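(* Let $n>m\ge 2$ and $t\ge 1$ be integers, $K$ a field, $S=K[x_1,\ldots,x_n]$, $S'=K[x_1,\ldots,x_{n-1}]$. Let $J=J_{n,m}\subset S$, $J'=(J:x_n)\cap S'$ and $I=I_{n-1,m}\subset S'$. For $1\le k\le t$ put $d_k:=\operatorname{depth}(S'/I^{t+1-k}J'^{k-1})$ and $s_k:=\operatorname{sdepth}(S'/I^{t+1-k}J'^{k-1})$. Then, for all $1\le k\le t$: (1) $d_k\geq \operatorname{depth}(S/(J^t:x_n^{k-1}))-1$. (2) If $\operatorname{depth}(S/(J^t:x_n^{k}))>\operatorname{depth}(S/(J^t:x_n^{k-1}))$, then $d_k = \operatorname{depth}(S/(J^t:x_n^{k-1}))$. (3) If $\operatorname{sdepth}(S/(J^t:x_n^{k}))>\operatorname{sdepth}(S/(J^t:x_n^{k-1}))$, then $s_k\leq \operatorname{sdepth}(S/(J^t:x_n^{k-1}))$.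
   Context: $J_{n,m}=(x_ix_{i+1}\cdots x_{i+m-1} : 1\le i\le n)\subset S$, where indices are read modulo $n$ in $\{1,\ldots,n\}$ ($m$-path ideal of the cycle graph on $n$ vertices). $I_{n-1,m}=(x_ix_{i+1}\cdots x_{i+m-1} : 1\le i\le n-m)\subset S'$ ($m$-path ideal of the path graph on $n-1$ vertices). The zeroth power of an ideal is the whole ring. $\operatorname{depth}$ is the depth of a finitely generated graded module with respect to the graded maximal ideal generated by the variables of the polynomial ring. For a monomial ideal $L\subsetneq R$ in a polynomial ring $R=K[x_1,\ldots,x_N]$, a Stanley decomposition of $M=R/L$ is a decomposition $\mathcal D: M=\bigoplus_{i=1}^r m_iK[Z_i]$ as a direct sum of $\mathbb Z^N$-graded $K$-vector spaces, where the $m_i\in R$ are monomials, $Z_i\subset\{x_1,\ldots,x_N\}$, and $m_iK[Z_i]$ denotes the $K$-span in $R/L$ of the classes of $m_iw$, $w$ a monomial in $Z_i$, these classes being linearly independent. Put $\operatorname{sdepth}(\mathcal D)=\min_i|Z_i|$; the Stanley depth $\operatorname{sdepth}(M)$ is the maximum of $\operatorname{sdepth}(\mathcal D)$ over all Stanley decompositions $\mathcal D$ of $M$. For $S/\cdot$ (resp. $S'/\cdot$) it is computed over $S$ (resp. $S'$). *)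

theory Defs
  imports
    "HOL-Algebra.QuotRing"
    "HOL-Algebra.Ideal_Product"
    "HOL-Algebra.Module"
    "HOL-Library.Poly_Mapping"
    "HOL-Library.Extended_Nat"
    "HOL-Library.FuncSet"
begin

section \<open>Polynomial rings in finitely many of the variables \<open>x\<^sub>0, x\<^sub>1, x\<^sub>2, \<dots>\<close>\<close>

text \<open>
  A monomial is its exponent vector \<open>nat \<Rightarrow>\<^sub>0 nat\<close>, a polynomial is a finitely supported
  map from monomials to coefficients. The coefficient field is the type \<open>'k\<close>, and all the rings
  \<open>K[X]\<close>, for sets \<open>X\<close> of variable indices, live in the same type; in particular
  \<open>K[X]\<close> is literally a subring of \<open>K[Y]\<close> when \<open>X \<subseteq> Y\<close>.
\<close>

type_synonym monomial = "nat \<Rightarrow>\<^sub>0 nat"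
type_synonym 'k mpoly = "monomial \<Rightarrow>\<^sub>0 'k"

definition monomial :: "monomial \<Rightarrow> 'k::field mpoly"
  where "monomial a = Poly_Mapping.single a 1"

definition var :: "nat \<Rightarrow> 'k::field mpoly"
  where "var i = monomial (Poly_Mapping.single i 1)"

definition poly_ring :: "nat set \<Rightarrow> 'k::field mpoly ring"  (\<open>K[_]\<close>)
  where "K[X] = \<lparr> carrier = {p. \<forall>a \<in> Poly_Mapping.keys p. Poly_Mapping.keys a \<subseteq> X},
                  mult = (*), one = 1, zero = 0, add = (+) \<rparr>"

definition graded_max_ideal :: "nat set \<Rightarrow> 'k::field mpoly set"
  where "graded_max_ideal X = Idl\<^bsub>K[X]\<^esub> (var ` X)"


section \<open>Ideals\<close>

definition colon :: "('a, 'b) ring_scheme \<Rightarrow> 'a set \<Rightarrow> 'a \<Rightarrow> 'a set"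
  where "colon R L f = {g \<in> carrier R. g \<otimes>\<^bsub>R\<^esub> f \<in> L}"

text \<open>Powers in the monoid of ideals, whose unit is the whole ring.\<close>

abbreviation ideal_power :: "('a, 'b) ring_scheme \<Rightarrow> 'a set \<Rightarrow> nat \<Rightarrow> 'a set"
  where "ideal_power R L k \<equiv> L [^]\<^bsub>ideals_set R\<^esub> k"

text \<open>The vertices are \<open>1, \<dots>, n\<close>; \<open>cyc n i\<close> is the representative of \<open>i\<close>
  modulo \<open>n\<close> in that range (for \<open>i \<ge> 1\<close>).\<close>

definition cyc :: "nat \<Rightarrow> nat \<Rightarrow> nat"
  where "cyc n i = (i - 1) mod n + 1"

definition cycle_path_ideal :: "nat \<Rightarrow> nat \<Rightarrow> 'k::field mpoly set"
  where "cycle_path_ideal n m =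
    Idl\<^bsub>K[{1..n}]\<^esub> {\<Prod>j<m. var (cyc n (i + j)) | i. 1 \<le> i \<and> i \<le> n}"

definition line_path_ideal :: "nat \<Rightarrow> nat \<Rightarrow> 'k::field mpoly set"
  where "line_path_ideal N m =
    Idl\<^bsub>K[{1..N}]\<^esub> {\<Prod>j<m. var (i + j) | i. 1 \<le> i \<and> i + m \<le> N + 1}"


section \<open>Depth\<close>

text \<open>The submodule \<open>(r\<^sub>1, \<dots>, r\<^sub>k) M\<close>.\<close>

definition list_smult :: "'a list \<Rightarrow> ('a, 'b, 'c) module_scheme \<Rightarrow> 'b set"
  where "list_smult rs M =
    {\<Oplus>\<^bsub>M\<^esub>i\<in>{..<length rs}. (rs ! i) \<odot>\<^bsub>M\<^esub> v i | v. v \<in> {..<length rs} \<rightarrow> carrier M}"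

text \<open>The first conjunct says that each \<open>r\<^sub>i\<close> acts injectively on
  \<open>M / (r\<^sub>1, \<dots>, r\<^sub>i\<^sub>-\<^sub>1) M\<close>.\<close>

definition regular_sequence :: "('a, 'b, 'c) module_scheme \<Rightarrow> 'a list \<Rightarrow> bool"
  where "regular_sequence M rs \<longleftrightarrow>
    (\<forall>i < length rs. \<forall>v \<in> carrier M.
        (rs ! i) \<odot>\<^bsub>M\<^esub> v \<in> list_smult (take i rs) M \<longrightarrow> v \<in> list_smult (take i rs) M)
    \<and> list_smult rs M \<noteq> carrier M"

definition depth :: "'a set \<Rightarrow> ('a, 'b, 'c) module_scheme \<Rightarrow> enat"
  where "depth Q M = (SUP rs \<in> {rs. set rs \<subseteq> Q \<and> regular_sequence M rs}. enat (length rs))"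

text \<open>\<open>R/L\<close> as an \<open>R\<close>-module.\<close>

definition quot_module :: "('a, 'b) ring_scheme \<Rightarrow> 'a set \<Rightarrow> ('a, 'a set) module"
  where "quot_module R L =
    ring.extend (R Quot L) (module.fields (\<lambda>r V. (L +>\<^bsub>R\<^esub> r) \<otimes>\<^bsub>R Quot L\<^esub> V))"

definition depth_quot :: "nat set \<Rightarrow> 'k::field mpoly set \<Rightarrow> enat"
  where "depth_quot X L = depth (graded_max_ideal X) (quot_module K[X] L)"


section \<open>Stanley depth\<close>

text \<open>The \<open>K\<close>-span in \<open>K[X]/L\<close> of the classes of the \<open>m w\<close>, where \<open>m\<close> is the
  monomial with exponent vector \<open>a\<close> and \<open>w\<close> runs through the monomials in \<open>Z\<close>: a linear
  combination of these \<open>w\<close> is just an element of \<open>K[Z]\<close>.\<close>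

definition stanley_space :: "nat set \<Rightarrow> 'k::field mpoly set \<Rightarrow> monomial \<Rightarrow> nat set \<Rightarrow> 'k mpoly set set"
  where "stanley_space X L a Z = {L +>\<^bsub>K[X]\<^esub> (monomial a * q) | q. q \<in> carrier K[Z]}"

text \<open>Linear independence of the classes of the \<open>m w\<close>.\<close>

definition independent_classes :: "'k::field mpoly set \<Rightarrow> monomial \<Rightarrow> nat set \<Rightarrow> bool"
  where "independent_classes L a Z \<longleftrightarrow>
    (\<forall>q \<in> carrier K[Z]. monomial a * q \<in> L \<longrightarrow> q = 0)"

text \<open>The summands are spanned by classes of monomials, so that for a monomial ideal \<open>L\<close> they
  are graded subspaces and the direct sum is one of \<open>\<int>\<^sup>N\<close>-graded spaces.\<close>

definition stanley_decomposition ::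
    "nat set \<Rightarrow> 'k::field mpoly set \<Rightarrow> (monomial \<times> nat set) list \<Rightarrow> bool"
  where "stanley_decomposition X L D \<longleftrightarrow>
    (\<forall>(a, Z) \<in> set D. Poly_Mapping.keys a \<subseteq> X \<and> Z \<subseteq> X \<and> independent_classes L a Z) \<and>
    (\<forall>v \<in> carrier (K[X] Quot L). \<exists>!c.
        c \<in> (\<Pi>\<^sub>E i\<in>{..<length D}. stanley_space X L (fst (D ! i)) (snd (D ! i))) \<and>
        v = (\<Oplus>\<^bsub>K[X] Quot L\<^esub>i\<in>{..<length D}. c i))"

text \<open>For \<open>L\<close> a proper ideal, \<open>D\<close> is never empty.\<close>

definition sdepth_decomposition :: "(monomial \<times> nat set) list \<Rightarrow> nat"
  where "sdepth_decomposition D = Min ((\<lambda>(a, Z). card Z) ` set D)"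

text \<open>For finite \<open>X\<close> and a proper monomial ideal \<open>L\<close> the supremum, taken in \<open>nat\<close>, is over
  a nonempty set bounded by \<open>card X\<close>, hence is the maximum.\<close>

definition sdepth_quot :: "nat set \<Rightarrow> 'k::field mpoly set \<Rightarrow> nat"
  where "sdepth_quot X L = (SUP D \<in> {D. stanley_decomposition X L D}. sdepth_decomposition D)"

end

theory Submission
  imports Defs
begin

text \<open>
  Put \<open>U\<^sub>s = (J\<^sup>t : x\<^sub>n\<^sup>s)\<close>. Since \<open>J = I S + x\<^sub>n J' S\<close> and \<open>I \<subseteq> J'\<close>, the coefficients of \<open>x\<^sub>n\<^sup>j\<close> of the elements
  of \<open>J\<^sup>t\<close> fill exactly \<open>I\<^sup>t\<^sup>-\<^sup>j J'\<^sup>j\<close> (\<open>J'\<^sup>t\<close> for \<open>j \<ge> t\<close>), so that \<open>U\<^sub>s\<close> is graded in \<open>x\<^sub>n\<close> and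
  \<open>S/(U\<^sub>s, x\<^sub>n) = S'/I\<^sup>t\<^sup>-\<^sup>s J'\<^sup>s\<close>. The exact sequence
  \<open>0 \<rightarrow> S/U\<^sub>s\<^sub>+\<^sub>1 \<rightarrow> S/U\<^sub>s \<rightarrow> S/(U\<^sub>s, x\<^sub>n) \<rightarrow> 0\<close> and the depth lemma give (2), and gluing Stanley
  decompositions of the outer terms gives (3).

  The depth lemma needs no homology: an element \<open>z\<close> regular on \<open>R/I\<close>, \<open>R/(I : x)\<close> and
  \<open>R/(I, x)\<close>, which exists by prime avoidance, satisfies \<open>((I, z) : x) = ((I : x), z)\<close>, so that one may
  pass from \<open>I\<close> to \<open>(I, z)\<close> and induct. For (1), regular elements are instead chosen in the maximal
  ideal of \<open>S'\<close>, which keeps the ideal graded in \<open>x\<^sub>n\<close>.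
\<close>

section \<open>Regular sequences on quotients of a ring\<close>

text \<open>The outer depths alone do not give (1): the depth lemma bounds the depth of
  \<open>S/(U_s, x_n)\<close> from below by the smaller of the depth of \<open>S/U_s\<close> and one
  less than the depth of \<open>S/U_{s+1}\<close>, and it does not compare these two. The grading
  takes the place of such a comparison. In depth one there need not be an element of the maximal
  ideal of \<open>S'\<close> that is regular on \<open>S/U_s\<close>, as the quotient
  \<open>K[x_n]\<close> shows; in depth two there is one, and an induction that loses one step never
  asks for less. Existence of regular elements is handled through its negation: over a Noetherian
  ring, prime avoidance turns the absence of a regular element into a nonzero class annihilated by
  the whole maximal ideal, and such classes can be chased through the exact sequence by hand.
  Reducing modulo \<open>z\<close> is harmless because every regular element begins a regular
  sequence of any attainable length. The condition \<open>m >= 2\<close> keeps \<open>x_n\<close>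
  itself from being a generator of \<open>J\<close>, so that \<open>J'\<close> and all
  \<open>U_s\<close> stay proper.\<close>

locale ring_carrier =
  fixes A :: "'a::comm_ring_1 set"
  assumes one_in: "1 \<in> A"
    and diff_in: "a \<in> A \<Longrightarrow> b \<in> A \<Longrightarrow> a - b \<in> A"
    and mult_in: "a \<in> A \<Longrightarrow> b \<in> A \<Longrightarrow> a * b \<in> A"
begin

lemma zero_in: "0 \<in> A"
  using diff_in[OF one_in one_in] by simp

lemma uminus_in: "a \<in> A \<Longrightarrow> - a \<in> A"
  using diff_in[OF zero_in] by simp

lemma add_in: "a \<in> A \<Longrightarrow> b \<in> A \<Longrightarrow> a + b \<in> A"
  using diff_in[OF _ uminus_in, of a b] by simp

lemmas ring_in = zero_in one_in add_in diff_in mult_in uminus_in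

lemma prod_in: "(\<And>i. i \<in> T \<Longrightarrow> f i \<in> A) \<Longrightarrow> prod f T \<in> A"
  by (induction T rule: infinite_finite_induct) (auto intro: ring_in)

section \<open>Ideals, colon ideals and generated ideals\<close>

definition is_ideal :: "'a set \<Rightarrow> bool" where
  "is_ideal I \<longleftrightarrow> I \<subseteq> A \<and> 0 \<in> I \<and> (\<forall>a\<in>I. \<forall>b\<in>I. a + b \<in> I) \<and> (\<forall>r\<in>A. \<forall>a\<in>I. r * a \<in> I)"

lemma is_idealI:
  assumes "I \<subseteq> A" "0 \<in> I" "\<And>a b. a \<in> I \<Longrightarrow> b \<in> I \<Longrightarrow> a + b \<in> I"
    "\<And>r a. r \<in> A \<Longrightarrow> a \<in> I \<Longrightarrow> r * a \<in> I"
  shows "is_ideal I"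
  using assms unfolding is_ideal_def by blast

lemma ideal_sub: "is_ideal I \<Longrightarrow> a \<in> I \<Longrightarrow> a \<in> A"
  by (auto simp: is_ideal_def)

lemma ideal_zero: "is_ideal I \<Longrightarrow> 0 \<in> I"
  by (auto simp: is_ideal_def)

lemma ideal_add: "is_ideal I \<Longrightarrow> a \<in> I \<Longrightarrow> b \<in> I \<Longrightarrow> a + b \<in> I"
  by (auto simp: is_ideal_def)

lemma ideal_mult: "is_ideal I \<Longrightarrow> r \<in> A \<Longrightarrow> a \<in> I \<Longrightarrow> r * a \<in> I"
  by (auto simp: is_ideal_def)

lemma ideal_mult': "is_ideal I \<Longrightarrow> r \<in> A \<Longrightarrow> a \<in> I \<Longrightarrow> a * r \<in> I"
  using ideal_mult[of I r a] by (simp add: mult.commute)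

lemma ideal_uminus: "is_ideal I \<Longrightarrow> a \<in> I \<Longrightarrow> - a \<in> I"
  using ideal_mult[of I "-1" a] uminus_in[OF one_in] by simp

lemma ideal_diff: "is_ideal I \<Longrightarrow> a \<in> I \<Longrightarrow> b \<in> I \<Longrightarrow> a - b \<in> I"
  using ideal_add[of I a "-b"] ideal_uminus by simp

lemma ideal_sum: "is_ideal I \<Longrightarrow> (\<And>i. i \<in> T \<Longrightarrow> f i \<in> I) \<Longrightarrow> sum f T \<in> I"
  by (induction T rule: infinite_finite_induct) (auto simp: ideal_zero ideal_add)

lemma ideal_carrier: "is_ideal A"
  by (rule is_idealI) (auto intro: ring_in)

lemma ideal_Inter:
  assumes "\<F> \<noteq> {}" "\<And>I. I \<in> \<F> \<Longrightarrow> is_ideal I"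
  shows "is_ideal (\<Inter>\<F>)"
proof (rule is_idealI)
  show "\<Inter>\<F> \<subseteq> A" using assms ideal_sub by blast
qed (use assms in \<open>auto intro: ideal_zero ideal_add ideal_mult\<close>)

text \<open>The colon ideal \<open>I : u\<close>, which is also the annihilator of the class of
  \<open>u\<close> in \<open>A/I\<close>; when prime, it is an associated prime of
  \<open>A/I\<close>.\<close>

definition quot :: "'a set \<Rightarrow> 'a \<Rightarrow> 'a set" where
  "quot I u = {v \<in> A. v * u \<in> I}"

lemma ideal_quot: "is_ideal I \<Longrightarrow> is_ideal (quot I u)"
  by (rule is_idealI)
     (auto simp: quot_def ring_in ideal_zero ideal_add distrib_right mult.assoc ideal_mult)

definition gen :: "'a set \<Rightarrow> 'a set" where
  "gen W = \<Inter>{I. is_ideal I \<and> W \<subseteq> I}"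

lemma ideal_gen: "W \<subseteq> A \<Longrightarrow> is_ideal (gen W)"
  unfolding gen_def by (rule ideal_Inter) (use ideal_carrier in auto)

lemma gen_superset: "W \<subseteq> gen W"
  by (auto simp: gen_def)

lemma gen_least: "is_ideal I \<Longrightarrow> W \<subseteq> I \<Longrightarrow> gen W \<subseteq> I"
  by (auto simp: gen_def)

lemma gen_mono: "V \<subseteq> W \<Longrightarrow> gen V \<subseteq> gen W"
  by (auto simp: gen_def)

text \<open>The elements lying in \<open>gen F\<close> for some finite part \<open>F\<close> of
  \<open>W\<close> already form an ideal, because two such parts can be united; no linear
  combinations have to be written out.\<close>

lemma gen_finite_subset:
  assumes W: "W \<subseteq> A" and p: "p \<in> gen W"
  shows "\<exists>F. finite F \<and> F \<subseteq> W \<and> p \<in> gen F"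
proof -
  define I where "I = {p. \<exists>F. finite F \<and> F \<subseteq> W \<and> p \<in> gen F}"
  have id: "is_ideal (gen F)" if "F \<subseteq> W" for F using that W by (intro ideal_gen) auto
  have "is_ideal I"
  proof (rule is_idealI)
    show "I \<subseteq> A" using ideal_sub[OF id] by (auto simp: I_def)
    show "0 \<in> I" unfolding I_def using id[of "{}"] ideal_zero by blast
    fix a b assume "a \<in> I" "b \<in> I"
    then obtain F G where F: "finite F" "F \<subseteq> W" "a \<in> gen F" "finite G" "G \<subseteq> W" "b \<in> gen G"
      unfolding I_def by blast
    then have "a \<in> gen (F \<union> G)" "b \<in> gen (F \<union> G)"
      using gen_mono[of F "F \<union> G"] gen_mono[of G "F \<union> G"] by auto
    with F show "a + b \<in> I" unfolding I_def
      by (intro CollectI exI[of _ "F \<union> G"]) (auto intro: ideal_add id)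
  next
    fix r a assume "r \<in> A" "a \<in> I"
    then show "r * a \<in> I" unfolding I_def using id ideal_mult by blast
  qed
  moreover have "W \<subseteq> I"
  proof
    fix w assume "w \<in> W"
    then show "w \<in> I" unfolding I_def using gen_superset[of "{w}"]
      by (intro CollectI exI[of _ "{w}"]) auto
  qed
  ultimately show ?thesis using p gen_least[of I W] unfolding I_def by blast
qed

section \<open>Adjoining one element; regular elements\<close>

definition adjoin :: "'a set \<Rightarrow> 'a \<Rightarrow> 'a set" where
  "adjoin I f = {a + r * f | a r. a \<in> I \<and> r \<in> A}"

lemma adjoinI: "a \<in> I \<Longrightarrow> r \<in> A \<Longrightarrow> a + r * f \<in> adjoin I f"
  by (auto simp: adjoin_def)

lemma adjoinE:
  assumes "p \<in> adjoin I f"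
  obtains a r where "a \<in> I" "r \<in> A" "p = a + r * f"
  using assms by (auto simp: adjoin_def)

lemma adjoin_sub: "I \<subseteq> adjoin I f"
  using adjoinI[of _ I 0 f] zero_in by auto

lemma adjoin_gen: "is_ideal I \<Longrightarrow> r \<in> A \<Longrightarrow> r * f \<in> adjoin I f"
  using adjoinI[of 0 I r f] ideal_zero by auto

lemma adjoin_gen1: "is_ideal I \<Longrightarrow> f \<in> adjoin I f"
  using adjoin_gen[of I 1 f] one_in by auto

lemma adjoin_least: "is_ideal K \<Longrightarrow> I \<subseteq> K \<Longrightarrow> f \<in> K \<Longrightarrow> adjoin I f \<subseteq> K"
  by (auto simp: adjoin_def intro!: ideal_add ideal_mult)

lemma ideal_adjoin:
  assumes I: "is_ideal I" and f: "f \<in> A"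
  shows "is_ideal (adjoin I f)"
proof (rule is_idealI)
  show "adjoin I f \<subseteq> A" using ideal_sub[OF I] f by (auto simp: adjoin_def intro!: ring_in)
  show "0 \<in> adjoin I f" using adjoin_sub ideal_zero[OF I] by blast
next
  fix a b assume "a \<in> adjoin I f" "b \<in> adjoin I f"
  then obtain c r d s where c: "c \<in> I" "r \<in> A" "a = c + r * f" "d \<in> I" "s \<in> A" "b = d + s * f"
    by (auto simp: adjoin_def)
  then have "a + b = (c + d) + (r + s) * f" by (simp add: algebra_simps)
  then show "a + b \<in> adjoin I f"
    using adjoinI[OF ideal_add[OF I c(1) c(4)] add_in[OF c(2) c(5)]] by simp
next
  fix s a assume "s \<in> A" "a \<in> adjoin I f"
  then obtain c r where c: "c \<in> I" "r \<in> A" "a = c + r * f"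
    by (auto simp: adjoin_def)
  then have "s * a = s * c + (s * r) * f" by (simp add: algebra_simps)
  then show "s * a \<in> adjoin I f"
    using adjoinI[OF ideal_mult[OF I \<open>s \<in> A\<close> c(1)] mult_in[OF \<open>s \<in> A\<close> c(2)]] by simp
qed

lemma adjoin_commute: "adjoin (adjoin I f) g = adjoin (adjoin I g) f"
proof -
  have "adjoin (adjoin I f) g \<subseteq> adjoin (adjoin I g) f" for f g
  proof
    fix p assume "p \<in> adjoin (adjoin I f) g"
    then obtain a r s where "a \<in> I" "r \<in> A" "s \<in> A" "p = (a + s * g) + r * f"
      by (auto simp: adjoin_def algebra_simps)
    then show "p \<in> adjoin (adjoin I g) f" by (auto intro!: adjoinI)
  qed
  then show ?thesis by blast
qed

definition nonzerodiv :: "'a set \<Rightarrow> 'a \<Rightarrow> bool" where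
  "nonzerodiv I f \<longleftrightarrow> (\<forall>v\<in>A. f * v \<in> I \<longrightarrow> v \<in> I)"

lemma nonzerodivD: "nonzerodiv I f \<Longrightarrow> v \<in> A \<Longrightarrow> f * v \<in> I \<Longrightarrow> v \<in> I"
  by (auto simp: nonzerodiv_def)

text \<open>The half of the permutability of a regular pair that holds without any local or graded
  setting: in \<open>z v = r w\<close> modulo \<open>I\<close>, the factor \<open>r\<close> is a
  multiple of \<open>z\<close>, which then cancels. The other half, regularity of \<open>w\<close>
  on \<open>A/I\<close>, is secured in the applications by the choice of \<open>w\<close>.\<close>

lemma nonzerodiv_swap:
  assumes I: "is_ideal I" and w: "w \<in> A" and z: "z \<in> A"
    and zI: "nonzerodiv I z" and wz: "nonzerodiv (adjoin I z) w"
  shows "nonzerodiv (adjoin I w) z"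
  unfolding nonzerodiv_def
proof safe
  fix v assume v: "v \<in> A" and "z * v \<in> adjoin I w"
  then obtain a r where a: "a \<in> I" "r \<in> A" "z * v = a + r * w" by (elim adjoinE)
  have "w * r = (- a) + v * z" using a by (simp add: algebra_simps)
  then have "r \<in> adjoin I z"
    using nonzerodivD[OF wz \<open>r \<in> A\<close>] adjoinI[OF ideal_uminus[OF I a(1)] v, of z] by simp
  then obtain b s where b: "b \<in> I" "s \<in> A" "r = b + s * z" by (elim adjoinE)
  have "z * (v - s * w) = a + w * b" using a b by (simp add: algebra_simps)
  then have "v - s * w \<in> I"
    using nonzerodivD[OF zI, of "v - s * w"] v b w a ideal_add[OF I a(1) ideal_mult[OF I w b(1)]]
    by (simp add: ring_in)
  then show "v \<in> adjoin I w" using adjoinI[of "v - s * w" I s w] b by simp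
qed

text \<open>Reducing \<open>0 \<rightarrow> A/(I : x) \<rightarrow> A/I \<rightarrow> A/(I, x)
  \<rightarrow> 0\<close> modulo \<open>z\<close> keeps it exact on the left, since the obstruction
  is the kernel of \<open>z\<close> on the right-hand term.\<close>

lemma quot_adjoin:
  assumes I: "is_ideal I" and x: "x \<in> A" and z: "z \<in> A"
    and reg: "nonzerodiv (adjoin I x) z"
  shows "quot (adjoin I z) x = adjoin (quot I x) z"
proof
  show "quot (adjoin I z) x \<subseteq> adjoin (quot I x) z"
  proof
    fix u assume "u \<in> quot (adjoin I z) x"
    then obtain a r where a: "u \<in> A" "a \<in> I" "r \<in> A" "u * x = a + r * z"
      by (auto simp: quot_def elim!: adjoinE)
    have "z * r = (- a) + u * x" using a by (simp add: algebra_simps)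
    then have "r \<in> adjoin I x"
      using nonzerodivD[OF reg \<open>r \<in> A\<close>] adjoinI[OF ideal_uminus[OF I a(2)] a(1), of x] by simp
    then obtain b s where b: "b \<in> I" "s \<in> A" "r = b + s * x" by (elim adjoinE)
    have "(u - s * z) * x = a + z * b" using a b by (simp add: algebra_simps)
    then have "u - s * z \<in> quot I x"
      using a b z ideal_add[OF I a(2) ideal_mult[OF I z b(1)]] by (simp add: quot_def ring_in)
    then show "u \<in> adjoin (quot I x) z" using adjoinI[of "u - s * z" _ s z] b by simp
  qed
  show "adjoin (quot I x) z \<subseteq> quot (adjoin I z) x"
  proof
    fix u assume "u \<in> adjoin (quot I x) z"
    then obtain a r where a: "a \<in> A" "a * x \<in> I" "r \<in> A" "u = a + r * z"
      by (auto simp: quot_def elim!: adjoinE)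
    then have "u * x = a * x + (r * x) * z" by (simp add: algebra_simps)
    then show "u \<in> quot (adjoin I z) x"
      using a x z adjoinI[OF a(2) mult_in[OF a(3) x]] by (simp add: quot_def ring_in)
  qed
qed

section \<open>Regular sequences and socles\<close>

fun regseq :: "'a set \<Rightarrow> 'a list \<Rightarrow> bool" where
  "regseq I [] = True"
| "regseq I (f # fs) = (nonzerodiv I f \<and> regseq (adjoin I f) fs)"

text \<open>A predicate in \<open>k\<close> instead of a supremum: comparisons of depths become
  implications proved by induction on \<open>k\<close>, with no special treatment of infinite
  values.\<close>

definition grade_ge :: "'a set \<Rightarrow> 'a set \<Rightarrow> nat \<Rightarrow> bool" where
  "grade_ge E I k \<longleftrightarrow> (\<exists>fs. set fs \<subseteq> E \<and> length fs = k \<and> regseq I fs)"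

lemma grade_ge_0: "grade_ge E I 0"
  by (auto simp: grade_ge_def)

lemma grade_ge_Suc:
  "grade_ge E I (Suc k) \<longleftrightarrow> (\<exists>f\<in>E. nonzerodiv I f \<and> grade_ge E (adjoin I f) k)"
proof
  assume "grade_ge E I (Suc k)"
  then obtain fs where "set fs \<subseteq> E" "length fs = Suc k" "regseq I fs"
    by (auto simp: grade_ge_def)
  then show "\<exists>f\<in>E. nonzerodiv I f \<and> grade_ge E (adjoin I f) k"
    by (cases fs) (auto simp: grade_ge_def)
next
  assume "\<exists>f\<in>E. nonzerodiv I f \<and> grade_ge E (adjoin I f) k"
  then obtain f fs where "f \<in> E" "nonzerodiv I f" "set fs \<subseteq> E" "length fs = k" "regseq (adjoin I f) fs"
    by (auto simp: grade_ge_def)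
  then show "grade_ge E I (Suc k)" unfolding grade_ge_def
    by (intro exI[of _ "f # fs"]) auto
qed

lemma grade_ge_mono: "grade_ge E I k \<Longrightarrow> j \<le> k \<Longrightarrow> grade_ge E I j"
proof (induction k arbitrary: I j)
  case (Suc k)
  then show ?case by (cases j) (auto simp: grade_ge_0 grade_ge_Suc)
qed simp

text \<open>The vanishing of \<open>Hom(A/(E), A/I)\<close>. Over a Noetherian ring, and for
  \<open>E\<close> closed under sums and products, prime avoidance makes this equivalent to the
  existence of one regular element in \<open>E\<close>.\<close>

definition socle_free :: "'a set \<Rightarrow> 'a set \<Rightarrow> bool" where
  "socle_free E I \<longleftrightarrow> (\<forall>u\<in>A. (\<forall>e\<in>E. e * u \<in> I) \<longrightarrow> u \<in> I)"

lemma socle_freeD: "socle_free E I \<Longrightarrow> u \<in> A \<Longrightarrow> (\<And>e. e \<in> E \<Longrightarrow> e * u \<in> I) \<Longrightarrow> u \<in> I"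
  by (auto simp: socle_free_def)

lemma nonzerodiv_imp_socle_free: "z \<in> E \<Longrightarrow> nonzerodiv I z \<Longrightarrow> socle_free E I"
  by (auto simp: socle_free_def nonzerodiv_def)

text \<open>Both conditions express the vanishing of \<open>Ext^1(A/(E), A/I)\<close>. The
  isomorphism behind this sends \<open>u\<close> modulo \<open>(I, y)\<close> to the element
  \<open>v\<close> modulo \<open>(I, x)\<close> with \<open>x u = y v\<close> modulo
  \<open>I\<close>.\<close>

lemma socle_free_adjoin_exchange:
  assumes I: "is_ideal I" and E: "E \<subseteq> A" and x: "x \<in> E" "nonzerodiv I x"
    and y: "y \<in> E" "nonzerodiv I y" and Ix: "socle_free E (adjoin I x)"
  shows "socle_free E (adjoin I y)"
  unfolding socle_free_def
proof safe
  fix u assume u: "u \<in> A" and Eu: "\<forall>e\<in>E. e * u \<in> adjoin I y"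
  have xy: "x \<in> A" "y \<in> A" using x y E by auto
  obtain a v where a: "a \<in> I" "v \<in> A" "x * u = a + v * y"
    using Eu x unfolding adjoin_def by blast
  have "v \<in> adjoin I x"
  proof (rule socle_freeD[OF Ix \<open>v \<in> A\<close>])
    fix e assume e: "e \<in> E"
    with Eu E obtain b w where b: "b \<in> I" "w \<in> A" "e * u = b + w * y" "e \<in> A"
      unfolding adjoin_def by blast
    \<comment> \<open>Modulo \<open>I\<close> one has \<open>y e v = e x u = x w y\<close>;
      cancelling \<open>y\<close> leaves \<open>e v = w x\<close>.\<close>
    have "y * (e * v) = e * (x * u) - e * a" using a by (simp add: algebra_simps)
    also have "e * (x * u) = x * (e * u)" by (simp add: algebra_simps)
    also have "\<dots> - e * a = x * b + x * w * y - e * a" using b by (simp add: algebra_simps)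
    finally have "y * (e * v - w * x) = x * b - e * a" by (simp add: algebra_simps)
    then have "e * v - w * x \<in> I"
      using nonzerodivD[OF y(2), of "e * v - w * x"] a b xy
        ideal_diff[OF I ideal_mult[OF I xy(1) b(1)] ideal_mult[OF I b(4) a(1)]]
      by (simp add: ring_in)
    then show "e * v \<in> adjoin I x" using adjoinI[of "e * v - w * x" I w x] b by simp
  qed
  then obtain b w where b: "b \<in> I" "w \<in> A" "v = b + w * x" by (elim adjoinE)
  have "x * (u - w * y) = a + y * b" using a b by (simp add: algebra_simps)
  then have "u - w * y \<in> I"
    using nonzerodivD[OF x(2), of "u - w * y"] a b xy u ideal_add[OF I a(1) ideal_mult[OF I xy(2) b(1)]]
    by (simp add: ring_in)
  then show "u \<in> adjoin I y" using adjoinI[of "u - w * y" I w y] b by simp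
qed

section \<open>Prime ideals and prime avoidance\<close>

definition is_prime :: "'a set \<Rightarrow> bool" where
  "is_prime P \<longleftrightarrow> is_ideal P \<and> (\<forall>a\<in>A. \<forall>b\<in>A. a * b \<in> P \<longrightarrow> a \<in> P \<or> b \<in> P)"

lemma prime_prod:
  assumes "is_prime P" "finite T" "T \<noteq> {}" "\<And>i. i \<in> T \<Longrightarrow> f i \<in> A" "prod f T \<in> P"
  shows "\<exists>i\<in>T. f i \<in> P"
  using assms(2-)
proof (induction T rule: finite_ne_induct)
  case (insert i T)
  have "prod f T \<in> A"
    using insert.prems(1) by (intro prod_in) auto
  then show ?case using insert assms(1) unfolding is_prime_def by auto
qed simp

text \<open>\<open>E\<close> need not be an ideal: it will also be the maximal ideal of a subring.\<close>

lemma prime_avoidance: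
  assumes "finite \<P>" "\<And>P. P \<in> \<P> \<Longrightarrow> is_prime P" and E: "E \<subseteq> A" "E \<noteq> {}"
    "\<And>a b. a \<in> E \<Longrightarrow> b \<in> E \<Longrightarrow> a + b \<in> E" "\<And>a b. a \<in> E \<Longrightarrow> b \<in> E \<Longrightarrow> a * b \<in> E"
    and "E \<subseteq> \<Union>\<P>"
  shows "\<exists>P\<in>\<P>. E \<subseteq> P"
  using assms(1,2,7)
proof (induction \<P> rule: finite_psubset_induct)
  case (psubset \<P>)
  show ?case
  proof (cases "\<exists>P\<in>\<P>. E \<subseteq> \<Union>(\<P> - {P})")
    case True
    then obtain P where "P \<in> \<P>" "E \<subseteq> \<Union>(\<P> - {P})" by blast
    then show ?thesis using psubset.IH[of "\<P> - {P}"] psubset.prems(1) by auto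
  next
    case False
    then have "\<forall>P\<in>\<P>. \<exists>e. e \<in> E \<and> e \<notin> \<Union>(\<P> - {P})" by blast
    then obtain e where e: "\<And>P. P \<in> \<P> \<Longrightarrow> e P \<in> E" "\<And>P. P \<in> \<P> \<Longrightarrow> e P \<notin> \<Union>(\<P> - {P})"
      by metis
    have eP: "e P \<in> P" if "P \<in> \<P>" for P using e[OF that] psubset.prems(2) that by blast
    have eQ: "e P \<notin> Q" if "P \<in> \<P>" "Q \<in> \<P>" "P \<noteq> Q" for P Q using e(2)[of P] that by blast
    have "\<P> \<noteq> {}" using E psubset.prems by auto
    then obtain P where P: "P \<in> \<P>" by blast
    show ?thesis
    proof (cases "\<P> = {P}")
      case True
      then show ?thesis using psubset.prems by auto
    next
      case ne: False
      define T where "T = \<P> - {P}"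
      have T: "finite T" "T \<noteq> {}" using psubset.hyps P ne by (auto simp: T_def)
      have eT: "e Q \<in> E" if "Q \<in> T" for Q using that e by (auto simp: T_def)
      have "prod e U \<in> E" if "finite U" "U \<noteq> {}" "U \<subseteq> T" for U
        using that by (induction U rule: finite_ne_induct) (auto simp: eT E)
      then have yE: "prod e T \<in> E" using T by auto
      have yP: "prod e T \<notin> P"
        using prime_prod[of P T e] psubset.prems(1)[OF P] T eT E(1) eQ P unfolding T_def by blast
      have yQ: "prod e T \<in> Q" if "Q \<in> T" for Q
      proof -
        have Q: "is_ideal Q" "Q \<in> \<P>" using psubset.prems(1) that by (auto simp: T_def is_prime_def)
        have "prod e (T - {Q}) \<in> A" using eT E(1)
          by (intro prod_in) auto
        then show ?thesis using T that eP[OF Q(2)] ideal_mult'[OF Q(1)] 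
          by (simp add: prod.remove[of T Q])
      qed
      \<comment> \<open>\<open>e P\<close> lies in \<open>P\<close> and in no other prime of the
        cover, the product in all the others and not in \<open>P\<close>; so the sum avoids every
        one of them.\<close>
      have "e P + prod e T \<in> E" using yE e P E by auto
      then obtain Q where Q: "Q \<in> \<P>" "e P + prod e T \<in> Q" using psubset.prems(2) by blast
      have Qi: "is_ideal Q" using psubset.prems(1) Q by (auto simp: is_prime_def)
      have False
      proof (cases "Q = P")
        case True
        then show False using ideal_diff[OF Qi Q(2), of "e P"] eP[OF P] yP by auto
      next
        case False
        then have "prod e T \<in> Q" using yQ Q by (auto simp: T_def)
        then show False using ideal_diff[OF Qi Q(2), of "prod e T"] eQ[OF P Q(1)] False by auto
      qed
      then show ?thesis ..
    qed
  qed
qed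

end

section \<open>Grade over a Noetherian ring\<close>

text \<open>The generators are required inside the given set: in
  \<open>finitely_many_associated_primes\<close> they must themselves be classes with prime
  annihilator.\<close>

locale noetherian_carrier = ring_carrier +
  assumes finitely_generated: "W \<subseteq> A \<Longrightarrow> \<exists>F. finite F \<and> F \<subseteq> W \<and> W \<subseteq> gen F"
begin

text \<open>The union of a chain is generated by finitely many of its elements, and these already
  lie in one member of the chain.\<close>

lemma ex_maximal_member:
  assumes "\<F> \<noteq> {}" and ideals: "\<And>I. I \<in> \<F> \<Longrightarrow> is_ideal I"
  shows "\<exists>M\<in>\<F>. \<forall>I\<in>\<F>. M \<subseteq> I \<longrightarrow> I = M"
proof (rule subset_Zorn_nonempty[OF assms(1)])
  fix \<C> assume C: "\<C> \<noteq> {}" "subset.chain \<F> \<C>"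
  have CF: "\<C> \<subseteq> \<F>" using C by (simp add: subset_chain_def)
  then have "\<Union>\<C> \<subseteq> A" using ideal_sub[OF ideals] by (meson Union_least subsetD subsetI)
  from finitely_generated[OF this]
  obtain F where F: "finite F" "F \<subseteq> \<Union>\<C>" "\<Union>\<C> \<subseteq> gen F" by blast
  obtain I where I: "I \<in> \<C>" "F \<subseteq> I" by (rule finite_subset_Union_chain[OF F(1,2) C])
  then have "gen F \<subseteq> I" using ideals CF by (intro gen_least) auto
  then have "\<Union>\<C> = I" using F I by blast
  then show "\<Union>\<C> \<in> \<F>" using I CF by blast
qed

section \<open>Associated primes and common regular elements\<close>

lemma maximal_quot_prime:
  assumes I: "is_ideal I" and u: "u \<in> A" "u \<notin> I"
    and max: "\<And>v. v \<in> A \<Longrightarrow> v \<notin> I \<Longrightarrow> quot I u \<subseteq> quot I v \<Longrightarrow> quot I v = quot I u"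
  shows "is_prime (quot I u)"
  unfolding is_prime_def
proof (intro conjI ballI impI)
  show "is_ideal (quot I u)" by (rule ideal_quot[OF I])
  fix a b assume ab: "a \<in> A" "b \<in> A" "a * b \<in> quot I u"
  show "a \<in> quot I u \<or> b \<in> quot I u"
  proof (rule disjCI)
    assume "b \<notin> quot I u"
    then have bu: "b * u \<notin> I" using ab by (simp add: quot_def)
    have "quot I u \<subseteq> quot I (b * u)"
      using ideal_mult[OF I ab(2)] by (auto simp: quot_def mult.left_commute[of _ b])
    then have "quot I (b * u) = quot I u" using max[OF mult_in[OF ab(2) u(1)] bu] by blast
    then show "a \<in> quot I u" using ab by (auto simp: quot_def mult.assoc)
  qed
qed

text \<open>Stands in for primary decomposition. \<open>W\<close> collects the representatives of
  nonzero classes with maximal annihilator, which is prime, and a finite \<open>F\<close> inside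
  \<open>W\<close> generates an ideal containing \<open>W\<close>. No maximal annihilator is missing
  from \<open>F\<close>: if for every \<open>u\<close> in \<open>F\<close> some \<open>c u\<close>
  killing \<open>u\<close> were outside the prime \<open>quot I w\<close>, the product of the
  \<open>c u\<close> would be outside as well, although it kills all of \<open>F\<close> and hence
  \<open>w\<close>.\<close>

lemma finitely_many_associated_primes:
  assumes I: "is_ideal I"
  shows "\<exists>U. finite U \<and> U \<subseteq> A - I \<and> (\<forall>u\<in>U. is_prime (quot I u)) \<and>
    (\<forall>z\<in>A. (\<forall>u\<in>U. z \<notin> quot I u) \<longrightarrow> nonzerodiv I z)"
proof -
  define W where
    "W = {u \<in> A - I. \<forall>v\<in>A - I. quot I u \<subseteq> quot I v \<longrightarrow> quot I v = quot I u}"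
  have Wp: "is_prime (quot I w)" if "w \<in> W" for w
    using that unfolding W_def by (intro maximal_quot_prime[OF I]) blast+
  have "W \<subseteq> A" by (auto simp: W_def)
  from finitely_generated[OF this]
  obtain F where F: "finite F" "F \<subseteq> W" "W \<subseteq> gen F" by blast
  have "nonzerodiv I z" if z: "z \<in> A" "\<forall>u\<in>F. z \<notin> quot I u" for z
  proof (rule ccontr)
    assume "\<not> nonzerodiv I z"
    then obtain v where v: "v \<in> A" "z * v \<in> I" "v \<notin> I" by (auto simp: nonzerodiv_def)
    \<comment> \<open>A maximal annihilator of a nonzero class above that of \<open>v\<close> still
      contains \<open>z\<close>, and its class belongs to \<open>W\<close>.\<close>
    let ?\<F> = "{quot I w | w. w \<in> A - I \<and> quot I v \<subseteq> quot I w}"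
    have "\<exists>M\<in>?\<F>. \<forall>I\<in>?\<F>. M \<subseteq> I \<longrightarrow> I = M"
      using v by (intro ex_maximal_member) (auto intro: ideal_quot[OF I])
    then obtain M where M: "M \<in> ?\<F>" "\<And>K. K \<in> ?\<F> \<Longrightarrow> M \<subseteq> K \<Longrightarrow> K = M" by auto
    then obtain w where w: "M = quot I w" "w \<in> A - I" "quot I v \<subseteq> quot I w" by auto
    have "quot I w' = quot I w" if "w' \<in> A - I" "quot I w \<subseteq> quot I w'" for w'
    proof -
      have "quot I w' \<in> ?\<F>" using that w by blast
      then show ?thesis using M(2) that w by blast
    qed
    then have wW: "w \<in> W" using w by (auto simp: W_def)
    have zw: "z \<in> quot I w" using w v z by (auto simp: quot_def)
    have "\<exists>u\<in>F. quot I u \<subseteq> quot I w"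
    proof (rule ccontr)
      assume "\<not> ?thesis"
      then have "\<forall>u\<in>F. \<exists>c. c \<in> quot I u \<and> c \<notin> quot I w" by blast
      then obtain c where c: "\<And>u. u \<in> F \<Longrightarrow> c u \<in> quot I u" "\<And>u. u \<in> F \<Longrightarrow> c u \<notin> quot I w"
        by metis
      have cA: "c u \<in> A" if "u \<in> F" for u using c(1)[OF that] by (auto simp: quot_def)
      have pA: "prod c T \<in> A" if "T \<subseteq> F" for T using cA that by (intro prod_in) auto
      have "prod c F \<notin> quot I w"
      \<comment> \<open>The empty product is 1, which does not kill the nonzero class of
        \<open>w\<close>.\<close>
      proof (cases "F = {}")
        case True
        then show ?thesis using w by (simp add: quot_def)
      next
        case False
        then show ?thesis using prime_prod[OF Wp[OF wW] F(1) False, of c] c cA by blast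
      qed
      moreover have "gen F \<subseteq> quot I (prod c F)"
      proof (rule gen_least[OF ideal_quot[OF I]], rule subsetI)
        fix u assume u: "u \<in> F"
        have "c u * u \<in> I" using c(1)[OF u] by (simp add: quot_def)
        then have "prod c (F - {u}) * (c u * u) \<in> I" using ideal_mult[OF I pA] by auto
        then have "u * prod c F \<in> I" using u F by (simp add: prod.remove[of F u] mult_ac)
        then show "u \<in> quot I (prod c F)" using u F \<open>W \<subseteq> A\<close> by (auto simp: quot_def)
      qed
      ultimately show False using F wW pA[of F] by (auto simp: quot_def mult.commute)
    qed
    then obtain u where u: "u \<in> F" "quot I u \<subseteq> quot I w" by blast
    then have "quot I w = quot I u" using F w by (auto simp: W_def)
    then show False using zw z u by auto
  qed
  moreover have "F \<subseteq> A - I" using F by (auto simp: W_def)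
  ultimately show ?thesis using F Wp by (intro exI[of _ F]) blast
qed

text \<open>Weaker than being an ideal: \<open>aug X\<close> is not an ideal of
  \<open>polys (insert x X)\<close>, yet regular elements of the larger ring will be sought in
  it.\<close>

definition add_mult_closed :: "'a set \<Rightarrow> bool" where
  "add_mult_closed E \<longleftrightarrow>
    E \<subseteq> A \<and> E \<noteq> {} \<and> (\<forall>a\<in>E. \<forall>b\<in>E. a + b \<in> E) \<and> (\<forall>a\<in>E. \<forall>b\<in>E. a * b \<in> E)"

lemma ideal_add_mult_closed: "is_ideal I \<Longrightarrow> add_mult_closed I"
  using ideal_sub[of I] ideal_zero[of I] ideal_add[of I] ideal_mult[of I]
  unfolding add_mult_closed_def by blast

text \<open>Prime avoidance for the maximal associated primes of all the quotients together. If
  \<open>E\<close> were inside one of them, say \<open>quot I u\<close>, the nonzero class of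
  \<open>u\<close> would be killed by \<open>E\<close>.\<close>

lemma ex_common_nonzerodiv:
  assumes "finite \<I>" and I: "\<And>I. I \<in> \<I> \<Longrightarrow> is_ideal I" and E: "add_mult_closed E"
    and free: "\<And>I. I \<in> \<I> \<Longrightarrow> socle_free E I"
  shows "\<exists>z\<in>E. \<forall>I\<in>\<I>. nonzerodiv I z"
proof -
  have "\<forall>I\<in>\<I>. \<exists>U. finite U \<and> U \<subseteq> A - I \<and> (\<forall>u\<in>U. is_prime (quot I u)) \<and>
    (\<forall>z\<in>A. (\<forall>u\<in>U. z \<notin> quot I u) \<longrightarrow> nonzerodiv I z)"
    using finitely_many_associated_primes[OF I] by blast
  then obtain U where U: "\<And>I. I \<in> \<I> \<Longrightarrow> finite (U I)" "\<And>I. I \<in> \<I> \<Longrightarrow> U I \<subseteq> A - I"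
    "\<And>I u. I \<in> \<I> \<Longrightarrow> u \<in> U I \<Longrightarrow> is_prime (quot I u)"
    "\<And>I z. I \<in> \<I> \<Longrightarrow> z \<in> A \<Longrightarrow> (\<And>u. u \<in> U I \<Longrightarrow> z \<notin> quot I u) \<Longrightarrow> nonzerodiv I z"
    by metis
  define \<P> where "\<P> = (\<Union>I\<in>\<I>. quot I ` U I)"
  have "\<not> E \<subseteq> \<Union>\<P>"
  proof
    assume "E \<subseteq> \<Union>\<P>"
    then have "\<exists>P\<in>\<P>. E \<subseteq> P" using E U assms(1)
      by (intro prime_avoidance) (auto simp: \<P>_def add_mult_closed_def)
    then obtain I u where Iu: "I \<in> \<I>" "u \<in> U I" "E \<subseteq> quot I u" by (auto simp: \<P>_def)
    have u: "u \<in> A" "u \<notin> I" using U(2)[OF Iu(1)] Iu(2) by auto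
    have "e * u \<in> I" if "e \<in> E" for e using Iu(3) that by (auto simp: quot_def)
    then show False using socle_freeD[OF free[OF Iu(1)] u(1)] u(2) by blast
  qed
  then obtain z where z: "z \<in> E" "z \<notin> \<Union>\<P>" by blast
  then have "z \<in> A" using E by (auto simp: add_mult_closed_def)
  have "nonzerodiv I z" if "I \<in> \<I>" for I
    using U(4)[OF that \<open>z \<in> A\<close>] z that by (auto simp: \<P>_def)
  then show ?thesis using z by blast
qed

lemma grade_ge_Suc_imp_socle_free: "grade_ge E I (Suc k) \<Longrightarrow> socle_free E I"
  by (auto simp: grade_ge_Suc intro: nonzerodiv_imp_socle_free)

text \<open>Takes the place of the theorem that maximal regular sequences have equal length: any
  regular \<open>z\<close> may serve as the first element of a sequence of attainable
  length.\<close>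

lemma grade_ge_adjoin:
  assumes E: "add_mult_closed E"
  shows "is_ideal I \<Longrightarrow> z \<in> E \<Longrightarrow> nonzerodiv I z \<Longrightarrow> grade_ge E I (Suc k) \<Longrightarrow> grade_ge E (adjoin I z) k"
proof (induction k arbitrary: I z)
  case 0
  show ?case by (rule grade_ge_0)
next
  case (Suc k)
  note I = Suc.prems(1)
  have EA: "E \<subseteq> A" using E by (simp add: add_mult_closed_def)
  obtain f where f: "f \<in> E" "nonzerodiv I f" "grade_ge E (adjoin I f) (Suc k)"
    using Suc.prems by (auto simp: grade_ge_Suc[of _ I])
  have fz: "f \<in> A" "z \<in> A" using f Suc.prems EA by auto
  note If = ideal_adjoin[OF I fz(1)] and Iz = ideal_adjoin[OF I fz(2)]
  have sf: "socle_free E (adjoin I f)" by (rule grade_ge_Suc_imp_socle_free[OF f(3)])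
  have sz: "socle_free E (adjoin I z)"
    by (rule socle_free_adjoin_exchange[OF I EA f(1,2) Suc.prems(2,3) sf])
  have s: "socle_free E I" by (rule nonzerodiv_imp_socle_free[OF f(1,2)])
  \<comment> \<open>\<open>w\<close> mediates between \<open>f\<close> and \<open>z\<close>: it
    first replaces \<open>f\<close> (induction on \<open>(I, f)\<close>, then a swap), after which
    \<open>z\<close> is treated modulo \<open>w\<close> (induction on
    \<open>(I, w)\<close>).\<close>
  have "\<exists>w\<in>E. \<forall>K\<in>{I, adjoin I f, adjoin I z}. nonzerodiv K w"
    using I If Iz sf sz s by (intro ex_common_nonzerodiv E) auto
  then obtain w where w: "w \<in> E" "nonzerodiv I w" "nonzerodiv (adjoin I f) w" "nonzerodiv (adjoin I z) w"
    by auto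
  have wA: "w \<in> A" using w EA by auto
  have "grade_ge E (adjoin (adjoin I w) f) k"
    using Suc.IH[OF If w(1,3) f(3)] by (simp add: adjoin_commute)
  then have "grade_ge E (adjoin I w) (Suc k)"
    using nonzerodiv_swap[OF I wA fz(1) f(2) w(3)] f(1) by (auto simp: grade_ge_Suc)
  then have "grade_ge E (adjoin (adjoin I w) z) k"
    using nonzerodiv_swap[OF I wA fz(2) Suc.prems(3) w(4)] Suc.prems(2)
    by (intro Suc.IH[OF ideal_adjoin[OF I wA]]) auto
  then show ?case using w by (auto simp: grade_ge_Suc adjoin_commute)
qed

text \<open>For one regular element this is left exactness of \<open>Hom(A/(E), -)\<close>: a class
  killed by \<open>E\<close> vanishes in the right-hand term, so it comes from the left-hand one,
  where it is killed too. Reducing modulo a \<open>z\<close> regular on all three terms lowers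
  \<open>k\<close> by one.\<close>

lemma grade_ge_middle:
  assumes E: "add_mult_closed E" and x: "x \<in> A"
  shows "is_ideal I \<Longrightarrow> grade_ge E (quot I x) k \<Longrightarrow> grade_ge E (adjoin I x) k \<Longrightarrow> grade_ge E I k"
proof (induction k arbitrary: I)
  case 0
  show ?case by (rule grade_ge_0)
next
  case (Suc k)
  note I = Suc.prems(1)
  have EA: "E \<subseteq> A" using E by (simp add: add_mult_closed_def)
  note sq = grade_ge_Suc_imp_socle_free[OF Suc.prems(2)]
  note sx = grade_ge_Suc_imp_socle_free[OF Suc.prems(3)]
  have s: "socle_free E I"
    unfolding socle_free_def
  proof safe
    fix u assume u: "u \<in> A" "\<forall>e\<in>E. e * u \<in> I"
    then have "u \<in> adjoin I x" using socle_freeD[OF sx] adjoin_sub by blast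
    then obtain a r where a: "a \<in> I" "r \<in> A" "u = a + r * x" by (elim adjoinE)
    have "r \<in> quot I x"
    proof (rule socle_freeD[OF sq a(2)])
      fix e assume e: "e \<in> E"
      have "e * u - e * a \<in> I"
        using e EA u(2) a(1) by (intro ideal_diff[OF I _ ideal_mult[OF I _ a(1)]]) auto
      then show "e * r \<in> quot I x" using e EA a by (auto simp: quot_def mult_in algebra_simps)
    qed
    then show "u \<in> I" using a ideal_add[OF I] by (simp add: quot_def)
  qed
  have "\<exists>z\<in>E. \<forall>K\<in>{I, quot I x, adjoin I x}. nonzerodiv K z"
    using s sq sx by (intro ex_common_nonzerodiv E) (auto intro: ideal_quot ideal_adjoin I x)
  then obtain z where z: "z \<in> E" "nonzerodiv I z" "nonzerodiv (quot I x) z" "nonzerodiv (adjoin I x) z"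
    by auto
  have zA: "z \<in> A" using z EA by auto
  have "grade_ge E (quot (adjoin I z) x) k"
    using grade_ge_adjoin[OF E ideal_quot[OF I] z(1,3) Suc.prems(2)] quot_adjoin[OF I x zA z(4)] by simp
  moreover have "grade_ge E (adjoin (adjoin I z) x) k"
    using grade_ge_adjoin[OF E ideal_adjoin[OF I x] z(1,4) Suc.prems(3)] by (simp add: adjoin_commute)
  ultimately have "grade_ge E (adjoin I z) k" by (rule Suc.IH[OF ideal_adjoin[OF I zA]])
  then show ?case using z by (auto simp: grade_ge_Suc)
qed

text \<open>For one regular element this is the connecting map: a class killed by \<open>E\<close>
  in the right-hand term gives an element of \<open>Ext^1\<close> of the left-hand term, which
  explains the extra regular element demanded there.\<close>

lemma grade_ge_right:
  assumes E: "add_mult_closed E" and x: "x \<in> A"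
  shows "is_ideal I \<Longrightarrow> grade_ge E (quot I x) (Suc k) \<Longrightarrow> grade_ge E I k \<Longrightarrow> grade_ge E (adjoin I x) k"
proof (induction k arbitrary: I)
  case 0
  show ?case by (rule grade_ge_0)
next
  case (Suc k)
  note I = Suc.prems(1)
  have EA: "E \<subseteq> A" using E by (simp add: add_mult_closed_def)
  note sq = grade_ge_Suc_imp_socle_free[OF Suc.prems(2)]
  note s = grade_ge_Suc_imp_socle_free[OF Suc.prems(3)]
  \<comment> \<open>This \<open>z\<close> realises \<open>Ext^1\<close> of the left-hand term as the
    classes killed by \<open>E\<close> modulo \<open>((I : x), z)\<close>; regularity on the
    right-hand term is not yet available.\<close>
  have "\<exists>z\<in>E. \<forall>K\<in>{I, quot I x}. nonzerodiv K z"
    using s sq by (intro ex_common_nonzerodiv E) (auto intro: ideal_quot I)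
  then obtain z where z: "z \<in> E" "nonzerodiv I z" "nonzerodiv (quot I x) z" by auto
  have zA: "z \<in> A" using z EA by auto
  have sqz: "socle_free E (adjoin (quot I x) z)"
    using grade_ge_adjoin[OF E ideal_quot[OF I] z(1,3) Suc.prems(2)]
    by (rule grade_ge_Suc_imp_socle_free)
  have sx: "socle_free E (adjoin I x)"
    unfolding socle_free_def
  proof safe
    fix u assume u: "u \<in> A" "\<forall>e\<in>E. e * u \<in> adjoin I x"
    then obtain a w where a: "a \<in> I" "w \<in> A" "z * u = a + w * x" using z(1) unfolding adjoin_def by blast
    have "w \<in> adjoin (quot I x) z"
    proof (rule socle_freeD[OF sqz a(2)])
      fix e assume e: "e \<in> E"
      then obtain b r where b: "b \<in> I" "r \<in> A" "e * u = b + r * x" using u(2) unfolding adjoin_def by blast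
      have eA: "e \<in> A" using e EA by auto
      have "e * (z * u) = z * (e * u)" by (simp add: mult_ac)
      then have "(e * w - r * z) * x = z * b - e * a" using a b by (simp add: algebra_simps)
      then have "e * w - r * z \<in> quot I x"
        using a b zA eA ideal_diff[OF I ideal_mult[OF I zA b(1)] ideal_mult[OF I eA a(1)]]
        by (simp add: quot_def ring_in)
      then show "e * w \<in> adjoin (quot I x) z" using adjoinI[of "e * w - r * z" _ r z] b by simp
    qed
    then obtain b r where b: "b * x \<in> I" "b \<in> A" "r \<in> A" "w = b + r * z"
      unfolding adjoin_def quot_def by blast
    have "z * (u - r * x) = a + b * x" using a b by (simp add: algebra_simps)
    then have "u - r * x \<in> I"
      using nonzerodivD[OF z(2), of "u - r * x"] u(1) b x ideal_add[OF I a(1) b(1)] by (simp add: ring_in)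
    then show "u \<in> adjoin I x" using adjoinI[of "u - r * x" I r x] b by simp
  qed
  \<comment> \<open>Now that \<open>A/(I, x)\<close> has no socle either, a second choice of
    \<open>z\<close> is regular on all three terms and the sequence can be reduced modulo
    it.\<close>
  have "\<exists>z\<in>E. \<forall>K\<in>{I, quot I x, adjoin I x}. nonzerodiv K z"
    using s sq sx by (intro ex_common_nonzerodiv E) (auto intro: ideal_quot ideal_adjoin I x)
  then obtain z where z: "z \<in> E" "nonzerodiv I z" "nonzerodiv (quot I x) z" "nonzerodiv (adjoin I x) z"
    by auto
  have zA: "z \<in> A" using z EA by auto
  have "grade_ge E (quot (adjoin I z) x) (Suc k)"
    using grade_ge_adjoin[OF E ideal_quot[OF I] z(1,3) Suc.prems(2)] quot_adjoin[OF I x zA z(4)] by simp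
  moreover have "grade_ge E (adjoin I z) k" by (rule grade_ge_adjoin[OF E I z(1,2) Suc.prems(3)])
  ultimately have "grade_ge E (adjoin (adjoin I z) x) k" by (rule Suc.IH[OF ideal_adjoin[OF I zA]])
  then show ?case using z by (auto simp: grade_ge_Suc adjoin_commute)
qed

end

section \<open>Polynomials as polynomials in one variable\<close>

text \<open>Finitely many generators of \<open>gen W\<close> involve only finitely many elements of
  \<open>W\<close>.\<close>

lemma (in ring_carrier) noetherian_carrierI:
  assumes "\<And>I. is_ideal I \<Longrightarrow> \<exists>F. finite F \<and> F \<subseteq> I \<and> I \<subseteq> gen F"
  shows "noetherian_carrier A"
proof
  fix W assume W: "W \<subseteq> A"
  obtain F where F: "finite F" "F \<subseteq> gen W" "gen W \<subseteq> gen F"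
    using assms[OF ideal_gen[OF W]] by blast
  have "\<forall>f\<in>F. \<exists>G. finite G \<and> G \<subseteq> W \<and> f \<in> gen G"
    using gen_finite_subset[OF W] F by blast
  then obtain G where G: "\<And>f. f \<in> F \<Longrightarrow> finite (G f)" "\<And>f. f \<in> F \<Longrightarrow> G f \<subseteq> W"
    "\<And>f. f \<in> F \<Longrightarrow> f \<in> gen (G f)" by metis
  let ?U = "\<Union>(G ` F)"
  have U: "?U \<subseteq> W" using G(2) by blast
  have "f \<in> gen ?U" if "f \<in> F" for f
    using G(3)[OF that] gen_mono[of "G f" ?U] that by blast
  then have "gen F \<subseteq> gen ?U"
    by (intro gen_least[OF ideal_gen[OF subset_trans[OF U W]]]) (rule subsetI)
  then have "W \<subseteq> gen ?U" using F(3) gen_superset[of W] by (meson subset_trans)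
  then have "finite ?U \<and> ?U \<subseteq> W \<and> W \<subseteq> gen ?U"
    using F(1) G(1) U by simp
  then show "\<exists>F. finite F \<and> F \<subseteq> W \<and> W \<subseteq> gen F" by blast
qed

section \<open>The rings \<open>K[X]\<close> inside one type\<close>

definition polys :: "nat set \<Rightarrow> 'k::field mpoly set" where
  "polys X = {p. \<forall>a\<in>Poly_Mapping.keys p. Poly_Mapping.keys a \<subseteq> X}"

lemma polys_iff:
  "p \<in> polys X \<longleftrightarrow> (\<forall>a i. Poly_Mapping.lookup p a \<noteq> 0 \<longrightarrow> Poly_Mapping.lookup a i \<noteq> 0 \<longrightarrow> i \<in> X)"
  by (auto simp: polys_def subset_iff in_keys_iff)

lemma polys_mono: "X \<subseteq> Y \<Longrightarrow> polys X \<subseteq> polys Y"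
  by (auto simp: polys_def)

lemma ring_carrier_polys: "ring_carrier (polys X :: 'k::field mpoly set)"
proof
  show "(1::'k mpoly) \<in> polys X" by (auto simp: polys_def)
  fix p q :: "'k mpoly" assume pq: "p \<in> polys X" "q \<in> polys X"
  show "p - q \<in> polys X" using pq unfolding polys_iff
    by (metis diff_zero lookup_minus)
  show "p * q \<in> polys X" unfolding polys_def
  proof safe
    fix a i assume "a \<in> Poly_Mapping.keys (p * q)" "i \<in> Poly_Mapping.keys a"
    then obtain b c where "a = b + c" "b \<in> Poly_Mapping.keys p" "c \<in> Poly_Mapping.keys q"
      using keys_mult[of p q] by auto
    moreover from this have "i \<in> Poly_Mapping.keys b \<or> i \<in> Poly_Mapping.keys c"
      using \<open>i \<in> Poly_Mapping.keys a\<close> Poly_Mapping.keys_add[of b c] by blast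
    ultimately show "i \<in> X" using pq unfolding polys_def by blast
  qed
qed

interpretation polys: ring_carrier "polys X :: 'k::field mpoly set" for X
  by (rule ring_carrier_polys)

lemma var_in_polys: "x \<in> X \<Longrightarrow> var x \<in> polys X"
  by (auto simp: var_def monomial_def polys_def)

lemma var_power_in_polys: "x \<in> X \<Longrightarrow> var x ^ i \<in> polys X"
  by (induction i) (auto intro: polys.mult_in polys.one_in var_in_polys)

lemma sum_singles: "p = (\<Sum>a\<in>Poly_Mapping.keys p. Poly_Mapping.single a (Poly_Mapping.lookup p a))"
proof (rule poly_mapping_eqI)
  fix b
  show "Poly_Mapping.lookup p b =
    Poly_Mapping.lookup (\<Sum>a\<in>Poly_Mapping.keys p. Poly_Mapping.single a (Poly_Mapping.lookup p a)) b"
    by (cases "b \<in> Poly_Mapping.keys p")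
       (auto simp: lookup_sum lookup_single when_def in_keys_iff)
qed

text \<open>Reduces identities additive in a polynomial, such as the product formula for
  \<open>var_coeff\<close>, to single terms.\<close>

lemma additive_induct [case_names single add]:
  fixes p :: "'a \<Rightarrow>\<^sub>0 'b::comm_monoid_add"
  assumes "\<And>a c. P (Poly_Mapping.single a c)" "\<And>p q. P p \<Longrightarrow> P q \<Longrightarrow> P (p + q)"
  shows "P p"
proof -
  have "P (\<Sum>a\<in>S. Poly_Mapping.single a (f a))" if "finite S" for S f
    using that
  proof (induction S)
    case empty
    then show ?case using assms(1)[of _ 0] by simp
  qed (auto intro: assms)
  then show ?thesis using sum_singles[of p] by (metis finite_keys)
qed

text \<open>The coefficient of \<open>x\<^sup>j\<close> in \<open>p\<close>, as a polynomial in the other variables.\<close>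

definition var_coeff :: "nat \<Rightarrow> nat \<Rightarrow> 'k::field mpoly \<Rightarrow> 'k mpoly" where
  "var_coeff x j p = Abs_poly_mapping
    (\<lambda>a. if Poly_Mapping.lookup a x = 0 then Poly_Mapping.lookup p (a + Poly_Mapping.single x j) else 0)"

lemma lookup_var_coeff:
  "Poly_Mapping.lookup (var_coeff x j p) a =
    (if Poly_Mapping.lookup a x = 0 then Poly_Mapping.lookup p (a + Poly_Mapping.single x j) else 0)"
proof -
  have "finite ((\<lambda>a. a + Poly_Mapping.single x j) -` Poly_Mapping.keys p)"
    by (intro finite_vimageI) (auto simp: inj_def)
  then have "finite {a. (if Poly_Mapping.lookup a x = 0
      then Poly_Mapping.lookup p (a + Poly_Mapping.single x j) else 0) \<noteq> 0}"
    by (rule rev_finite_subset) (auto simp: in_keys_iff)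
  then show ?thesis by (simp add: var_coeff_def)
qed

lemma var_coeff_add: "var_coeff x j (p + q) = var_coeff x j p + var_coeff x j q"
  by (rule poly_mapping_eqI) (simp add: lookup_var_coeff lookup_add)

lemma var_coeff_diff: "var_coeff x j (p - q) = var_coeff x j p - var_coeff x j q"
  by (rule poly_mapping_eqI) (simp add: lookup_var_coeff lookup_minus)

lemma var_coeff_0 [simp]: "var_coeff x j 0 = 0"
  by (rule poly_mapping_eqI) (simp add: lookup_var_coeff)

lemma var_coeff_sum: "var_coeff x j (sum f T) = (\<Sum>i\<in>T. var_coeff x j (f i))"
  by (induction T rule: infinite_finite_induct) (auto simp: var_coeff_add)

lemma var_coeff_single:
  "var_coeff x j (Poly_Mapping.single a c) =
    (if Poly_Mapping.lookup a x = j then Poly_Mapping.single (a - Poly_Mapping.single x j) c else 0)"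
proof (rule poly_mapping_eqI)
  fix b
  have 1: "a = b + Poly_Mapping.single x j \<Longrightarrow> Poly_Mapping.lookup b x = 0 \<Longrightarrow>
      Poly_Mapping.lookup a x = j \<and> a - Poly_Mapping.single x j = b"
    by (simp add: lookup_add)
  have 2: "a = (a - Poly_Mapping.single x j) + Poly_Mapping.single x j \<and>
      Poly_Mapping.lookup (a - Poly_Mapping.single x j) x = 0" if "Poly_Mapping.lookup a x = j"
    using that by (auto simp: lookup_minus lookup_add lookup_single when_def intro!: poly_mapping_eqI)
  show "Poly_Mapping.lookup (var_coeff x j (Poly_Mapping.single a c)) b =
    Poly_Mapping.lookup (if Poly_Mapping.lookup a x = j
      then Poly_Mapping.single (a - Poly_Mapping.single x j) c else 0) b"
    using 1 2 by (auto simp: lookup_var_coeff lookup_single when_def)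
qed

lemma var_coeff_mult:
  "var_coeff x l (p * q) = (\<Sum>i\<le>l. var_coeff x i p * var_coeff x (l - i) q)"
proof (induction p rule: additive_induct)
  case (single a c)
  show ?case
  proof (induction q rule: additive_induct)
    case (single b d)
    let ?a = "Poly_Mapping.lookup a x" and ?b = "Poly_Mapping.lookup b x"
    have "(\<Sum>i\<le>l. var_coeff x i (Poly_Mapping.single a c) * var_coeff x (l - i) (Poly_Mapping.single b d)) =
      (\<Sum>i\<le>l. if i = ?a then var_coeff x ?a (Poly_Mapping.single a c) *
         var_coeff x (l - ?a) (Poly_Mapping.single b d) else 0)"
      by (intro sum.cong) (auto simp: var_coeff_single)
    also have "\<dots> = (if ?a + ?b = l then
        Poly_Mapping.single ((a - Poly_Mapping.single x ?a) + (b - Poly_Mapping.single x ?b)) (c * d) else 0)"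
      by (auto simp: var_coeff_single mult_single)
    also have "(a - Poly_Mapping.single x ?a) + (b - Poly_Mapping.single x ?b) =
        a + b - Poly_Mapping.single x (?a + ?b)"
      by (rule poly_mapping_eqI) (auto simp: lookup_add lookup_minus lookup_single when_def)
    finally show ?case by (auto simp: mult_single var_coeff_single lookup_add)
  qed (simp add: distrib_left var_coeff_add sum.distrib)
qed (simp add: distrib_right var_coeff_add sum.distrib)

lemma var_coeff_free:
  assumes "p \<in> polys X" "x \<notin> X"
  shows "var_coeff x j p = (if j = 0 then p else 0)"
proof (rule poly_mapping_eqI)
  fix a
  have *: "Poly_Mapping.lookup p b = 0" if "Poly_Mapping.lookup b x \<noteq> 0" for b
    using assms that unfolding polys_iff by blast
  show "Poly_Mapping.lookup (var_coeff x j p) a = Poly_Mapping.lookup (if j = 0 then p else 0) a"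
    using *[of a] *[of "a + Poly_Mapping.single x j"] by (auto simp: lookup_var_coeff lookup_add)
qed

lemma var_coeff_free_mult:
  assumes "p \<in> polys X" "x \<notin> X"
  shows "var_coeff x j (p * q) = p * var_coeff x j q"
proof -
  have "var_coeff x j (p * q) = (\<Sum>i\<le>j. if i = 0 then p * var_coeff x j q else 0)"
    unfolding var_coeff_mult by (intro sum.cong) (auto simp: var_coeff_free[OF assms])
  then show ?thesis by simp
qed

lemma var_coeff_var_mult:
  "var_coeff x j (var x * p) = (if j = 0 then 0 else var_coeff x (j - 1) p)"
proof -
  have v: "var_coeff x i (var x) = (if i = 1 then 1 else 0)" for i
    by (auto simp: var_def monomial_def var_coeff_single)
  have "var_coeff x j (var x * p) = (\<Sum>i\<le>j. if i = 1 then var_coeff x (j - 1) p else 0)"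
    unfolding var_coeff_mult by (intro sum.cong) (auto simp: v)
  then show ?thesis by auto
qed

lemma var_coeff_var_power_mult:
  "var_coeff x j (var x ^ i * p) = (if i \<le> j then var_coeff x (j - i) p else 0)"
  by (induction i arbitrary: j) (auto simp: var_coeff_var_mult mult.assoc)

lemma var_coeff_in:
  assumes "p \<in> polys (insert x X)"
  shows "var_coeff x j p \<in> polys X"
  unfolding polys_iff
proof (intro allI impI)
  fix a i assume "Poly_Mapping.lookup (var_coeff x j p) a \<noteq> 0" and i: "Poly_Mapping.lookup a i \<noteq> 0"
  then have a: "Poly_Mapping.lookup a x = 0" "Poly_Mapping.lookup p (a + Poly_Mapping.single x j) \<noteq> 0"
    by (auto simp: lookup_var_coeff split: if_splits)
  have "Poly_Mapping.lookup (a + Poly_Mapping.single x j) i \<noteq> 0" using i by (simp add: lookup_add)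
  then have "i \<in> insert x X" using assms a unfolding polys_iff by blast
  then show "i \<in> X" using a(1) i by auto
qed

lemma var_coeff_eventually_0: "\<exists>d. \<forall>j\<ge>d. var_coeff x j p = 0"
proof (induction p rule: additive_induct)
  case (single a c)
  then show ?case by (intro exI[of _ "Suc (Poly_Mapping.lookup a x)"]) (auto simp: var_coeff_single)
next
  case (add p q)
  then obtain d e where "\<forall>j\<ge>d. var_coeff x j p = 0" "\<forall>j\<ge>e. var_coeff x j q = 0" by blast
  then show ?case by (intro exI[of _ "max d e"]) (auto simp: var_coeff_add)
qed

lemma var_coeff_eqI:
  fixes p q :: "'k::field mpoly"
  assumes "\<And>j. var_coeff x j p = var_coeff x j q"
  shows "p = q"
proof (rule poly_mapping_eqI)
  fix a :: monomial
  let ?j = "Poly_Mapping.lookup a x" and ?b = "a - Poly_Mapping.single x (Poly_Mapping.lookup a x)"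
  have "a = ?b + Poly_Mapping.single x ?j" "Poly_Mapping.lookup ?b x = 0"
    by (auto simp: lookup_minus lookup_add lookup_single when_def intro!: poly_mapping_eqI)
  then show "Poly_Mapping.lookup p a = Poly_Mapping.lookup q a"
    using arg_cong[OF assms[of ?j], of "\<lambda>r. Poly_Mapping.lookup r ?b"]
    by (simp add: lookup_var_coeff)
qed

lemma var_coeff_expansion:
  assumes "\<And>j. d \<le> j \<Longrightarrow> var_coeff x j p = 0"
  shows "p = (\<Sum>j<d. var x ^ j * var_coeff x j p)"
proof (rule var_coeff_eqI)
  fix j
  have free: "var_coeff x i p \<in> polys (UNIV - {x})" for i
    by (rule var_coeff_in) (auto simp: polys_def)
  have "var_coeff x j (\<Sum>i<d. var x ^ i * var_coeff x i p) =
      (\<Sum>i<d. if i = j then var_coeff x j p else 0)"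
    unfolding var_coeff_sum
    by (intro sum.cong) (auto simp: var_coeff_var_power_mult var_coeff_free[OF free])
  then show "var_coeff x j p = var_coeff x j (\<Sum>j<d. var x ^ j * var_coeff x j p)"
    using assms[of j] by auto
qed

lemma var_coeff_0_split:
  assumes "p \<in> polys (insert x X)"
  obtains q where "q \<in> polys (insert x X)" "p = var_coeff x 0 p + var x * q"
proof -
  obtain d where "\<forall>j\<ge>d. var_coeff x j p = 0" using var_coeff_eventually_0 by blast
  then have "p = (\<Sum>j<Suc d. var x ^ j * var_coeff x j p)" by (intro var_coeff_expansion) auto
  also have "\<dots> = var_coeff x 0 p + var x * (\<Sum>j<d. var x ^ j * var_coeff x (Suc j) p)"
    by (simp only: sum.lessThan_Suc_shift) (simp add: sum_distrib_left mult.assoc)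
  finally have "p = var_coeff x 0 p + var x * (\<Sum>j<d. var x ^ j * var_coeff x (Suc j) p)" .
  moreover have "(\<Sum>j<d. var x ^ j * var_coeff x (Suc j) p) \<in> polys (insert x X)"
    using var_coeff_in[OF assms] polys_mono[of X "insert x X"]
    by (intro polys.ideal_sum[OF polys.ideal_carrier] polys.mult_in var_power_in_polys) auto
  ultimately show ?thesis by (rule that[rotated])
qed

section \<open>Hilbert's basis theorem\<close>

text \<open>Without variables only constants remain, so a nonzero ideal contains a unit.\<close>

lemma noetherian_polys_empty: "noetherian_carrier (polys {} :: 'k::field mpoly set)"
proof (rule polys.noetherian_carrierI)
  fix I :: "'k mpoly set" assume I: "polys.is_ideal {} I"
  have const: "p = Poly_Mapping.single 0 (Poly_Mapping.lookup p 0)" if "p \<in> polys {}" for p :: "'k mpoly"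
    using that by (intro poly_mapping_eqI)
      (auto simp: polys_def lookup_single when_def in_keys_iff keys_eq_empty)
  show "\<exists>F. finite F \<and> F \<subseteq> I \<and> I \<subseteq> polys.gen {} F"
  proof (cases "I \<subseteq> {0}")
    case True
    then show ?thesis using I polys.ideal_zero[OF I] polys.gen_superset[of "{0}"]
      by (intro exI[of _ "{0}"]) auto
  next
    case False
    then obtain c where c: "c \<in> I" "c \<noteq> 0" by blast
    have cp: "c \<in> polys {}" using polys.ideal_sub[OF I c(1)] .
    define v where "v = Poly_Mapping.lookup c 0"
    have cv: "c = Poly_Mapping.single 0 v" using const[OF cp] by (simp add: v_def)
    then have "v \<noteq> 0" using c by auto
    have gc: "polys.is_ideal {} (polys.gen {} {c})" using cp by (intro polys.ideal_gen) auto
    have "Poly_Mapping.single 0 (1 / v) * c \<in> polys.gen {} {c}"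
      using polys.gen_superset[of "{c}" "{}"]
      by (intro polys.ideal_mult[OF gc]) (auto simp: polys_iff lookup_single when_def)
    moreover have "Poly_Mapping.single 0 (1 / v) * c = 1"
      using \<open>v \<noteq> 0\<close> by (simp add: cv mult_single)
    ultimately have "p \<in> polys.gen {} {c}" if "p \<in> polys {}" for p
      using polys.ideal_mult[OF gc that, of 1] by simp
    then show ?thesis using c polys.ideal_sub[OF I] by (intro exI[of _ "{c}"]) auto
  qed
qed

text \<open>Finite generation over \<open>polys X\<close> is applied to all top coefficients
  together (\<open>F\<close>) and to those of each small degree separately (\<open>H j\<close>).
  Polynomials in \<open>I\<close> with these top coefficients make up \<open>G\<close>, and
  subtracting suitable elements of \<open>gen G\<close> lowers the degree in
  \<open>x\<close>.\<close>

lemma noetherian_polys_insert: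
  assumes X: "noetherian_carrier (polys X :: 'k::field mpoly set)" and x: "x \<notin> X"
  shows "noetherian_carrier (polys (insert x X) :: 'k mpoly set)"
proof (rule polys.noetherian_carrierI)
  interpret A: noetherian_carrier "polys X :: 'k mpoly set" by (rule X)
  let ?Y = "insert x X"
  fix I :: "'k mpoly set" assume I: "polys.is_ideal ?Y I"
  have IY: "p \<in> polys ?Y" if "p \<in> I" for p using polys.ideal_sub[OF I that] .
  define lc where "lc j = {var_coeff x j p | p. p \<in> I \<and> (\<forall>i>j. var_coeff x i p = 0)}" for j
  have lcX: "lc j \<subseteq> polys X" for j using var_coeff_in[OF IY] by (auto simp: lc_def)
  have XY: "polys X \<subseteq> polys ?Y" by (rule polys_mono) auto
  have "(\<Union>j. lc j) \<subseteq> polys X" using lcX by blast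
  from A.finitely_generated[OF this]
  obtain F where F: "finite F" "F \<subseteq> (\<Union>j. lc j)" "(\<Union>j. lc j) \<subseteq> polys.gen X F" by blast
  have "\<forall>f\<in>F. \<exists>j p. p \<in> I \<and> (\<forall>i>j. var_coeff x i p = 0) \<and> var_coeff x j p = f"
    using F(2) by (fastforce simp: lc_def)
  then obtain jf pf where pf: "\<And>f. f \<in> F \<Longrightarrow> pf f \<in> I"
    "\<And>f i. f \<in> F \<Longrightarrow> i > jf f \<Longrightarrow> var_coeff x i (pf f) = 0"
    "\<And>f. f \<in> F \<Longrightarrow> var_coeff x (jf f) (pf f) = f" by metis
  have "\<forall>j. \<exists>H. finite H \<and> H \<subseteq> lc j \<and> lc j \<subseteq> polys.gen X H"
    using A.finitely_generated[OF lcX] by blast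
  then obtain H where H: "\<And>j. finite (H j)" "\<And>j. H j \<subseteq> lc j" "\<And>j. lc j \<subseteq> polys.gen X (H j)" by metis
  have "\<forall>j. \<forall>h\<in>H j. \<exists>p. p \<in> I \<and> (\<forall>i>j. var_coeff x i p = 0) \<and> var_coeff x j p = h"
    using H(2) by (fastforce simp: lc_def)
  then obtain ph where ph: "\<And>j h. h \<in> H j \<Longrightarrow> ph j h \<in> I"
    "\<And>j h i. h \<in> H j \<Longrightarrow> i > j \<Longrightarrow> var_coeff x i (ph j h) = 0"
    "\<And>j h. h \<in> H j \<Longrightarrow> var_coeff x j (ph j h) = h" by metis
  \<comment> \<open>Any common bound of the degrees \<open>jf f\<close> would do; the sum is one,
    also for empty \<open>F\<close>.\<close>
  define d where "d = (\<Sum>f\<in>F. jf f)"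
  have d: "jf f \<le> d" if "f \<in> F" for f
    using that F(1) member_le_sum[of f F jf] by (auto simp: d_def)
  define G where "G = pf ` F \<union> (\<Union>j<d. ph j ` H j)"
  have GI: "finite G" "G \<subseteq> I" using F(1) H(1) pf ph by (auto simp: G_def)
  have gG: "polys.is_ideal ?Y (polys.gen ?Y G)" using GI IY by (intro polys.ideal_gen) auto
  have gI: "polys.gen ?Y G \<subseteq> I" using GI by (intro polys.gen_least I)
  have Gg: "g \<in> polys.gen ?Y G" if "g \<in> G" for g using polys.gen_superset that by blast
  \<comment> \<open>The top coefficients in degree \<open>n\<close> reached by \<open>gen G\<close>.
    Since \<open>LC n\<close> is an ideal of \<open>polys X\<close>, the inclusion of
    \<open>lc n\<close> is tested on \<open>H n\<close> or \<open>F\<close> alone.\<close>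
  define LC where "LC n = {c. \<exists>q\<in>polys.gen ?Y G. (\<forall>i>n. var_coeff x i q = 0) \<and> var_coeff x n q = c}" for n
  have LC: "polys.is_ideal X (LC n)" for n
  proof (rule polys.is_idealI)
    show "LC n \<subseteq> polys X" using gI IY var_coeff_in by (fastforce simp: LC_def)
    show "0 \<in> LC n" using polys.ideal_zero[OF gG] by (auto simp: LC_def intro!: bexI[of _ 0])
  next
    fix a b :: "'k mpoly" assume "a \<in> LC n" "b \<in> LC n"
    then obtain q r where q: "q \<in> polys.gen ?Y G" "\<forall>i>n. var_coeff x i q = 0" "var_coeff x n q = a"
      and r: "r \<in> polys.gen ?Y G" "\<forall>i>n. var_coeff x i r = 0" "var_coeff x n r = b"
      by (auto simp: LC_def)
    then show "a + b \<in> LC n" using polys.ideal_add[OF gG q(1) r(1)]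
      by (auto simp: LC_def var_coeff_add intro!: bexI[of _ "q + r"])
  next
    fix r a :: "'k mpoly" assume r: "r \<in> polys X" "a \<in> LC n"
    then obtain q where q: "q \<in> polys.gen ?Y G" "\<forall>i>n. var_coeff x i q = 0" "var_coeff x n q = a"
      by (auto simp: LC_def)
    then show "r * a \<in> LC n" using polys.ideal_mult[OF gG _ q(1), of r] r XY
      by (auto simp: LC_def var_coeff_free_mult[OF r(1) x] intro!: bexI[of _ "r * q"])
  qed
  have lc_LC: "lc n \<subseteq> LC n" for n
  proof (cases "n < d")
    case True
    have "H n \<subseteq> LC n"
    proof
      fix h assume h: "h \<in> H n"
      then have "ph n h \<in> G" using True by (auto simp: G_def)
      then show "h \<in> LC n" using ph[OF h] Gg unfolding LC_def by blast
    qed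
    then show ?thesis using H(3)[of n] polys.gen_least[OF LC] by blast
  next
    case False
    have "F \<subseteq> LC n"
    proof
      fix f assume f: "f \<in> F"
      then have "pf f \<in> G" by (auto simp: G_def)
      then have "var x ^ (n - jf f) * pf f \<in> polys.gen ?Y G"
        by (intro polys.ideal_mult[OF gG] var_power_in_polys Gg) auto
      then show "f \<in> LC n" using pf[OF f] d[OF f] False unfolding LC_def
        by (intro CollectI bexI[of _ "var x ^ (n - jf f) * pf f"]) (auto simp: var_coeff_var_power_mult)
    qed
    then show ?thesis using F(3) polys.gen_least[OF LC] by blast
  qed
  have "p \<in> polys.gen ?Y G" if "p \<in> I" "\<forall>j\<ge>n. var_coeff x j p = 0" for n p
    using that
  proof (induction n arbitrary: p)
    case 0
    have "p = 0" by (rule var_coeff_eqI[of x]) (use 0 in auto)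
    then show ?case using polys.ideal_zero[OF gG] by simp
  next
    case (Suc n)
    then have "var_coeff x n p \<in> lc n" by (auto simp: lc_def)
    then obtain q where q: "q \<in> polys.gen ?Y G" "\<forall>i>n. var_coeff x i q = 0"
      "var_coeff x n q = var_coeff x n p" using lc_LC by (fastforce simp: LC_def)
    have "p - q \<in> polys.gen ?Y G"
    proof (rule Suc.IH)
      show "p - q \<in> I" using polys.ideal_diff[OF I Suc.prems(1) subsetD[OF gI q(1)]] .
      show "\<forall>j\<ge>n. var_coeff x j (p - q) = 0"
        using Suc.prems(2) q by (simp add: var_coeff_diff) (metis Suc_leI le_eq_less_or_eq)
    qed
    then show ?case using polys.ideal_add[OF gG _ q(1)] by fastforce
  qed
  then have "I \<subseteq> polys.gen ?Y G" using var_coeff_eventually_0 by blast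
  then show "\<exists>F. finite F \<and> F \<subseteq> I \<and> I \<subseteq> polys.gen ?Y F" using GI by blast
qed

lemma noetherian_polys: "finite X \<Longrightarrow> noetherian_carrier (polys X :: 'k::field mpoly set)"
  by (induction X rule: finite_induct) (auto intro: noetherian_polys_empty noetherian_polys_insert)

section \<open>Ideals graded in one variable\<close>

text \<open>Explicit form of the graded maximal ideal, see \<open>graded_max_ideal_eq\<close>;
  membership is decided by one coefficient.\<close>

definition aug :: "nat set \<Rightarrow> 'k::field mpoly set" where
  "aug X = {p \<in> polys X. Poly_Mapping.lookup p 0 = 0}"

lemma var_coeff_0_mult: "var_coeff x 0 (p * q) = var_coeff x 0 p * var_coeff x 0 q"
  by (simp add: var_coeff_mult)

lemma lookup_mult_0:
  "Poly_Mapping.lookup (p * q) 0 = Poly_Mapping.lookup p 0 * Poly_Mapping.lookup q (0 :: monomial)"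
proof (induction p rule: additive_induct)
  case (single a c)
  have z: "a + b = 0 \<longleftrightarrow> a = 0 \<and> b = 0" for b :: monomial
    by (auto simp: poly_mapping_eq_iff fun_eq_iff lookup_add)
  show ?case
    by (induction q rule: additive_induct)
       (auto simp: mult_single lookup_single when_def z distrib_left lookup_add)
qed (simp add: distrib_right lookup_add)

lemma ideal_aug: "polys.is_ideal X (aug X)"
  by (rule polys.is_idealI) (auto simp: aug_def polys.ring_in lookup_add lookup_mult_0)

lemma aug_mono: "X \<subseteq> Y \<Longrightarrow> aug X \<subseteq> aug Y"
  using polys_mono[of X Y] by (auto simp: aug_def)

lemma var_in_aug: "x \<in> X \<Longrightarrow> var x \<in> aug X"
  using var_in_polys[of x X] single_zero[of x] inj_single
  by (auto simp: aug_def var_def monomial_def lookup_single when_def dest: arg_cong[of _ 0 Poly_Mapping.keys])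

lemma var_coeff_0_in_aug: "p \<in> aug (insert x X) \<Longrightarrow> var_coeff x 0 p \<in> aug X"
  using var_coeff_in[of p x X 0] by (simp add: aug_def lookup_var_coeff)

text \<open>Homogeneity for the degree in \<open>x\<close> alone. Unlike being a monomial ideal, it
  survives adjoining an arbitrary polynomial free of \<open>x\<close>.\<close>

definition graded_in :: "nat \<Rightarrow> 'k::field mpoly set \<Rightarrow> bool" where
  "graded_in x I \<longleftrightarrow> (\<forall>p\<in>I. \<forall>j. var x ^ j * var_coeff x j p \<in> I)"

lemma graded_inD: "graded_in x I \<Longrightarrow> p \<in> I \<Longrightarrow> var x ^ j * var_coeff x j p \<in> I"
  by (auto simp: graded_in_def)

lemma graded_inD0: "graded_in x I \<Longrightarrow> p \<in> I \<Longrightarrow> var_coeff x 0 p \<in> I"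
  using graded_inD[of x I p 0] by simp

context
  fixes X :: "nat set" and x :: nat
  assumes fin: "finite X" and x: "x \<notin> X"
begin

interpretation Y: noetherian_carrier "polys (insert x X) :: 'k::field mpoly set"
  using fin by (intro noetherian_polys) auto

lemma sub_insert: "polys X \<subseteq> (polys (insert x X) :: 'k::field mpoly set)" "aug X \<subseteq> (aug (insert x X) :: 'k mpoly set)"
  by (auto intro!: polys_mono aug_mono)

lemma Y_add_mult_closed: "Y.add_mult_closed (aug X :: 'k::field mpoly set)" "Y.add_mult_closed (aug (insert x X) :: 'k mpoly set)"
proof -
  show "Y.add_mult_closed (aug (insert x X) :: 'k mpoly set)" by (rule Y.ideal_add_mult_closed[OF ideal_aug])
  have "(0 :: 'k mpoly) \<in> aug X" by (rule polys.ideal_zero[OF ideal_aug])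
  then show "Y.add_mult_closed (aug X :: 'k mpoly set)"
    using sub_insert(1) unfolding Y.add_mult_closed_def
    by (intro conjI) (auto simp: aug_def polys.ring_in lookup_add lookup_mult_0 intro!: exI[of _ 0])
qed

text \<open>Nonzero elements killed by the variables other than \<open>x\<close> would form a graded \<open>K[x]\<close>-module
  \<open>N\<close>; two regular elements force \<open>N = x N\<close>, which is impossible in a module graded from below.\<close>

lemma socle_free_of_grade_2:
  fixes I :: "'k::field mpoly set"
  assumes I: "polys.is_ideal (insert x X) I" and g: "graded_in x I"
    and gr: "polys.grade_ge (insert x X) (aug (insert x X)) I 2"
  shows "polys.socle_free (insert x X) (aug X) I"
proof -
  let ?Y = "insert x X"
  let ?A = "polys ?Y :: 'k mpoly set"
  obtain f where f: "f \<in> aug ?Y" "polys.nonzerodiv ?Y I f"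
    "polys.grade_ge ?Y (aug ?Y) (polys.adjoin ?Y I f) 1"
    using gr by (auto simp: numeral_2_eq_2 polys.grade_ge_Suc[of _ _ _ "Suc 0"])
  have sf: "polys.socle_free ?Y (aug ?Y) (polys.adjoin ?Y I f)"
    using f(3) by (intro Y.grade_ge_Suc_imp_socle_free[where k = 0]) simp
  have fA: "f \<in> ?A" using f by (simp add: aug_def)
  then obtain h where h: "h \<in> ?A" "f = var_coeff x 0 f + var x * h" by (rule var_coeff_0_split)
  define f0 where "f0 = var_coeff x 0 f"
  have f0: "f0 \<in> aug X" "f = f0 + var x * h" using f h var_coeff_0_in_aug by (auto simp: f0_def)
  have xA: "var x \<in> ?A" by (rule var_in_polys) simp
  define N where "N = {u \<in> ?A. \<forall>e\<in>aug X. e * u \<in> I}"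
  have augA: "e \<in> ?A" if "e \<in> aug X" for e :: "'k mpoly" using sub_insert that by (auto simp: aug_def)
  \<comment> \<open>Write \<open>f = f0 + x h\<close>. Since \<open>f0\<close> kills
    \<open>u\<close>, multiplication by \<open>x\<close> acts on \<open>h u\<close> like
    multiplication by \<open>f\<close> on \<open>u\<close>, so \<open>h u\<close> is killed by all
    of \<open>aug (insert x X)\<close> modulo \<open>(I, f)\<close>. Hence \<open>h u = v f\<close>
    modulo \<open>I\<close>, and \<open>f (u - x v) = f0 u\<close> lies in \<open>I\<close>.\<close>
  have step: "\<exists>v\<in>N. u - var x * v \<in> I" if u: "u \<in> N" for u
  proof -
    have uA: "u \<in> ?A" and eu: "\<And>e. e \<in> aug X \<Longrightarrow> e * u \<in> I" using u by (auto simp: N_def)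
    have "h * u \<in> polys.adjoin ?Y I f"
    proof (rule polys.socle_freeD[OF sf polys.mult_in[OF h(1) uA]])
      fix e :: "'k mpoly" assume e: "e \<in> aug ?Y"
      then have eA: "e \<in> ?A" by (simp add: aug_def)
      then obtain e1 where e1: "e1 \<in> ?A" "e = var_coeff x 0 e + var x * e1" by (rule var_coeff_0_split)
      let ?e0 = "var_coeff x 0 e"
      have "?e0 \<in> aug X" using e var_coeff_0_in_aug by auto
      then have "h * (?e0 * u) - e1 * (f0 * u) \<in> I"
        by (intro polys.ideal_diff[OF I polys.ideal_mult[OF I h(1) eu] polys.ideal_mult[OF I e1(1) eu]] f0(1))
      from polys.adjoinI[OF this polys.mult_in[OF e1(1) uA], of f]
      show "e * (h * u) \<in> polys.adjoin ?Y I f"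
        by (subst e1(2)) (simp add: f0(2) algebra_simps)
    qed
    then obtain b v where b: "b \<in> I" "v \<in> ?A" "h * u = b + v * f" by (elim polys.adjoinE)
    have "f * (u - var x * v) = f0 * u + var x * b"
    proof -
      have "f * (u - var x * v) = f * u - var x * (v * f)" by (simp add: algebra_simps)
      also have "v * f = h * u - b" using b by simp
      finally show ?thesis by (simp add: f0(2) algebra_simps)
    qed
    then have 1: "u - var x * v \<in> I"
      using polys.nonzerodivD[OF f(2), of "u - var x * v"] polys.ideal_add[OF I eu[OF f0(1)] polys.ideal_mult[OF I xA b(1)]]
        uA b(2) xA by (simp add: polys.ring_in)
    have "v \<in> N" unfolding N_def
    proof (intro CollectI conjI ballI b(2))
      fix e :: "'k mpoly" assume e: "e \<in> aug X"
      have "f * (e * v) = e * (v * f)" by (simp add: algebra_simps)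
      also have "\<dots> = h * (e * u) - e * b" using b by (simp add: algebra_simps)
      also have "\<dots> \<in> I"
        by (rule polys.ideal_diff[OF I polys.ideal_mult[OF I h(1) eu[OF e]] polys.ideal_mult[OF I augA[OF e] b(1)]])
      finally show "e * v \<in> I" by (rule polys.nonzerodivD[OF f(2) polys.mult_in[OF augA[OF e] b(2)]])
    qed
    with 1 show ?thesis by blast
  qed
  have pow: "\<exists>v\<in>N. u - var x ^ n * v \<in> I" if "u \<in> N" for u n
    using that
  proof (induction n arbitrary: u)
    case 0
    then show ?case using polys.ideal_zero[OF I] by (intro bexI[of _ u]) auto
  next
    case (Suc n)
    obtain v where v: "v \<in> N" "u - var x ^ n * v \<in> I" using Suc by blast
    obtain w where w: "w \<in> N" "v - var x * w \<in> I" using step[OF v(1)] by blast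
    have "(u - var x ^ n * v) + var x ^ n * (v - var x * w) \<in> I"
      using v w by (intro polys.ideal_add[OF I] polys.ideal_mult[OF I] var_power_in_polys) auto
    then show ?case using w(1) by (intro bexI[of _ w]) (simp_all add: algebra_simps)
  qed
  have "u \<in> I" if uN: "u \<in> N" for u
  proof -
    obtain d where d: "\<forall>j\<ge>d. var_coeff x j u = 0" using var_coeff_eventually_0 by blast
    obtain v where v: "u - var x ^ d * v \<in> I" using pow[OF uN] by blast
    \<comment> \<open>With \<open>d\<close> beyond the degree of \<open>u\<close>, subtracting
      \<open>x^d v\<close> changes no coefficient of index below \<open>d\<close>, so each
      homogeneous part of \<open>u\<close> is one of \<open>u - x^d v\<close> and lies in the graded
      ideal \<open>I\<close>.\<close>
    have "var x ^ j * var_coeff x j u \<in> I" if "j < d" for j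
      using graded_inD[OF g v, of j] that by (simp add: var_coeff_diff var_coeff_var_power_mult)
    then have "(\<Sum>j<d. var x ^ j * var_coeff x j u) \<in> I" by (intro polys.ideal_sum[OF I]) auto
    then show ?thesis using var_coeff_expansion[of d x u] d by auto
  qed
  then show ?thesis unfolding polys.socle_free_def N_def by blast
qed

text \<open>\<open>z\<close> is homogeneous of degree 0 in \<open>x\<close>.\<close>

lemma graded_in_adjoin:
  fixes I :: "'k::field mpoly set"
  assumes g: "graded_in x I" and z: "z \<in> polys X"
  shows "graded_in x (polys.adjoin (insert x X) I z)"
  unfolding graded_in_def
proof (intro ballI allI)
  fix p j assume "p \<in> polys.adjoin (insert x X) I z"
  then obtain a r where a: "a \<in> I" "r \<in> polys (insert x X)" "p = a + r * z" by (elim polys.adjoinE)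
  have "var x ^ j * var_coeff x j p = var x ^ j * var_coeff x j a + (var x ^ j * var_coeff x j r) * z"
  proof -
    have "var_coeff x j (r * z) = var_coeff x j r * z"
      using var_coeff_free_mult[OF z x, of j r] by (simp add: mult.commute)
    then show ?thesis by (simp add: a(3) var_coeff_add distrib_left mult.assoc)
  qed
  moreover have "var x ^ j * var_coeff x j r \<in> polys (insert x X)"
    using var_coeff_in[OF a(2)] sub_insert(1) by (intro polys.mult_in var_power_in_polys) auto
  ultimately show "var x ^ j * var_coeff x j p \<in> polys.adjoin (insert x X) I z"
    using polys.adjoinI[OF graded_inD[OF g a(1)]] by simp
qed

text \<open>The loss is at most one even if \<open>x\<close> is a zero divisor on
  \<open>A/I\<close>. The base case asks for nothing, so the step starts from grade at least 2,
  where \<open>socle_free_of_grade_2\<close> helps to find a \<open>z\<close> free of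
  \<open>x\<close> that is regular on \<open>A/I\<close> and on \<open>A/(I, x)\<close>.\<close>

lemma grade_ge_adjoin_var:
  fixes I :: "'k::field mpoly set"
  assumes "polys.is_ideal (insert x X) I" "graded_in x I"
    "polys.grade_ge (insert x X) (aug (insert x X)) I (Suc k)"
  shows "polys.grade_ge (insert x X) (aug (insert x X)) (polys.adjoin (insert x X) I (var x)) k"
  using assms
proof (induction k arbitrary: I)
  case 0
  show ?case by (rule polys.grade_ge_0)
next
  case (Suc k)
  let ?Y = "insert x X"
  let ?A = "polys ?Y :: 'k mpoly set" and ?E = "aug ?Y :: 'k mpoly set"
  let ?Ix = "polys.adjoin ?Y I (var x)"
  note I = Suc.prems(1) and g = Suc.prems(2)
  have xA: "var x \<in> ?A" by (rule var_in_polys) simp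
  have Ix: "polys.is_ideal ?Y ?Ix" by (rule polys.ideal_adjoin[OF I xA])
  have s: "polys.socle_free ?Y (aug X) I"
    using polys.grade_ge_mono[OF Suc.prems(3), of 2] by (intro socle_free_of_grade_2 I g) simp
  \<comment> \<open>\<open>A/(I, x)\<close> is the part of \<open>A/I\<close> of degree 0 in
    \<open>x\<close>, a submodule over \<open>polys X\<close>, so it inherits the absence of classes
    killed by \<open>aug X\<close>.\<close>
  have sx: "polys.socle_free ?Y (aug X) ?Ix"
    unfolding polys.socle_free_def
  proof (intro ballI impI)
    fix u assume u: "u \<in> ?A" "\<forall>e\<in>aug X. e * u \<in> ?Ix"
    from u(1) obtain v where v: "v \<in> ?A" "u = var_coeff x 0 u + var x * v" by (rule var_coeff_0_split)
    have u0: "var_coeff x 0 u \<in> ?A" using var_coeff_in[OF u(1)] sub_insert by blast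
    have "var_coeff x 0 u \<in> I"
    proof (rule polys.socle_freeD[OF s u0])
      fix e :: "'k mpoly" assume e: "e \<in> aug X"
      then have eX: "e \<in> polys X" by (simp add: aug_def)
      obtain b r where b: "b \<in> I" "r \<in> ?A" "e * u = b + r * var x"
        using u(2) e unfolding polys.adjoin_def by blast
      have "var_coeff x 0 (e * u) = var_coeff x 0 b"
        by (simp add: b(3) var_coeff_add mult.commute[of r] var_coeff_var_mult)
      then have "e * var_coeff x 0 u = var_coeff x 0 b" by (simp add: var_coeff_free_mult[OF eX x])
      then show "e * var_coeff x 0 u \<in> I" using graded_inD0[OF g b(1)] by simp
    qed
    from polys.adjoinI[OF this v(1), of "var x"] show "u \<in> ?Ix"
      by (subst v(2)) (simp add: mult.commute)
  qed
  have "\<exists>z\<in>aug X. \<forall>K\<in>{I, ?Ix}. polys.nonzerodiv ?Y K z"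
    using s sx I Ix by (intro Y.ex_common_nonzerodiv Y_add_mult_closed) auto
  then obtain z where z: "z \<in> aug X" "polys.nonzerodiv ?Y I z" "polys.nonzerodiv ?Y ?Ix z" by auto
  have zE: "z \<in> ?E" using z sub_insert by blast
  have zX: "z \<in> polys X" and zA: "z \<in> ?A" using z zE by (auto simp: aug_def)
  have "polys.grade_ge ?Y ?E (polys.adjoin ?Y I z) (Suc k)"
    by (rule Y.grade_ge_adjoin[OF Y_add_mult_closed(2) I zE z(2) Suc.prems(3)])
  then have "polys.grade_ge ?Y ?E (polys.adjoin ?Y (polys.adjoin ?Y I z) (var x)) k"
    by (intro Suc.IH polys.ideal_adjoin[OF I zA] graded_in_adjoin[OF g zX])
  then show ?case using z(3) zE by (auto simp: polys.grade_ge_Suc polys.adjoin_commute)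
qed

text \<open>\<open>K[X, x]/L = K[X]/(L \<inter> K[X])\<close> if \<open>x \<in> L\<close>.\<close>

lemma grade_ge_restrict:
  fixes L :: "'k::field mpoly set"
  assumes "polys.is_ideal (insert x X) L" "var x \<in> L"
  shows "polys.grade_ge (insert x X) (aug (insert x X)) L k \<longleftrightarrow>
    polys.grade_ge X (aug X) (L \<inter> polys X) k"
  using assms
proof (induction k arbitrary: L)
  case 0
  show ?case by (simp add: polys.grade_ge_0)
next
  case (Suc k)
  let ?Y = "insert x X"
  let ?A = "polys ?Y :: 'k mpoly set"
  note L = Suc.prems(1)
  \<comment> \<open>As \<open>x\<close> lies in \<open>L\<close>, membership can be tested after
    setting \<open>x = 0\<close>, that is, on \<open>var_coeff x 0\<close>; regularity and adjoining
    follow suit.\<close>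
  have mem: "p \<in> L \<longleftrightarrow> var_coeff x 0 p \<in> L \<inter> polys X" if p: "p \<in> ?A" for p
  proof -
    obtain q where q: "q \<in> ?A" "p = var_coeff x 0 p + var x * q" using p by (rule var_coeff_0_split)
    have xq: "var x * q \<in> L" by (rule polys.ideal_mult'[OF L q(1) Suc.prems(2)])
    have "var_coeff x 0 p = p - var x * q" using q(2) by (simp add: algebra_simps)
    then have "p \<in> L \<longleftrightarrow> var_coeff x 0 p \<in> L"
      using polys.ideal_diff[OF L _ xq, of p] polys.ideal_add[OF L _ xq, of "var_coeff x 0 p"] q(2)
      by auto
    then show ?thesis using var_coeff_in[OF p] by blast
  qed
  have free: "var_coeff x 0 p = p" if "p \<in> polys X" for p :: "'k mpoly"
    by (simp add: var_coeff_free[OF that x])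
  have nzd: "polys.nonzerodiv ?Y L f \<longleftrightarrow> polys.nonzerodiv X (L \<inter> polys X) (var_coeff x 0 f)"
    if f: "f \<in> ?A" for f
  proof
    assume n: "polys.nonzerodiv ?Y L f"
    show "polys.nonzerodiv X (L \<inter> polys X) (var_coeff x 0 f)" unfolding polys.nonzerodiv_def
    proof (intro ballI impI)
      fix v :: "'k mpoly" assume v: "v \<in> polys X" "var_coeff x 0 f * v \<in> L \<inter> polys X"
      have vA: "v \<in> ?A" using v sub_insert by blast
      have "f * v \<in> L" using mem[OF polys.mult_in[OF f vA]] v by (simp add: var_coeff_0_mult free)
      then show "v \<in> L \<inter> polys X" using polys.nonzerodivD[OF n vA] v by blast
    qed
  next
    assume n: "polys.nonzerodiv X (L \<inter> polys X) (var_coeff x 0 f)"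
    show "polys.nonzerodiv ?Y L f" unfolding polys.nonzerodiv_def
    proof (intro ballI impI)
      fix v assume v: "v \<in> ?A" "f * v \<in> L"
      then have "var_coeff x 0 f * var_coeff x 0 v \<in> L \<inter> polys X"
        using mem[OF polys.mult_in[OF f v(1)]] by (simp add: var_coeff_0_mult)
      then show "v \<in> L" using polys.nonzerodivD[OF n var_coeff_in[OF v(1)]] mem[OF v(1)] by blast
    qed
  qed
  have adj: "polys.adjoin ?Y L f \<inter> polys X = polys.adjoin X (L \<inter> polys X) (var_coeff x 0 f)"
    if f: "f \<in> ?A" for f
  proof
    show "polys.adjoin ?Y L f \<inter> polys X \<subseteq> polys.adjoin X (L \<inter> polys X) (var_coeff x 0 f)"
    proof
      fix p assume p: "p \<in> polys.adjoin ?Y L f \<inter> polys X"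
      then obtain a r where a: "a \<in> L" "r \<in> ?A" "p = a + r * f" unfolding polys.adjoin_def by blast
      have "p = var_coeff x 0 a + var_coeff x 0 r * var_coeff x 0 f"
        using free[of p] p a(3) by (simp add: var_coeff_add var_coeff_0_mult)
      moreover have "var_coeff x 0 a \<in> L \<inter> polys X" using mem[OF polys.ideal_sub[OF L a(1)]] a(1) by blast
      ultimately show "p \<in> polys.adjoin X (L \<inter> polys X) (var_coeff x 0 f)"
        using polys.adjoinI[OF _ var_coeff_in[OF a(2)]] by blast
    qed
    show "polys.adjoin X (L \<inter> polys X) (var_coeff x 0 f) \<subseteq> polys.adjoin ?Y L f \<inter> polys X"
    proof
      fix p assume "p \<in> polys.adjoin X (L \<inter> polys X) (var_coeff x 0 f)"
      then obtain a r where a: "a \<in> L" "a \<in> polys X" "r \<in> polys X" "p = a + r * var_coeff x 0 f"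
        by (elim polys.adjoinE) blast
      have rA: "r \<in> ?A" using a sub_insert by blast
      obtain q where q: "q \<in> ?A" "f = var_coeff x 0 f + var x * q" using f by (rule var_coeff_0_split)
      have "p = (a - r * (var x * q)) + r * f"
        using arg_cong[OF q(2), of "\<lambda>g. r * g"] a(4) by (simp add: algebra_simps)
      moreover have "a - r * (var x * q) \<in> L"
        using polys.ideal_diff[OF L a(1) polys.ideal_mult[OF L rA polys.ideal_mult'[OF L q(1) Suc.prems(2)]]] .
      ultimately show "p \<in> polys.adjoin ?Y L f \<inter> polys X"
        using polys.adjoinI[OF _ rA] a(4) polys.add_in[OF a(2) polys.mult_in[OF a(3) var_coeff_in[OF f]]]
        by (metis IntI)
    qed
  qed
  have IH: "polys.grade_ge ?Y (aug ?Y) (polys.adjoin ?Y L f) k \<longleftrightarrow>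
      polys.grade_ge X (aug X) (polys.adjoin X (L \<inter> polys X) (var_coeff x 0 f)) k" if "f \<in> ?A" for f
    using Suc.IH[OF polys.ideal_adjoin[OF L that]] polys.adjoin_sub[of L ?Y f] Suc.prems(2) adj[OF that]
    by auto
  show ?case
  proof
    assume "polys.grade_ge ?Y (aug ?Y) L (Suc k)"
    then obtain f where f: "f \<in> aug ?Y" "polys.nonzerodiv ?Y L f"
      "polys.grade_ge ?Y (aug ?Y) (polys.adjoin ?Y L f) k" by (auto simp: polys.grade_ge_Suc)
    then have "f \<in> ?A" by (simp add: aug_def)
    then show "polys.grade_ge X (aug X) (L \<inter> polys X) (Suc k)"
      unfolding polys.grade_ge_Suc using f IH nzd var_coeff_0_in_aug[OF f(1)] by blast
  next
    assume "polys.grade_ge X (aug X) (L \<inter> polys X) (Suc k)"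
    then obtain f where f: "f \<in> aug X" "polys.nonzerodiv X (L \<inter> polys X) f"
      "polys.grade_ge X (aug X) (polys.adjoin X (L \<inter> polys X) f) k" by (auto simp: polys.grade_ge_Suc)
    have fY: "f \<in> aug ?Y" using f(1) sub_insert by blast
    then have "f \<in> ?A" by (simp add: aug_def)
    moreover have "var_coeff x 0 f = f" using f(1) by (intro free) (simp add: aug_def)
    ultimately show "polys.grade_ge ?Y (aug ?Y) L (Suc k)"
      unfolding polys.grade_ge_Suc using f(2,3) fY IH[of f] nzd[of f] by auto
  qed
qed

text \<open>Setting \<open>x = 0\<close> maps a graded ideal into itself, so the right-hand term of
  the exact sequence is the quotient of \<open>polys X\<close> by
  \<open>U \<inter> polys X\<close>.\<close>

lemma graded_adjoin_var_Int:
  fixes U :: "'k::field mpoly set"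
  assumes U: "polys.is_ideal (insert x X) U" and g: "graded_in x U"
  shows "polys.adjoin (insert x X) U (var x) \<inter> polys X = U \<inter> polys X"
proof
  show "polys.adjoin (insert x X) U (var x) \<inter> polys X \<subseteq> U \<inter> polys X"
  proof
    fix p assume p: "p \<in> polys.adjoin (insert x X) U (var x) \<inter> polys X"
    then obtain a r where a: "a \<in> U" "p = a + r * var x" unfolding polys.adjoin_def by blast
    have "p = var_coeff x 0 p" using p x by (simp add: var_coeff_free[where X = X])
    also have "\<dots> = var_coeff x 0 a"
      by (simp add: a(2) var_coeff_add mult.commute[of r] var_coeff_var_mult)
    finally show "p \<in> U \<inter> polys X" using graded_inD0[OF g a(1)] p by simp
  qed
qed (use polys.adjoin_sub[of U] in blast)

end

section \<open>Polynomial rings as records\<close>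

lemma poly_ring_simps [simp]:
  "carrier K[X] = polys X" "mult K[X] = (*)" "one K[X] = 1" "zero K[X] = 0" "add K[X] = (+)"
  by (simp_all add: poly_ring_def polys_def)

lemma cring_poly_ring: "cring (K[X] :: 'k::field mpoly ring)"
proof (rule cringI)
  show "abelian_group (K[X] :: 'k mpoly ring)"
    by (rule abelian_groupI)
       (auto simp: polys.ring_in add.assoc add.commute intro: bexI[of _ "- _"] polys.uminus_in)
  show "comm_monoid (K[X] :: 'k mpoly ring)"
    by (rule comm_monoidI) (auto simp: polys.ring_in mult.assoc mult.commute)
qed (auto simp: distrib_right)

lemma ideal_poly_ring_iff: "ideal I (K[X] :: 'k::field mpoly ring) \<longleftrightarrow> polys.is_ideal X I"
proof
  assume "ideal I (K[X] :: 'k mpoly ring)"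
  then interpret ideal I "K[X] :: 'k mpoly ring" .
  show "polys.is_ideal X I"
    using a_subset additive_subgroup.zero_closed[OF is_additive_subgroup]
      additive_subgroup.a_closed[OF is_additive_subgroup] I_l_closed
    by (intro polys.is_idealI) auto
next
  assume I: "polys.is_ideal X I"
  interpret cring "K[X] :: 'k mpoly ring" by (rule cring_poly_ring)
  have minus: "\<ominus>\<^bsub>K[X]\<^esub> a = - a" if "a \<in> polys X" for a :: "'k mpoly"
    using that by (intro minus_equality) (auto intro: polys.uminus_in)
  show "ideal I (K[X] :: 'k mpoly ring)"
  proof (rule idealI[OF ring_axioms])
    show "subgroup I (add_monoid (K[X] :: 'k mpoly ring))"
      using minus polys.ideal_sub[OF I] polys.ideal_uminus[OF I]
      by (intro add.subgroupI) (auto simp: a_inv_def[symmetric] intro: polys.ideal_zero[OF I] polys.ideal_add[OF I])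
  qed (auto intro: polys.ideal_mult[OF I] polys.ideal_mult'[OF I])
qed

lemma genideal_poly_ring: "Idl\<^bsub>K[X]\<^esub> W = polys.gen X W"
  by (simp add: genideal_def polys.gen_def ideal_poly_ring_iff)

lemma colon_poly_ring: "colon K[X] L f = polys.quot X L f"
  by (simp add: colon_def polys.quot_def)

text \<open>A polynomial without constant term is a sum of terms each divisible by a
  variable.\<close>

lemma graded_max_ideal_eq: "graded_max_ideal X = (aug X :: 'k::field mpoly set)"
  unfolding graded_max_ideal_def genideal_poly_ring
proof
  have vX: "(var ` X :: 'k mpoly set) \<subseteq> polys X" by (auto intro: var_in_polys)
  note G = polys.ideal_gen[OF vX]
  show "polys.gen X (var ` X :: 'k mpoly set) \<subseteq> aug X"
    by (rule polys.gen_least[OF ideal_aug]) (auto intro: var_in_aug)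
  show "(aug X :: 'k mpoly set) \<subseteq> polys.gen X (var ` X)"
  proof
    fix p :: "'k mpoly" assume p: "p \<in> aug X"
    have "Poly_Mapping.single a (Poly_Mapping.lookup p a) \<in> polys.gen X (var ` X)"
      if a: "a \<in> Poly_Mapping.keys p" for a
    proof -
      have "a \<noteq> 0" using p a by (auto simp: aug_def in_keys_iff)
      then obtain i where i: "i \<in> Poly_Mapping.keys a" by fastforce
      have aX: "Poly_Mapping.keys a \<subseteq> X" using p a by (auto simp: aug_def polys_def)
      have "a = (a - Poly_Mapping.single i 1) + Poly_Mapping.single i 1"
        using i by (intro poly_mapping_eqI) (auto simp: lookup_add lookup_minus lookup_single when_def in_keys_iff)
      then have eq: "Poly_Mapping.single a c = Poly_Mapping.single (a - Poly_Mapping.single i 1) c * var i" for c :: 'k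
        by (simp add: var_def monomial_def mult_single)
      have "Poly_Mapping.single (a - Poly_Mapping.single i 1) c \<in> polys X" for c :: 'k
        using aX by (auto simp: polys_iff lookup_single when_def lookup_minus in_keys_iff split: if_splits)
      moreover have "var i \<in> polys.gen X (var ` X :: 'k mpoly set)"
        using polys.gen_superset[of "var ` X"] aX i by blast
      ultimately show ?thesis unfolding eq by (rule polys.ideal_mult[OF G])
    qed
    then show "p \<in> polys.gen X (var ` X)"
      by (subst sum_singles) (rule polys.ideal_sum[OF G])
  qed
qed

section \<open>Depth\<close>

context ring_carrier
begin

lemma foldl_adjoin_sub: "I \<subseteq> foldl adjoin I fs"
proof (induction fs arbitrary: I)
  case (Cons f fs)
  then show ?case using adjoin_sub[of I f] by (metis foldl_Cons subset_trans)
qed simp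

lemma ideal_foldl_adjoin: "is_ideal I \<Longrightarrow> set fs \<subseteq> A \<Longrightarrow> is_ideal (foldl adjoin I fs)"
  by (induction fs arbitrary: I) (auto intro: ideal_adjoin)

lemma foldl_adjoin_least: "is_ideal K \<Longrightarrow> I \<subseteq> K \<Longrightarrow> set fs \<subseteq> K \<Longrightarrow> foldl adjoin I fs \<subseteq> K"
  by (induction fs arbitrary: I) (auto dest: adjoin_least)

lemma regseq_iff:
  "regseq I fs \<longleftrightarrow> (\<forall>i<length fs. nonzerodiv (foldl adjoin I (take i fs)) (fs ! i))"
  by (induction fs arbitrary: I) (auto simp: All_less_Suc2)

text \<open>Links adjoining elements one at a time with the linear combinations that define
  \<open>list_smult\<close>.\<close>

lemma mem_foldl_adjoin_iff:
  "p \<in> foldl adjoin I fs \<longleftrightarrow>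
    (\<exists>a\<in>I. \<exists>w. (\<forall>i<length fs. w i \<in> A) \<and> p = a + (\<Sum>i<length fs. fs ! i * w i))"
proof (induction fs arbitrary: p rule: rev_induct)
  case Nil
  show ?case by simp
next
  case (snoc f fs)
  let ?n = "length fs"
  have eq: "(\<Sum>i<?n. (fs @ [f]) ! i * w i) = (\<Sum>i<?n. fs ! i * w i)" for w
    by (intro sum.cong) (auto simp: nth_append)
  show ?case
  proof
    assume "p \<in> foldl adjoin I (fs @ [f])"
    then obtain b r where b: "b \<in> foldl adjoin I fs" "r \<in> A" "p = b + r * f"
      by (auto elim: adjoinE)
    obtain a w where a: "a \<in> I" "\<forall>i<?n. w i \<in> A" "b = a + (\<Sum>i<?n. fs ! i * w i)"
      using b(1) unfolding snoc.IH by blast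
    have "(\<Sum>i<?n. fs ! i * (w(?n := r)) i) = (\<Sum>i<?n. fs ! i * w i)"
      by (intro sum.cong) auto
    then have "p = a + (\<Sum>i<length (fs @ [f]). (fs @ [f]) ! i * (w(?n := r)) i)"
      by (simp add: eq a b mult.commute[of f] add.assoc)
    moreover have "\<forall>i<length (fs @ [f]). (w(?n := r)) i \<in> A" using a b by auto
    ultimately show "\<exists>a\<in>I. \<exists>w. (\<forall>i<length (fs @ [f]). w i \<in> A) \<and> p = a + (\<Sum>i<length (fs @ [f]). (fs @ [f]) ! i * w i)"
      using a(1) by blast
  next
    assume "\<exists>a\<in>I. \<exists>w. (\<forall>i<length (fs @ [f]). w i \<in> A) \<and> p = a + (\<Sum>i<length (fs @ [f]). (fs @ [f]) ! i * w i)"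
    then obtain a w where a: "a \<in> I" "\<forall>i<Suc ?n. w i \<in> A"
      "p = a + (\<Sum>i<Suc ?n. (fs @ [f]) ! i * w i)" by auto
    then have "p = (a + (\<Sum>i<?n. fs ! i * w i)) + w ?n * f" by (simp add: eq mult.commute[of f] add.assoc)
    moreover have "a + (\<Sum>i<?n. fs ! i * w i) \<in> foldl adjoin I fs"
      unfolding snoc.IH using a(1,2) less_SucI by blast
    ultimately show "p \<in> foldl adjoin I (fs @ [f])" using a(2) by (simp add: adjoinI)
  qed
qed

end

locale poly_quotient =
  fixes X :: "nat set" and L :: "'k::field mpoly set"
  assumes L: "polys.is_ideal X L"
begin

abbreviation cls :: "'k mpoly \<Rightarrow> 'k mpoly set" where
  "cls p \<equiv> L +>\<^bsub>K[X]\<^esub> p"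

sublocale Q: ideal L "K[X] :: 'k mpoly ring"
  using L by (simp add: ideal_poly_ring_iff)

sublocale QR: cring "K[X] Quot L"
  by (rule Q.quotient_is_cring[OF cring_poly_ring])

lemma cls_eq_iff: "p \<in> polys X \<Longrightarrow> q \<in> polys X \<Longrightarrow> cls p = cls q \<longleftrightarrow> p - q \<in> L"
proof -
  have eq: "cls r = (\<lambda>l. l + r) ` L" for r by (auto simp: a_r_coset_def')
  show "cls p = cls q \<longleftrightarrow> p - q \<in> L"
  proof
    assume "cls p = cls q"
    moreover have "p \<in> cls p" unfolding eq using polys.ideal_zero[OF L] by (auto intro!: image_eqI[of _ _ 0])
    ultimately obtain l where "l \<in> L" "p = l + q" unfolding eq by auto
    then show "p - q \<in> L" by simp
  next
    assume pq: "p - q \<in> L"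
    have sub: "cls a \<subseteq> cls b" if ab: "a - b \<in> L" for a b
    proof
      fix y assume "y \<in> cls a"
      then obtain l where l: "l \<in> L" "y = l + a" unfolding eq by blast
      then have "y = (l + (a - b)) + b" by simp
      then show "y \<in> cls b" unfolding eq using polys.ideal_add[OF L l(1) ab] by (rule image_eqI)
    qed
    have "q - p \<in> L" using polys.ideal_uminus[OF L pq] by simp
    then show "cls p = cls q" using sub pq by blast
  qed
qed

lemma carrier_Quot: "carrier (K[X] Quot L) = cls ` polys X"
  by (auto simp: FactRing_def A_RCOSETS_def')

lemma cls_mult: "p \<in> polys X \<Longrightarrow> q \<in> polys X \<Longrightarrow> cls p \<otimes>\<^bsub>K[X] Quot L\<^esub> cls q = cls (p * q)"
  using ring_hom_mult[OF Q.rcos_ring_hom, of p q] by simp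

lemma finsum_cls:
  assumes "finite T" "\<And>i. i \<in> T \<Longrightarrow> f i \<in> polys X"
  shows "finsum (K[X] Quot L) (\<lambda>i. cls (f i)) T = cls (sum f T)"
  using assms
proof (induction T)
  case empty
  have "cls 0 = L" using polys.ideal_zero[OF L] by (auto simp: a_r_coset_def')
  then show ?case by (simp only: QR.finsum_empty sum.empty) (simp add: FactRing_def)
next
  case (insert i T)
  have "sum f T \<in> polys X" using insert.prems by (intro polys.ideal_sum[OF polys.ideal_carrier]) auto
  then show ?case
    using insert ring_hom_add[OF Q.rcos_ring_hom, of "f i" "sum f T"]
    by (subst QR.finsum_insert) (auto simp: carrier_Quot)
qed

lemma list_smult_quot_module:
  assumes rs: "set rs \<subseteq> polys X"
  shows "list_smult rs (quot_module K[X] L) = cls ` foldl (polys.adjoin X) L rs"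
proof -
  let ?M = "quot_module K[X] L"
  have fs: "finsum ?M f T = finsum (K[X] Quot L) f T" for f :: "nat \<Rightarrow> 'k mpoly set" and T
    by (simp add: quot_module_def finsum_def finprod_def ring.defs module.defs)
  have sm: "r \<odot>\<^bsub>?M\<^esub> cls w = cls (r * w)" if "r \<in> polys X" "w \<in> polys X" for r w
    using that by (simp add: quot_module_def ring.defs module.defs cls_mult)
  have cM: "carrier ?M = cls ` polys X" by (simp add: quot_module_def ring.defs carrier_Quot)
  have rsi: "rs ! i \<in> polys X" if "i < length rs" for i using rs that nth_mem by blast
  have key: "(\<Oplus>\<^bsub>?M\<^esub>i\<in>{..<length rs}. (rs ! i) \<odot>\<^bsub>?M\<^esub> v i) = cls (\<Sum>i<length rs. rs ! i * w i)"
    if w: "\<And>i. i < length rs \<Longrightarrow> w i \<in> polys X \<and> v i = cls (w i)" for v w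
  proof -
    have "(\<Oplus>\<^bsub>?M\<^esub>i\<in>{..<length rs}. (rs ! i) \<odot>\<^bsub>?M\<^esub> v i) =
        finsum (K[X] Quot L) (\<lambda>i. cls (rs ! i * w i)) {..<length rs}"
      unfolding fs using w rsi sm
      by (intro QR.finsum_cong') (auto simp: carrier_Quot polys.mult_in)
    also have "\<dots> = cls (\<Sum>i<length rs. rs ! i * w i)"
      using w rsi by (intro finsum_cls) (auto intro: polys.mult_in)
    finally show ?thesis .
  qed
  have sumX: "(\<Sum>i<length rs. rs ! i * w i) \<in> polys X" if "\<And>i. i < length rs \<Longrightarrow> w i \<in> polys X" for w
    using that rsi by (intro polys.ideal_sum[OF polys.ideal_carrier]) (auto intro: polys.mult_in)
  show ?thesis
  proof
    show "list_smult rs ?M \<subseteq> cls ` foldl (polys.adjoin X) L rs"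
    proof
      fix y assume "y \<in> list_smult rs ?M"
      then obtain v where v: "v \<in> {..<length rs} \<rightarrow> carrier ?M"
        "y = (\<Oplus>\<^bsub>?M\<^esub>i\<in>{..<length rs}. (rs ! i) \<odot>\<^bsub>?M\<^esub> v i)" by (auto simp: list_smult_def)
      then have "\<forall>i. i < length rs \<longrightarrow> (\<exists>w. w \<in> polys X \<and> v i = cls w)" by (auto simp: cM Pi_def)
      then obtain w where w: "\<And>i. i < length rs \<Longrightarrow> w i \<in> polys X \<and> v i = cls (w i)" by metis
      then have "(\<Sum>i<length rs. rs ! i * w i) \<in> foldl (polys.adjoin X) L rs"
        unfolding polys.mem_foldl_adjoin_iff using polys.ideal_zero[OF L] by (intro bexI[of _ 0] exI[of _ w]) auto
      then show "y \<in> cls ` foldl (polys.adjoin X) L rs" using v(2) key[OF w] by auto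
    qed
    show "cls ` foldl (polys.adjoin X) L rs \<subseteq> list_smult rs ?M"
    proof safe
      fix p assume "p \<in> foldl (polys.adjoin X) L rs"
      then obtain a w where a: "a \<in> L" "\<And>i. i < length rs \<Longrightarrow> w i \<in> polys X"
        "p = a + (\<Sum>i<length rs. rs ! i * w i)" unfolding polys.mem_foldl_adjoin_iff by blast
      have "cls p = cls (\<Sum>i<length rs. rs ! i * w i)"
        using a sumX[OF a(2)] polys.ideal_sub[OF L a(1)] by (subst cls_eq_iff) (auto intro: polys.add_in)
      also have "\<dots> = (\<Oplus>\<^bsub>?M\<^esub>i\<in>{..<length rs}. (rs ! i) \<odot>\<^bsub>?M\<^esub> cls (w i))"
        using a(2) by (intro key[symmetric]) auto
      finally show "cls p \<in> list_smult rs ?M"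
        unfolding list_smult_def using a(2)
        by (intro CollectI exI[of _ "\<lambda>i. cls (w i)"]) (auto simp: cM)
    qed
  qed
qed

lemma cls_in_image_iff:
  assumes "polys.is_ideal X K" "L \<subseteq> K" "p \<in> polys X"
  shows "cls p \<in> cls ` K \<longleftrightarrow> p \<in> K"
proof
  assume "cls p \<in> cls ` K"
  then obtain q where q: "q \<in> K" "cls p = cls q" by auto
  then have "p - q \<in> K" using cls_eq_iff[OF assms(3) polys.ideal_sub[OF assms(1) q(1)]] assms(2) by auto
  then show "p \<in> K" using polys.ideal_add[OF assms(1) _ q(1)] by fastforce
qed auto

lemma regular_sequence_quot_module_iff:
  assumes rs: "set rs \<subseteq> aug X" and La: "L \<subseteq> aug X"
  shows "regular_sequence (quot_module K[X] L) rs \<longleftrightarrow> polys.regseq X L rs"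
proof -
  let ?M = "quot_module K[X] L"
  have rsX: "set rs \<subseteq> polys X" using rs by (auto simp: aug_def)
  have tX: "set (take i rs) \<subseteq> polys X" for i using rsX set_take_subset[of i rs] by blast
  have sm: "r \<odot>\<^bsub>?M\<^esub> cls w = cls (r * w)" if "r \<in> polys X" "w \<in> polys X" for r w
    using that by (simp add: quot_module_def ring.defs module.defs cls_mult)
  have cM: "carrier ?M = cls ` polys X" by (simp add: quot_module_def ring.defs carrier_Quot)
  have mem: "cls p \<in> list_smult (take i rs) ?M \<longleftrightarrow> p \<in> foldl (polys.adjoin X) L (take i rs)"
    if "p \<in> polys X" for p i
    unfolding list_smult_quot_module[OF tX]
    by (rule cls_in_image_iff[OF polys.ideal_foldl_adjoin[OF L tX] polys.foldl_adjoin_sub that])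
  \<comment> \<open>The nonvanishing clause of \<open>regular_sequence\<close>: everything adjoined
    has zero constant term, so the class of 1 is never reached.\<close>
  have "foldl (polys.adjoin X) L rs \<subseteq> aug X" by (rule polys.foldl_adjoin_least[OF ideal_aug La rs])
  then have "1 \<notin> foldl (polys.adjoin X) L rs" by (auto simp: aug_def)
  then have "cls 1 \<notin> list_smult rs ?M" using mem[OF polys.one_in, of "length rs"] by simp
  moreover have "cls 1 \<in> carrier ?M" using polys.one_in by (auto simp: cM)
  ultimately have ne: "list_smult rs ?M \<noteq> carrier ?M" by blast
  have "(\<forall>v\<in>carrier ?M. (rs ! i) \<odot>\<^bsub>?M\<^esub> v \<in> list_smult (take i rs) ?M \<longrightarrow> v \<in> list_smult (take i rs) ?M)
      \<longleftrightarrow> polys.nonzerodiv X (foldl (polys.adjoin X) L (take i rs)) (rs ! i)" if "i < length rs" for i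
  proof -
    have "rs ! i \<in> polys X" using rsX that nth_mem by blast
    then show ?thesis by (auto simp: cM sm mem polys.nonzerodiv_def polys.mult_in)
  qed
  then show ?thesis using ne by (auto simp: regular_sequence_def polys.regseq_iff)
qed

lemma depth_quot_eq:
  assumes "L \<subseteq> aug X"
  shows "depth_quot X L = (SUP k\<in>{k. polys.grade_ge X (aug X) L k}. enat k)"
proof -
  have "{rs. set rs \<subseteq> aug X \<and> regular_sequence (quot_module K[X] L) rs} =
      {rs. set rs \<subseteq> aug X \<and> polys.regseq X L rs}"
    using regular_sequence_quot_module_iff[OF _ assms] by blast
  moreover have "{k. polys.grade_ge X (aug X) L k} = length ` {rs. set rs \<subseteq> aug X \<and> polys.regseq X L rs}"
    by (auto simp: polys.grade_ge_def)
  ultimately show ?thesis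
    by (simp add: depth_quot_def depth_def graded_max_ideal_eq image_image)
qed

text \<open>Valid also for an infinite supremum: some sequence is longer than \<open>k - 1\<close>,
  and it can be truncated.\<close>

lemma grade_ge_iff_depth_quot:
  assumes "L \<subseteq> aug X"
  shows "polys.grade_ge X (aug X) L k \<longleftrightarrow> enat k \<le> depth_quot X L"
proof
  assume "polys.grade_ge X (aug X) L k"
  then show "enat k \<le> depth_quot X L" unfolding depth_quot_eq[OF assms] by (intro SUP_upper) simp
next
  assume k: "enat k \<le> depth_quot X L"
  show "polys.grade_ge X (aug X) L k"
  proof (cases k)
    case 0
    then show ?thesis by (simp add: polys.grade_ge_0)
  next
    case (Suc i)
    then have "enat i < depth_quot X L" using k by (simp add: Suc_ile_eq)
    then obtain j where "polys.grade_ge X (aug X) L j" "i < j"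
      unfolding depth_quot_eq[OF assms] less_SUP_iff by auto
    then show ?thesis using polys.grade_ge_mono[of X "aug X" L j k] Suc by simp
  qed
qed

end

section \<open>Stanley decompositions\<close>

lemma monomial_in_polys: "Poly_Mapping.keys a \<subseteq> X \<Longrightarrow> monomial a \<in> polys X"
  by (auto simp: monomial_def polys_def)

definition stanley_sum :: "(monomial \<times> nat set) list \<Rightarrow> (nat \<Rightarrow> 'k::field mpoly) \<Rightarrow> 'k mpoly" where
  "stanley_sum D q = (\<Sum>i<length D. monomial (fst (D ! i)) * q i)"

definition stanley_coeffs :: "(monomial \<times> nat set) list \<Rightarrow> (nat \<Rightarrow> 'k::field mpoly) \<Rightarrow> bool" where
  "stanley_coeffs D q \<longleftrightarrow> (\<forall>i<length D. q i \<in> polys (snd (D ! i)))"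

definition stanley_data :: "nat set \<Rightarrow> (monomial \<times> nat set) list \<Rightarrow> bool" where
  "stanley_data X D \<longleftrightarrow> (\<forall>(a, Z)\<in>set D. Poly_Mapping.keys a \<subseteq> X \<and> Z \<subseteq> X)"

lemma stanley_term_in:
  assumes "stanley_data X D" "i < length D" "q \<in> polys (snd (D ! i))"
  shows "monomial (fst (D ! i)) * q \<in> polys X"
proof -
  have "Poly_Mapping.keys (fst (D ! i)) \<subseteq> X" "snd (D ! i) \<subseteq> X"
    using assms(1) nth_mem[OF assms(2)] by (auto simp: stanley_data_def case_prod_beta)
  then show ?thesis using subsetD[OF polys_mono assms(3)] by (intro polys.mult_in monomial_in_polys)
qed

lemma stanley_sum_in:
  assumes "stanley_data X D" "stanley_coeffs D q"
  shows "stanley_sum D q \<in> polys X"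
  unfolding stanley_sum_def using assms
  by (intro polys.ideal_sum[OF polys.ideal_carrier] stanley_term_in) (auto simp: stanley_coeffs_def)

context poly_quotient
begin

text \<open>Lifts the direct sum of spaces of classes to polynomials. The last clause merges
  directness of the sum with linear independence inside each summand.\<close>

lemma stanley_decomposition_iff:
  "stanley_decomposition X L D \<longleftrightarrow> stanley_data X D \<and>
    (\<forall>p\<in>polys X. \<exists>q. stanley_coeffs D q \<and> p - stanley_sum D q \<in> L) \<and>
    (\<forall>q. stanley_coeffs D q \<longrightarrow> stanley_sum D q \<in> L \<longrightarrow> (\<forall>i<length D. q i = 0))"
  (is "_ \<longleftrightarrow> _ \<and> ?span \<and> ?indep")
proof -
  let ?S = "\<lambda>i. stanley_space X L (fst (D ! i)) (snd (D ! i))"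
  let ?P = "\<Pi>\<^sub>E i\<in>{..<length D}. ?S i"
  let ?R = "K[X] Quot L"
  let ?t = "\<lambda>q i. monomial (fst (D ! i)) * q i :: 'k mpoly"
  have sumc: "(\<Oplus>\<^bsub>?R\<^esub>i\<in>{..<length D}. c i) = cls (stanley_sum D q)"
    if "stanley_data X D" "stanley_coeffs D q" "\<And>i. i < length D \<Longrightarrow> c i = cls (?t q i)" for c q
  proof -
    have t: "?t q i \<in> polys X" if "i < length D" for i
      using stanley_term_in[OF \<open>stanley_data X D\<close> that, of "q i"] \<open>stanley_coeffs D q\<close> that by (simp add: stanley_coeffs_def)
    have "(\<Oplus>\<^bsub>?R\<^esub>i\<in>{..<length D}. c i) = (\<Oplus>\<^bsub>?R\<^esub>i\<in>{..<length D}. cls (?t q i))"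
      using t that(3) by (intro QR.finsum_cong') (auto simp: carrier_Quot)
    also have "\<dots> = cls (stanley_sum D q)"
      using t unfolding stanley_sum_def by (intro finsum_cls) auto
    finally show ?thesis .
  qed
  have Pform: "\<exists>q. stanley_coeffs D q \<and> (\<forall>i<length D. c i = cls (?t q i))" if "c \<in> ?P" for c
  proof -
    have "\<forall>i. i < length D \<longrightarrow> (\<exists>q. q \<in> polys (snd (D ! i)) \<and> c i = cls (monomial (fst (D ! i)) * q))"
      using that by (auto simp: PiE_def Pi_def stanley_space_def)
    then show ?thesis unfolding stanley_coeffs_def by metis
  qed
  have inP: "restrict (\<lambda>i. cls (?t q i)) {..<length D} \<in> ?P" if "stanley_coeffs D q" for q
    using that by (auto simp: stanley_coeffs_def stanley_space_def)
  let ?uniq = "\<forall>v\<in>carrier ?R. \<exists>!c. c \<in> ?P \<and> v = (\<Oplus>\<^bsub>?R\<^esub>i\<in>{..<length D}. c i)"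
  let ?ind = "\<forall>(a, Z)\<in>set D. independent_classes L a Z"
  have def: "stanley_decomposition X L D \<longleftrightarrow> stanley_data X D \<and> ?ind \<and> ?uniq"
  proof -
    have "(\<forall>(a, Z)\<in>set D. Poly_Mapping.keys a \<subseteq> X \<and> Z \<subseteq> X \<and> independent_classes L a Z) \<longleftrightarrow>
        stanley_data X D \<and> ?ind" unfolding stanley_data_def by blast
    then show ?thesis unfolding stanley_decomposition_def by (simp only: conj_assoc)
  qed
  show ?thesis
  proof (cases "stanley_data X D")
    case data: True
    have in_poly: "stanley_sum D q \<in> polys X" if "stanley_coeffs D q" for q :: "nat \<Rightarrow> 'k mpoly"
      by (rule stanley_sum_in[OF data that])
    have eq: "?ind \<and> ?uniq \<longleftrightarrow> ?span \<and> ?indep"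
    proof
      assume asm: "?ind \<and> ?uniq"
      have ?span
      proof
        fix p :: "'k mpoly" assume p: "p \<in> polys X"
        then have "cls p \<in> carrier ?R" by (auto simp: carrier_Quot)
        from bspec[OF conjunct2[OF asm] this]
        obtain c where c: "c \<in> ?P" "cls p = (\<Oplus>\<^bsub>?R\<^esub>i\<in>{..<length D}. c i)"
          by (elim ex1E conjE)
        obtain q where q: "stanley_coeffs D q" "\<forall>i<length D. c i = cls (?t q i)" using Pform[OF c(1)] by blast
        have "cls p = cls (stanley_sum D q)" using c(2) sumc[OF data q(1)] q(2) by simp
        then have "p - stanley_sum D q \<in> L" using cls_eq_iff[OF p in_poly[OF q(1)]] by simp
        then show "\<exists>q. stanley_coeffs D q \<and> p - stanley_sum D q \<in> L" using q(1) by blast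
      qed
      moreover have ?indep
      proof (intro allI impI)
        fix q :: "nat \<Rightarrow> 'k mpoly" and i
        assume q: "stanley_coeffs D q" "stanley_sum D q \<in> L" and i: "i < length D"
        define c where "c q = restrict (\<lambda>i. cls (?t q i)) {..<length D}" for q
        have z: "stanley_coeffs D (\<lambda>_. 0)" by (simp add: stanley_coeffs_def polys.zero_in)
        have c0: "cls 0 = (\<Oplus>\<^bsub>?R\<^esub>i\<in>{..<length D}. c (\<lambda>_. 0) i)"
          by (subst sumc[OF data z]) (auto simp: c_def stanley_sum_def)
        have cq: "cls 0 = (\<Oplus>\<^bsub>?R\<^esub>i\<in>{..<length D}. c q i)"
        proof -
          have "cls 0 = cls (stanley_sum D q)"
            using cls_eq_iff[OF polys.zero_in in_poly[OF q(1)]] polys.ideal_uminus[OF L q(2)] by simp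
          then show ?thesis by (subst sumc[OF data q(1)]) (auto simp: c_def)
        qed
        have cP: "c q \<in> ?P" "c (\<lambda>_. 0) \<in> ?P" using inP[OF q(1)] inP[OF z] by (auto simp: c_def)
        have "cls 0 \<in> carrier ?R" using polys.zero_in by (auto simp: carrier_Quot)
        from bspec[OF conjunct2[OF asm] this]
        obtain d where d: "\<And>c. c \<in> ?P \<and> cls 0 = (\<Oplus>\<^bsub>?R\<^esub>i\<in>{..<length D}. c i) \<Longrightarrow> c = d"
          by (elim ex1E) blast
        \<comment> \<open>Both families represent the zero class, so uniqueness identifies them
          summand by summand; independence inside the \<open>i\<close>-th summand then gives
          \<open>q i = 0\<close>.\<close>
        have "c q = c (\<lambda>_. 0)" using d[OF conjI[OF cP(1) cq]] d[OF conjI[OF cP(2) c0]] by simp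
        then have "c q i = c (\<lambda>_. 0) i" by simp
        then have eq: "cls (?t q i) = cls 0" using i by (simp add: c_def)
        have qi: "q i \<in> polys (snd (D ! i))" using q(1) i by (simp add: stanley_coeffs_def)
        have "?t q i \<in> L"
          using eq cls_eq_iff[OF stanley_term_in[OF data i qi] polys.zero_in] by simp
        moreover have "independent_classes L (fst (D ! i)) (snd (D ! i))"
          using asm nth_mem[OF i] by (auto split: prod.splits)
        ultimately show "q i = 0" using qi by (simp add: independent_classes_def)
      qed
      ultimately show "?span \<and> ?indep" ..
    next
      assume asm: "?span \<and> ?indep"
      have ?ind
      proof safe
        fix a Z assume "(a, Z) \<in> set D"
        then obtain i where i: "i < length D" "D ! i = (a, Z)" by (auto simp: in_set_conv_nth)
        show "independent_classes L a Z" unfolding independent_classes_def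
        proof (intro ballI impI)
          fix q assume q: "q \<in> carrier (K[Z] :: 'k mpoly ring)" "monomial a * q \<in> L"
          let ?q = "\<lambda>j. if j = i then q else 0"
          have "stanley_coeffs D ?q" using q i by (auto simp: stanley_coeffs_def polys.zero_in)
          moreover have "stanley_sum D ?q = monomial a * q"
          proof -
            have "stanley_sum D ?q = (\<Sum>j<length D. if j = i then monomial a * q else 0)"
              unfolding stanley_sum_def using i by (intro sum.cong) auto
            then show ?thesis using i by simp
          qed
          ultimately have "?q i = 0"
            using q(2) i(1) by (intro conjunct2[OF asm, rule_format]) simp_all
          then show "q = 0" by simp
        qed
      qed
      moreover have ?uniq
      proof
        fix v assume "v \<in> carrier ?R"
        then obtain p where p: "p \<in> polys X" "v = cls p" by (auto simp: carrier_Quot)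
        obtain q where q: "stanley_coeffs D q" "p - stanley_sum D q \<in> L"
          using bspec[OF conjunct1[OF asm] p(1)] by (elim exE conjE)
        let ?c = "restrict (\<lambda>i. cls (?t q i)) {..<length D}"
        have v: "v = cls (stanley_sum D q)" using cls_eq_iff[OF p(1) in_poly[OF q(1)]] q(2) p(2) by simp
        show "\<exists>!c. c \<in> ?P \<and> v = (\<Oplus>\<^bsub>?R\<^esub>i\<in>{..<length D}. c i)"
        proof (rule ex1I[of _ ?c])
          show "?c \<in> ?P \<and> v = (\<Oplus>\<^bsub>?R\<^esub>i\<in>{..<length D}. ?c i)"
            using inP[OF q(1)] sumc[OF data q(1), of ?c] v by simp
        next
          fix c assume c: "c \<in> ?P \<and> v = (\<Oplus>\<^bsub>?R\<^esub>i\<in>{..<length D}. c i)"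
          then obtain r where r: "stanley_coeffs D r" "\<forall>i<length D. c i = cls (?t r i)" using Pform by blast
          have "cls (stanley_sum D r) = cls (stanley_sum D q)" using sumc[OF data r(1)] r(2) c v by simp
          then have "stanley_sum D r - stanley_sum D q \<in> L" using cls_eq_iff[OF in_poly[OF r(1)] in_poly[OF q(1)]] by simp
          moreover have "stanley_sum D r - stanley_sum D q = stanley_sum D (\<lambda>i. r i - q i)"
            by (simp add: stanley_sum_def sum_subtractf right_diff_distrib)
          moreover have "stanley_coeffs D (\<lambda>i. r i - q i)"
            using r(1) q(1) by (auto simp: stanley_coeffs_def polys.diff_in)
          ultimately have "r i - q i = 0" if "i < length D" for i
            using conjunct2[OF asm, rule_format, of "\<lambda>i. r i - q i" i] that by simp
          then have "c i = ?c i" if "i \<in> {..<length D}" for i using that r(2) by simp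
          then show "c = ?c" by (rule PiE_ext[OF conjunct1[OF c] inP[OF q(1)]])
        qed
      qed
      ultimately show "?ind \<and> ?uniq" ..
    qed
    show ?thesis unfolding def eq ..
  next
    case False
    then show ?thesis unfolding def by (simp only: simp_thms)
  qed
qed

lemma stanley_decomposition_nonempty:
  assumes "stanley_decomposition X L D" "L \<noteq> polys X"
  shows "D \<noteq> []"
proof
  assume "D = []"
  then have "p \<in> L" if "p \<in> polys X" for p
    using assms(1) that unfolding stanley_decomposition_iff by (auto simp: stanley_sum_def)
  then show False using assms(2) polys.ideal_sub[OF L] by blast
qed

lemma sdepth_quot_props:
  assumes "finite X" "L \<noteq> polys X"
  shows sdepth_quot_upper: "stanley_decomposition X L D \<Longrightarrow> sdepth_decomposition D \<le> sdepth_quot X L"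
    and sdepth_quot_attained: "sdepth_quot X L > 0 \<Longrightarrow>
      \<exists>D. stanley_decomposition X L D \<and> sdepth_decomposition D = sdepth_quot X L"
proof -
  let ?S = "sdepth_decomposition ` {D. stanley_decomposition X L D}"
  have bound: "sdepth_decomposition D \<le> card X" if "stanley_decomposition X L D" for D
  proof -
    have "D \<noteq> []" by (rule stanley_decomposition_nonempty[OF that assms(2)])
    then obtain a Z where aZ: "(a, Z) \<in> set D" by (cases D) auto
    then have "Z \<subseteq> X" using that unfolding stanley_decomposition_iff stanley_data_def by blast
    then have "card Z \<le> card X" using assms(1) by (intro card_mono)
    moreover have "sdepth_decomposition D \<le> card Z"
      unfolding sdepth_decomposition_def using aZ by (intro Min_le) (auto intro!: image_eqI)
    ultimately show ?thesis by simp
  qed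
  have "?S \<subseteq> {..card X}" using bound by blast
  then have fin: "finite ?S" by (rule finite_subset) simp
  show "sdepth_decomposition D \<le> sdepth_quot X L" if "stanley_decomposition X L D"
    unfolding sdepth_quot_def using that fin by (intro cSUP_upper) (auto intro: bdd_above_finite)
  assume pos: "sdepth_quot X L > 0"
  \<comment> \<open>The supremum of the empty set of naturals is 0, so a positive value certifies
    that a decomposition exists.\<close>
  have "?S \<noteq> {}"
  proof
    assume "?S = {}"
    then show False using pos unfolding sdepth_quot_def by (simp add: Sup_nat_def)
  qed
  then have "Sup ?S \<in> ?S" using fin by (simp add: cSup_eq_Max)
  then show "\<exists>D. stanley_decomposition X L D \<and> sdepth_decomposition D = sdepth_quot X L"
    unfolding sdepth_quot_def by auto
qed

end

lemma sum_lessThan_add: "(\<Sum>i<m + n. f i) = (\<Sum>i<m. f i) + (\<Sum>i<n. f (m + i :: nat) :: 'a::comm_monoid_add)"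
  by (induction n) (simp_all add: add.assoc)

lemma stanley_sum_append:
  "stanley_sum (D @ E) q = stanley_sum D q + stanley_sum E (\<lambda>i. q (length D + i))"
  by (simp add: stanley_sum_def sum_lessThan_add nth_append)

lemma all_less_add: "(\<forall>i<m + n. P i) \<longleftrightarrow> (\<forall>i<m. P i) \<and> (\<forall>i<n. P (m + i :: nat))"
  by (induction n) (auto simp: All_less_Suc)

lemma stanley_coeffs_append:
  "stanley_coeffs (D @ E) q \<longleftrightarrow> stanley_coeffs D q \<and> stanley_coeffs E (\<lambda>i. q (length D + i))"
  by (simp add: stanley_coeffs_def all_less_add nth_append)

text \<open>Transports summands of \<open>S/(U : x)\<close> into \<open>S/U\<close> along
  multiplication by \<open>x\<close>, leaving the sets \<open>Z\<close> unchanged.\<close>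

definition shift_var :: "nat \<Rightarrow> (monomial \<times> nat set) list \<Rightarrow> (monomial \<times> nat set) list" where
  "shift_var x = map (\<lambda>(a, Z). (Poly_Mapping.single x 1 + a, Z))"

lemma stanley_sum_shift:
  fixes q :: "nat \<Rightarrow> 'k::field mpoly"
  shows "stanley_sum (shift_var x D) q = var x * stanley_sum D q"
proof -
  have "monomial (Poly_Mapping.single x (Suc 0) + a) = (var x * monomial a :: 'k mpoly)" for a
    by (simp add: var_def monomial_def mult_single)
  then show ?thesis
    by (simp add: stanley_sum_def shift_var_def sum_distrib_left case_prod_beta mult.assoc)
qed

lemma stanley_coeffs_shift: "stanley_coeffs (shift_var x D) q \<longleftrightarrow> stanley_coeffs D q"
  by (simp add: stanley_coeffs_def shift_var_def case_prod_beta)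

lemma ideal_Int_polys:
  fixes U :: "'k::field mpoly set"
  assumes U: "polys.is_ideal Y U" and XY: "X \<subseteq> Y"
  shows "polys.is_ideal X (U \<inter> polys X)"
proof (rule polys.is_idealI)
  fix r a :: "'k mpoly" assume "r \<in> polys X" "a \<in> U \<inter> polys X"
  then show "r * a \<in> U \<inter> polys X"
    using polys.ideal_mult[OF U subsetD[OF polys_mono[OF XY]]] polys.mult_in by blast
qed (auto simp: polys.ring_in polys.ideal_zero[OF U] polys.ideal_add[OF U])

text \<open>As a vector space, \<open>S/U\<close> is the sum of \<open>S'/(U \<inter> S')\<close>,
  the classes free of \<open>x\<close>, and of the image of \<open>S/(U : x)\<close> under
  multiplication by \<open>x\<close>. The sum is direct because \<open>U\<close> is graded.\<close>

lemma stanley_decomposition_glue: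
  fixes U :: "'k::field mpoly set"
  assumes U: "polys.is_ideal (insert x X) U" and g: "graded_in x U" and x: "x \<notin> X"
    and A: "stanley_decomposition (insert x X) (polys.quot (insert x X) U (var x)) D"
    and C: "stanley_decomposition X (U \<inter> polys X) E"
  shows "stanley_decomposition (insert x X) U (E @ shift_var x D)"
proof -
  let ?Y = "insert x X"
  have UX: "polys.is_ideal X (U \<inter> polys X)" by (rule ideal_Int_polys[OF U]) auto
  interpret B: poly_quotient ?Y U by unfold_locales (rule U)
  interpret A: poly_quotient ?Y "polys.quot ?Y U (var x)" by unfold_locales (rule polys.ideal_quot[OF U])
  interpret C: poly_quotient X "U \<inter> polys X" by unfold_locales (rule UX)
  note A' = A[unfolded A.stanley_decomposition_iff] and C' = C[unfolded C.stanley_decomposition_iff]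
  have free: "var_coeff x 0 p = p" if "p \<in> polys X" for p :: "'k mpoly"
    by (simp add: var_coeff_free[OF that x])
  show ?thesis unfolding B.stanley_decomposition_iff
  proof (intro conjI ballI allI impI)
    have "Poly_Mapping.keys (Poly_Mapping.single x 1 + a) \<subseteq> ?Y" if "Poly_Mapping.keys a \<subseteq> ?Y" for a :: monomial
      using that Poly_Mapping.keys_add[of "Poly_Mapping.single x 1" a] by auto
    then show "stanley_data ?Y (E @ shift_var x D)"
      using A' C' unfolding stanley_data_def shift_var_def by fastforce
  next
    fix p :: "'k mpoly" assume p: "p \<in> polys ?Y"
    then obtain r where r: "r \<in> polys ?Y" "p = var_coeff x 0 p + var x * r" by (rule var_coeff_0_split)
    obtain q where q: "stanley_coeffs E q" "var_coeff x 0 p - stanley_sum E q \<in> U"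
      using C' var_coeff_in[OF p] by blast
    obtain s where s: "stanley_coeffs D s" "r - stanley_sum D s \<in> polys.quot ?Y U (var x)"
      using A' r(1) by blast
    let ?q = "\<lambda>i. if i < length E then q i else s (i - length E)"
    have eq: "stanley_sum E ?q = stanley_sum E q" by (simp add: stanley_sum_def)
    have "stanley_coeffs (E @ shift_var x D) ?q"
      unfolding stanley_coeffs_append stanley_coeffs_shift using q(1) s(1) by (simp add: stanley_coeffs_def)
    moreover have "p - stanley_sum (E @ shift_var x D) ?q =
        (var_coeff x 0 p - stanley_sum E q) + (r - stanley_sum D s) * var x"
    proof -
      have "p - stanley_sum (E @ shift_var x D) ?q =
          p - (stanley_sum E q + var x * stanley_sum D s)"
        by (simp add: stanley_sum_append stanley_sum_shift eq)
      also have "p - (stanley_sum E q + var x * stanley_sum D s) =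
          (var_coeff x 0 p + var x * r) - (stanley_sum E q + var x * stanley_sum D s)"
        using r(2) by simp
      finally show ?thesis by (simp add: algebra_simps)
    qed
    moreover have "(r - stanley_sum D s) * var x \<in> U" using s(2) by (simp add: polys.quot_def)
    ultimately show "\<exists>q. stanley_coeffs (E @ shift_var x D) q \<and> p - stanley_sum (E @ shift_var x D) q \<in> U"
      using polys.ideal_add[OF U q(2), of "(r - stanley_sum D s) * var x"] by (intro exI[of _ ?q]) simp
  next
    fix q i assume q: "stanley_coeffs (E @ shift_var x D) q" "stanley_sum (E @ shift_var x D) q \<in> U"
      and i: "i < length (E @ shift_var x D)"
    let ?s = "\<lambda>i. q (length E + i)"
    have cE: "stanley_coeffs E q" and cD: "stanley_coeffs D ?s"
      using q(1) by (auto simp: stanley_coeffs_append stanley_coeffs_shift)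
    have EX: "stanley_sum E q \<in> polys X" using C' cE by (intro stanley_sum_in) auto
    have DY: "stanley_sum D ?s \<in> polys ?Y" using A' cD by (intro stanley_sum_in) auto
    have sum: "stanley_sum E q + var x * stanley_sum D ?s \<in> U"
      using q(2) by (simp add: stanley_sum_append stanley_sum_shift)
    \<comment> \<open>The part of degree 0 in \<open>x\<close> of a relation is again a relation and
      involves only \<open>E\<close>; the rest is a relation for \<open>D\<close> multiplied by
      \<open>x\<close>.\<close>
    have "var_coeff x 0 (stanley_sum E q + var x * stanley_sum D ?s) = stanley_sum E q"
      by (simp add: var_coeff_add var_coeff_var_mult free[OF EX])
    then have E: "stanley_sum E q \<in> U" using graded_inD0[OF g sum] by simp
    then have zE: "\<forall>i<length E. q i = 0" using C' cE EX by blast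
    have "var x * stanley_sum D ?s \<in> U" using polys.ideal_diff[OF U sum E] by simp
    then have "stanley_sum D ?s \<in> polys.quot ?Y U (var x)" using DY by (simp add: polys.quot_def mult.commute)
    then have zD: "\<forall>i<length D. ?s i = 0" using A' cD by blast
    have "\<forall>i<length E + length D. q i = 0" using zE zD by (simp add: all_less_add)
    then show "q i = 0" using i by (simp add: shift_var_def)
  qed
qed

text \<open>If the right-hand term exceeded the middle one as well, the glued decomposition would be
  too good for the middle term. The two strict inequalities also make both outer values positive, so
  that decompositions attaining them exist.\<close>

lemma sdepth_quot_le:
  fixes U :: "'k::field mpoly set"
  assumes X: "finite X" "x \<notin> X" and U: "polys.is_ideal (insert x X) U" and g: "graded_in x U"
    and proper: "U \<noteq> polys (insert x X)" "polys.quot (insert x X) U (var x) \<noteq> polys (insert x X)"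
      "U \<inter> polys X \<noteq> polys X"
    and gt: "sdepth_quot (insert x X) (polys.quot (insert x X) U (var x)) > sdepth_quot (insert x X) U"
  shows "sdepth_quot X (U \<inter> polys X) \<le> sdepth_quot (insert x X) U"
proof (rule ccontr)
  assume nle: "\<not> ?thesis"
  let ?Y = "insert x X"
  have UX: "polys.is_ideal X (U \<inter> polys X)" by (rule ideal_Int_polys[OF U]) auto
  have Y: "finite ?Y" using X by simp
  interpret B: poly_quotient ?Y U by unfold_locales (rule U)
  interpret A: poly_quotient ?Y "polys.quot ?Y U (var x)" by unfold_locales (rule polys.ideal_quot[OF U])
  interpret C: poly_quotient X "U \<inter> polys X" by unfold_locales (rule UX)
  obtain D where D: "stanley_decomposition ?Y (polys.quot ?Y U (var x)) D"
    "sdepth_decomposition D = sdepth_quot ?Y (polys.quot ?Y U (var x))"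
    using A.sdepth_quot_attained[OF Y proper(2)] gt by auto
  obtain E where E: "stanley_decomposition X (U \<inter> polys X) E"
    "sdepth_decomposition E = sdepth_quot X (U \<inter> polys X)"
    using C.sdepth_quot_attained[OF X(1) proper(3)] nle by auto
  have ne: "D \<noteq> []" "E \<noteq> []"
    using A.stanley_decomposition_nonempty[OF D(1) proper(2)]
      C.stanley_decomposition_nonempty[OF E(1) proper(3)] by auto
  have "sdepth_decomposition (E @ shift_var x D) \<le> sdepth_quot ?Y U"
    by (rule B.sdepth_quot_upper[OF Y proper(1) stanley_decomposition_glue[OF U g X(2) D(1) E(1)]])
  moreover have "(\<lambda>(a, Z). card Z) ` set (shift_var x D) = (\<lambda>(a, Z). card Z) ` set D"
    by (force simp: shift_var_def image_iff)
  then have "sdepth_decomposition (E @ shift_var x D) = min (sdepth_decomposition E) (sdepth_decomposition D)"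
    unfolding sdepth_decomposition_def using ne by (simp add: image_Un Min_Un)
  ultimately show False using gt nle D(2) E(2) by simp
qed

section \<open>The depth lemma\<close>

text \<open>The first bound rests on \<open>f1\<close> alone. For the equality, \<open>f3\<close>
  makes \<open>dC\<close> at least \<open>dB\<close>, and by \<open>f2\<close> a larger
  \<open>dC\<close> would raise \<open>dB\<close> too.\<close>

lemma depth_short_exact:
  fixes U :: "'k::field mpoly set"
  assumes X: "finite X" "x \<notin> X" and U: "polys.is_ideal (insert x X) U" and g: "graded_in x U"
    and Ua: "U \<subseteq> aug (insert x X)" and Qa: "polys.quot (insert x X) U (var x) \<subseteq> aug (insert x X)"
  defines "dA \<equiv> depth_quot (insert x X) (polys.quot (insert x X) U (var x))"
    and "dB \<equiv> depth_quot (insert x X) U" and "dC \<equiv> depth_quot X (U \<inter> polys X)"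
  shows depth_right_bound: "dB \<le> dC + 1"
    and depth_right_eq: "dA > dB \<Longrightarrow> dC = dB"
proof -
  let ?Y = "insert x X"
  let ?E = "aug ?Y :: 'k mpoly set"
  let ?C = "polys.adjoin ?Y U (var x)"
  interpret Y: noetherian_carrier "polys ?Y :: 'k mpoly set" using X by (intro noetherian_polys) auto
  have xY: "var x \<in> (polys ?Y :: 'k mpoly set)" by (rule var_in_polys) simp
  have E: "Y.add_mult_closed ?E" by (rule Y.ideal_add_mult_closed[OF ideal_aug])
  interpret B: poly_quotient ?Y U by unfold_locales (rule U)
  interpret A: poly_quotient ?Y "polys.quot ?Y U (var x)" by unfold_locales (rule polys.ideal_quot[OF U])
  interpret C: poly_quotient X "U \<inter> polys X" by unfold_locales (rule ideal_Int_polys[OF U], auto)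
  have Ca: "U \<inter> polys X \<subseteq> aug X" using Ua by (auto simp: aug_def)
  note iffA = A.grade_ge_iff_depth_quot[OF Qa, folded dA_def]
    and iffB = B.grade_ge_iff_depth_quot[OF Ua, folded dB_def]
  have iffC: "polys.grade_ge ?Y ?E ?C k \<longleftrightarrow> enat k \<le> dC" for k
    using grade_ge_restrict[OF X polys.ideal_adjoin[OF U xY] polys.adjoin_gen1[OF U]]
      graded_adjoin_var_Int[OF X U g] C.grade_ge_iff_depth_quot[OF Ca] by (simp add: dC_def)
  have f1: "enat k \<le> dC" if "enat (Suc k) \<le> dB" for k
    using grade_ge_adjoin_var[OF X U g, of k] that by (simp add: iffB iffC)
  have f2: "enat k \<le> dB" if "enat k \<le> dA" "enat k \<le> dC" for k
    using Y.grade_ge_middle[OF E xY U, of k] that by (simp add: iffA iffB iffC)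
  have f3: "enat k \<le> dC" if "enat (Suc k) \<le> dA" "enat k \<le> dB" for k
    using Y.grade_ge_right[OF E xY U, of k] that by (simp add: iffA iffB iffC)
  show "dB \<le> dC + 1"
  proof (rule ccontr)
    assume "\<not> ?thesis"
    then obtain c where c: "dC = enat c" "dC + 1 < dB" by (cases dC) auto
    then have "enat (Suc (Suc c)) \<le> dB" by (simp add: Suc_ile_eq one_enat_def)
    then show False using f1 c(1) by fastforce
  qed
  assume gt: "dA > dB"
  \<comment> \<open>Being strictly below \<open>dA\<close> makes \<open>dB\<close> finite, so its
    successor makes sense as a length.\<close>
  then obtain b where b: "dB = enat b" by (cases dB) auto
  then have Sb: "enat (Suc b) \<le> dA" using gt by (simp add: Suc_ile_eq)
  have "enat b \<le> dC" using f3[OF Sb] b by simp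
  moreover have "\<not> enat b < dC"
  proof
    assume "enat b < dC"
    then have "enat (Suc b) \<le> dB" using f2[OF Sb] by (simp add: Suc_ile_eq)
    then show False using b by simp
  qed
  ultimately show "dC = dB" using b by (simp add: not_less)
qed

section \<open>Powers of the ideal\<close>

lemma poly_prodI: "a \<in> K \<Longrightarrow> b \<in> L \<Longrightarrow> a * b \<in> K \<cdot>\<^bsub>K[X]\<^esub> L"
  using ideal_prod.prod[of a K b L "K[X]"] by simp

lemma poly_sumI:
  "a \<in> K \<cdot>\<^bsub>K[X]\<^esub> L \<Longrightarrow> b \<in> K \<cdot>\<^bsub>K[X]\<^esub> L \<Longrightarrow> a + b \<in> K \<cdot>\<^bsub>K[X]\<^esub> L"
  using ideal_prod.sum[of a "K[X]" K L b] by simp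

lemma prod_in_ideal:
  assumes I: "polys.is_ideal X I" and "\<And>a b. a \<in> K \<Longrightarrow> b \<in> L \<Longrightarrow> a * b \<in> I"
  shows "K \<cdot>\<^bsub>K[X]\<^esub> L \<subseteq> I"
proof
  fix p assume "p \<in> K \<cdot>\<^bsub>K[X]\<^esub> L"
  then show "p \<in> I"
    by (induction p rule: ideal_prod.induct) (use assms polys.ideal_add[OF I] in auto)
qed

text \<open>Isolates what the argument uses of the path ideals. The inclusion
  \<open>J' \<subseteq> aug X\<close> keeps the quotients by all positive powers and their colon
  ideals nonzero.\<close>

locale split_ideal =
  fixes X :: "nat set" and x :: nat and I J' :: "'k::field mpoly set"
  assumes fin: "finite X" and x: "x \<notin> X"
    and I: "polys.is_ideal X I" and J': "polys.is_ideal X J'" and IJ': "I \<subseteq> J'"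
    and J'_aug: "J' \<subseteq> aug X"
begin

abbreviation Y :: "nat set" where "Y \<equiv> insert x X"

text \<open>The ideal \<open>I S + x J' S\<close>, described by its coefficients in
  \<open>x\<close>; the inclusion of \<open>I\<close> in \<open>J'\<close> makes this an
  ideal.\<close>

definition J :: "'k mpoly set" where
  "J = {p \<in> polys Y. var_coeff x 0 p \<in> I \<and> (\<forall>j>0. var_coeff x j p \<in> J')}"

text \<open>The ideal of coefficients of \<open>x^j\<close> in the \<open>t\<close>-th power.
  Truncated subtraction and \<open>min\<close> let one formula cover \<open>j >= t\<close>, where it
  is the power \<open>J'^t\<close>.\<close>

definition pow_coeff :: "nat \<Rightarrow> nat \<Rightarrow> 'k mpoly set" where
  "pow_coeff t j = ideal_power K[X] I (t - j) \<cdot>\<^bsub>K[X]\<^esub> ideal_power K[X] J' (min j t)"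

sublocale RX: cring "K[X] :: 'k mpoly ring" by (rule cring_poly_ring)
sublocale RY: cring "K[Y] :: 'k mpoly ring" by (rule cring_poly_ring)
sublocale MX: comm_monoid "ideals_set (K[X] :: 'k mpoly ring)" by (rule RX.ideals_set_is_comm_monoid)
sublocale MY: comm_monoid "ideals_set (K[Y] :: 'k mpoly ring)" by (rule RY.ideals_set_is_comm_monoid)

lemma carrier_ideals: "K \<in> carrier (ideals_set K[V]) \<longleftrightarrow> polys.is_ideal V K" for K :: "'k mpoly set" and V
  by (simp add: ideals_set_def ideal_poly_ring_iff)

lemma mult_ideals: "mult (ideals_set K[V]) = ideal_prod (K[V] :: 'k mpoly ring)" for V
  by (simp add: ideals_set_def)

lemma IJ_in: "I \<in> carrier (ideals_set K[X])" "J' \<in> carrier (ideals_set K[X])"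
  using I J' by (simp_all add: carrier_ideals)

lemma free: "var_coeff x j p = (if j = 0 then p else 0)" if "p \<in> polys X" for p :: "'k mpoly"
  by (rule var_coeff_free[OF that x])

lemma XY: "polys X \<subseteq> (polys Y :: 'k mpoly set)" by (rule polys_mono) auto

lemma ideal_J: "polys.is_ideal Y J"
proof (rule polys.is_idealI)
  fix a b :: "'k mpoly" assume "a \<in> J" "b \<in> J"
  then show "a + b \<in> J"
    using polys.ideal_add[OF I] polys.ideal_add[OF J'] by (simp add: J_def var_coeff_add polys.add_in)
next
  fix r a :: "'k mpoly" assume r: "r \<in> polys Y" and a: "a \<in> J"
  have aJ': "var_coeff x j a \<in> J'" for j using a IJ' by (cases j) (auto simp: J_def)
  have "var_coeff x j (r * a) \<in> J'" for j
    unfolding var_coeff_mult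
    by (rule polys.ideal_sum[OF J'], rule polys.ideal_mult[OF J' var_coeff_in[OF r] aJ'])
  moreover have "var_coeff x 0 (r * a) \<in> I"
    using polys.ideal_mult[OF I var_coeff_in[OF r]] a by (simp add: var_coeff_0_mult J_def)
  ultimately show "r * a \<in> J" using r a by (simp add: J_def polys.mult_in)
qed (auto simp: J_def polys.zero_in polys.ideal_zero[OF I] polys.ideal_zero[OF J'])

lemma J_in: "J \<in> carrier (ideals_set K[Y])"
  using ideal_J by (simp add: carrier_ideals)

lemma ideal_pow: "polys.is_ideal X (ideal_power K[X] I k)" "polys.is_ideal X (ideal_power K[X] J' k)"
  "polys.is_ideal Y (ideal_power K[Y] J k)"
  using MX.nat_pow_closed[OF IJ_in(1)] MX.nat_pow_closed[OF IJ_in(2)] MY.nat_pow_closed[OF J_in]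
  by (simp_all add: carrier_ideals)

lemma ideal_pow_coeff: "polys.is_ideal X (pow_coeff t j)"
  using MX.m_closed[OF MX.nat_pow_closed[OF IJ_in(1)] MX.nat_pow_closed[OF IJ_in(2)]]
  by (simp add: carrier_ideals mult_ideals pow_coeff_def)

lemma prod_mono:
  assumes "K \<subseteq> K'" "L \<subseteq> L'"
  shows "K \<cdot>\<^bsub>K[X]\<^esub> L \<subseteq> K' \<cdot>\<^bsub>K[X]\<^esub> (L' :: 'k mpoly set)"
proof
  fix p assume "p \<in> K \<cdot>\<^bsub>K[X]\<^esub> L"
  then show "p \<in> K' \<cdot>\<^bsub>K[X]\<^esub> L'"
    by (induction p rule: ideal_prod.induct) (use assms in \<open>auto intro: poly_prodI poly_sumI\<close>)
qed

lemma pow_coeff_mult_J': "pow_coeff t j \<cdot>\<^bsub>K[X]\<^esub> J' = pow_coeff (Suc t) (Suc j)"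
  using MX.m_assoc[OF MX.nat_pow_closed[OF IJ_in(1)] MX.nat_pow_closed[OF IJ_in(2)] IJ_in(2)]
  by (simp add: pow_coeff_def mult_ideals)

lemma pow_coeff_mult_I:
  assumes "j \<le> t"
  shows "pow_coeff t j \<cdot>\<^bsub>K[X]\<^esub> I = pow_coeff (Suc t) j"
proof -
  have c: "ideal_power K[X] I (t - j) \<in> carrier (ideals_set K[X])"
      "ideal_power K[X] J' (min j t) \<in> carrier (ideals_set K[X])"
    by (rule MX.nat_pow_closed, rule IJ_in)+
  have "pow_coeff t j \<cdot>\<^bsub>K[X]\<^esub> I =
      (ideal_power K[X] I (t - j) \<cdot>\<^bsub>K[X]\<^esub> I) \<cdot>\<^bsub>K[X]\<^esub> ideal_power K[X] J' (min j t)"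
    using MX.m_assoc[OF c IJ_in(1)] MX.m_assoc[OF c(1) IJ_in(1) c(2)] MX.m_comm[OF c(2) IJ_in(1)]
    by (simp add: pow_coeff_def mult_ideals)
  also have "ideal_power K[X] I (t - j) \<cdot>\<^bsub>K[X]\<^esub> I = ideal_power K[X] I (Suc t - j)"
    using assms by (simp add: Suc_diff_le mult_ideals)
  finally show ?thesis using assms by (simp add: pow_coeff_def)
qed

text \<open>Trading one factor \<open>I\<close> for the larger \<open>J'\<close> raises the index;
  once no factor \<open>I\<close> is left, the ideal is constant.\<close>

lemma pow_coeff_Suc: "pow_coeff t j \<subseteq> pow_coeff t (Suc j)"
proof (cases t)
  case (Suc s)
  show ?thesis
  proof (cases "j \<le> s")
    case True
    show ?thesis
      using prod_mono[OF subset_refl IJ', of "pow_coeff s j"]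
      unfolding Suc pow_coeff_mult_I[OF True] pow_coeff_mult_J' .
  qed (simp add: pow_coeff_def Suc)
qed (simp add: pow_coeff_def)

lemma pow_coeff_mono: "i \<le> j \<Longrightarrow> pow_coeff t i \<subseteq> pow_coeff t j"
  by (rule lift_Suc_mono_le[of "pow_coeff t"]) (rule pow_coeff_Suc)

text \<open>\<open>b\<close> stands for the coefficient of \<open>x^l\<close> in an element of
  \<open>J\<close>. It contributes a factor from \<open>I\<close> or from \<open>J'\<close>;
  monotonicity absorbs the excess of \<open>l\<close> over 1.\<close>

lemma mult_in_pow_coeff:
  assumes "a \<in> pow_coeff t i" "b \<in> (if l = 0 then I else J')"
  shows "a * b \<in> pow_coeff (Suc t) (i + l)"
proof -
  have J: "a * b \<in> pow_coeff (Suc t) (Suc i)" if "b \<in> J'" for b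
    using poly_prodI[OF assms(1) that, of X] by (simp add: pow_coeff_mult_J')
  show ?thesis
  proof (cases "l = 0")
    case False
    then have "a * b \<in> pow_coeff (Suc t) (Suc i)" using J assms(2) by simp
    then show ?thesis using pow_coeff_mono[of "Suc i" "i + l" "Suc t"] False by auto
  next
    case True
    then have b: "b \<in> I" using assms(2) by simp
    show ?thesis
    proof (cases "i \<le> t")
      case True
      then show ?thesis
        using poly_prodI[OF assms(1) b, of X] \<open>l = 0\<close> by (simp add: pow_coeff_mult_I)
    next
      case False
      \<comment> \<open>For \<open>i > t\<close> both sides are already the power
        \<open>J'^(t+1)\<close>, so \<open>b\<close> is used as an element of
        \<open>J'\<close>.\<close>
      then have "pow_coeff (Suc t) (Suc i) = pow_coeff (Suc t) i" by (simp add: pow_coeff_def)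
      then show ?thesis using J b IJ' \<open>l = 0\<close> by auto
    qed
  qed
qed

lemma pow_coeff_0: "pow_coeff 0 j = polys X"
proof
  show "pow_coeff 0 j \<subseteq> polys X" using polys.ideal_sub[OF ideal_pow_coeff] by blast
  show "polys X \<subseteq> pow_coeff 0 j"
  proof
    fix p :: "'k mpoly" assume "p \<in> polys X"
    then show "p \<in> pow_coeff 0 j"
      using poly_prodI[OF _ polys.one_in, of p "polys X" X X]
      by (simp add: pow_coeff_def ideals_set_def)
  qed
qed

text \<open>Description of \<open>J^t\<close> by coefficients, confirmed in
  \<open>ideal_power_J\<close>; in this form a colon by \<open>x^s\<close> is a shift of the
  index.\<close>

definition J_pow :: "nat \<Rightarrow> 'k mpoly set" where
  "J_pow t = {p \<in> polys Y. \<forall>j. var_coeff x j p \<in> pow_coeff t j}"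

lemma pow_subset: "ideal_power K[Y] J t \<subseteq> J_pow t"
proof (induction t)
  case 0
  show ?case using var_coeff_in by (auto simp: ideals_set_def J_pow_def pow_coeff_0)
next
  case (Suc t)
  show ?case
  proof
    fix p assume "p \<in> ideal_power K[Y] J (Suc t)"
    then have "p \<in> ideal_power K[Y] J t \<cdot>\<^bsub>K[Y]\<^esub> J" by (simp add: mult_ideals)
    then show "p \<in> J_pow (Suc t)"
    proof (induction p rule: ideal_prod.induct)
      case (prod a b)
      then have a: "a \<in> polys Y" "\<And>i. var_coeff x i a \<in> pow_coeff t i" using Suc by (auto simp: J_pow_def)
      have b: "b \<in> polys Y" "\<And>l. var_coeff x l b \<in> (if l = 0 then I else J')" using prod by (auto simp: J_def)
      have "var_coeff x l (a * b) \<in> pow_coeff (Suc t) l" for l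
        unfolding var_coeff_mult
      proof (rule polys.ideal_sum[OF ideal_pow_coeff])
        fix i assume "i \<in> {..l}"
        then show "var_coeff x i a * var_coeff x (l - i) b \<in> pow_coeff (Suc t) l"
          using mult_in_pow_coeff[OF a(2) b(2), of i "l - i"] by simp
      qed
      then show ?case using a(1) b(1) by (simp add: J_pow_def polys.mult_in)
    next
      case (sum a b)
      then show ?case
        using polys.ideal_add[OF ideal_pow_coeff] by (simp add: J_pow_def var_coeff_add polys.add_in)
    qed
  qed
qed

lemma I_sub_J: "I \<subseteq> J"
proof
  fix p assume p: "p \<in> I"
  then have "p \<in> polys X" by (rule polys.ideal_sub[OF I])
  then show "p \<in> J" using p XY polys.ideal_zero[OF J'] by (auto simp: J_def free)
qed

lemma var_J'_in_J: "p \<in> J' \<Longrightarrow> var x * p \<in> J"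
proof -
  assume p: "p \<in> J'"
  then have "p \<in> polys X" by (rule polys.ideal_sub[OF J'])
  then show "var x * p \<in> J"
    using p XY polys.ideal_zero[OF I] polys.ideal_zero[OF J'] var_in_polys[of x Y]
    by (auto simp: J_def free var_coeff_var_mult intro!: polys.mult_in)
qed

lemma I_pow_sub: "ideal_power K[X] I k \<subseteq> ideal_power K[Y] J k"
proof (induction k)
  case 0
  show ?case using XY by (simp add: ideals_set_def)
next
  case (Suc k)
  have "a * b \<in> ideal_power K[Y] J (Suc k)" if "a \<in> ideal_power K[X] I k" "b \<in> I" for a b
    using poly_prodI[of a "ideal_power K[Y] J k" b J Y] that Suc I_sub_J by (auto simp: mult_ideals)
  moreover have "a * b \<in> polys X" if "a \<in> ideal_power K[X] I k" "b \<in> I" for a b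
    by (rule polys.mult_in[OF polys.ideal_sub[OF ideal_pow(1) that(1)] polys.ideal_sub[OF I that(2)]])
  moreover have "polys.is_ideal X (ideal_power K[Y] J (Suc k) \<inter> polys X)"
    by (rule ideal_Int_polys[OF ideal_pow(3)]) auto
  ultimately have "ideal_power K[X] I k \<cdot>\<^bsub>K[X]\<^esub> I \<subseteq> ideal_power K[Y] J (Suc k) \<inter> polys X"
    by (intro prod_in_ideal) blast+
  then show ?case by (simp add: mult_ideals)
qed

lemma var_J'_pow_in: "p \<in> ideal_power K[X] J' k \<Longrightarrow> var x ^ k * p \<in> ideal_power K[Y] J k"
proof (induction k arbitrary: p)
  case 0
  then show ?case using XY by (auto simp: ideals_set_def)
next
  case (Suc k)
  then have "p \<in> ideal_power K[X] J' k \<cdot>\<^bsub>K[X]\<^esub> J'" by (simp add: mult_ideals)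
  then show ?case
  proof (induction p rule: ideal_prod.induct)
    case (prod a b)
    have "(var x ^ k * a) * (var x * b) \<in> ideal_power K[Y] J k \<cdot>\<^bsub>K[Y]\<^esub> J"
      by (rule poly_prodI[OF Suc.IH[OF prod(1)] var_J'_in_J[OF prod(2)]])
    then show ?case by (simp add: mult_ideals mult_ac)
  next
    case (sum a b)
    show ?case unfolding distrib_left poly_ring_simps by (rule polys.ideal_add[OF ideal_pow(3) sum.IH])
  qed
qed

text \<open>Each of the \<open>min j t\<close> factors from \<open>J'\<close> takes one
  \<open>x\<close> and becomes an element of \<open>J\<close>, the factors from \<open>I\<close> are
  in \<open>J\<close> already, and surplus powers of \<open>x\<close> remain as a
  multiplier.\<close>

lemma var_pow_coeff_in: "p \<in> pow_coeff t j \<Longrightarrow> var x ^ j * p \<in> ideal_power K[Y] J t"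
  unfolding pow_coeff_def
proof (induction p rule: ideal_prod.induct)
  case (prod a b)
  let ?s = "min j t"
  have "a * (var x ^ ?s * b) \<in> ideal_power K[Y] J (t - j) \<cdot>\<^bsub>K[Y]\<^esub> ideal_power K[Y] J ?s"
    by (rule poly_prodI[OF subsetD[OF I_pow_sub prod(1)] var_J'_pow_in[OF prod(2)]])
  also have "\<dots> = ideal_power K[Y] J t"
  proof -
    have "t - j + ?s = t" by simp
    then show ?thesis using MY.nat_pow_mult[OF J_in, of "t - j" ?s] by (simp add: mult_ideals)
  qed
  finally have "var x ^ (j - ?s) * (a * (var x ^ ?s * b)) \<in> ideal_power K[Y] J t"
    by (rule polys.ideal_mult[OF ideal_pow(3) var_power_in_polys, rotated]) simp
  moreover have "var x ^ (j - ?s) * (a * (var x ^ ?s * b)) = var x ^ j * (a * b)"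
  proof -
    have "var x ^ j = (var x ^ (j - ?s) * var x ^ ?s :: 'k mpoly)" by (simp flip: power_add)
    then show ?thesis by (simp add: mult_ac)
  qed
  ultimately show ?case by simp
next
  case (sum a b)
  then show ?case using polys.ideal_add[OF ideal_pow(3)] by (simp add: distrib_left)
qed

lemma ideal_power_J: "ideal_power K[Y] J t = J_pow t"
proof
  show "J_pow t \<subseteq> ideal_power K[Y] J t"
  proof
    fix p assume p: "p \<in> J_pow t"
    obtain d where d: "\<forall>j\<ge>d. var_coeff x j p = 0" using var_coeff_eventually_0 by blast
    have "(\<Sum>j<d. var x ^ j * var_coeff x j p) \<in> ideal_power K[Y] J t"
      using p by (intro polys.ideal_sum[OF ideal_pow(3)] var_pow_coeff_in) (simp add: J_pow_def)
    then show "p \<in> ideal_power K[Y] J t" using var_coeff_expansion[of d x p] d by simp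
  qed
qed (rule pow_subset)

lemma quot_J_pow:
  "polys.quot Y (J_pow t) (var x ^ s) = {p \<in> polys Y. \<forall>j. var_coeff x j p \<in> pow_coeff t (j + s)}"
proof -
  have "(\<forall>j. var_coeff x j (p * var x ^ s) \<in> pow_coeff t j) \<longleftrightarrow>
      (\<forall>j. var_coeff x j p \<in> pow_coeff t (j + s))" for p
  proof -
    have c: "var_coeff x j (p * var x ^ s) = (if s \<le> j then var_coeff x (j - s) p else 0)" for j
      by (simp add: mult.commute[of p] var_coeff_var_power_mult)
    show ?thesis
    proof safe
      fix j assume "\<forall>j. var_coeff x j (p * var x ^ s) \<in> pow_coeff t j"
      from spec[OF this, of "j + s"] show "var_coeff x j p \<in> pow_coeff t (j + s)" by (simp add: c)
    next
      fix j assume "\<forall>j. var_coeff x j p \<in> pow_coeff t (j + s)"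
      from spec[OF this, of "j - s"] show "var_coeff x j (p * var x ^ s) \<in> pow_coeff t j"
        using polys.ideal_zero[OF ideal_pow_coeff] by (auto simp: c)
    qed
  qed
  then show ?thesis
    using var_power_in_polys[of x Y s] by (auto simp: polys.quot_def J_pow_def intro: polys.mult_in)
qed

lemma graded_quot_J_pow: "graded_in x (polys.quot Y (J_pow t) (var x ^ s))"
  unfolding graded_in_def quot_J_pow
proof safe
  fix p i assume p: "p \<in> polys Y" "\<forall>j. var_coeff x j p \<in> pow_coeff t (j + s)"
  have pX: "var_coeff x i p \<in> polys X" for i by (rule var_coeff_in[OF p(1)])
  show "var x ^ i * var_coeff x i p \<in> polys Y"
    using pX XY by (intro polys.mult_in var_power_in_polys) auto
  fix j show "var_coeff x j (var x ^ i * var_coeff x i p) \<in> pow_coeff t (j + s)"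
    using p(2) polys.ideal_zero[OF ideal_pow_coeff] by (auto simp: var_coeff_var_power_mult free[OF pX])
qed

lemma quot_J_pow_Int: "polys.quot Y (J_pow t) (var x ^ s) \<inter> polys X = pow_coeff t s"
proof
  show "polys.quot Y (J_pow t) (var x ^ s) \<inter> polys X \<subseteq> pow_coeff t s"
  proof
    fix p assume p: "p \<in> polys.quot Y (J_pow t) (var x ^ s) \<inter> polys X"
    then have "var_coeff x 0 p \<in> pow_coeff t (0 + s)" unfolding quot_J_pow by blast
    then show "p \<in> pow_coeff t s" using p by (simp add: free)
  qed
  show "pow_coeff t s \<subseteq> polys.quot Y (J_pow t) (var x ^ s) \<inter> polys X"
  proof
    fix p assume p: "p \<in> pow_coeff t s"
    then have "p \<in> polys X" by (rule polys.ideal_sub[OF ideal_pow_coeff])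
    then show "p \<in> polys.quot Y (J_pow t) (var x ^ s) \<inter> polys X"
      using p XY polys.ideal_zero[OF ideal_pow_coeff] by (auto simp: quot_J_pow free)
  qed
qed

text \<open>Raising the index makes it possible to split off a factor \<open>J'\<close>, which lies
  in \<open>aug X\<close>.\<close>

lemma pow_coeff_aug:
  assumes "t \<ge> 1"
  shows "pow_coeff t j \<subseteq> aug X"
proof -
  obtain s where s: "t = Suc s" using assms by (cases t) auto
  have "pow_coeff t j \<subseteq> pow_coeff t (Suc (max j s))" by (rule pow_coeff_mono) simp
  also have "\<dots> = pow_coeff s (max j s) \<cdot>\<^bsub>K[X]\<^esub> J'" by (simp add: s pow_coeff_mult_J')
  also have "\<dots> \<subseteq> J'"
    using polys.ideal_mult[OF J' polys.ideal_sub[OF ideal_pow_coeff]] by (intro prod_in_ideal[OF J'])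
  finally show ?thesis using J'_aug by blast
qed

lemma quot_J_pow_aug:
  assumes "t \<ge> 1"
  shows "polys.quot Y (J_pow t) (var x ^ s) \<subseteq> aug Y"
proof
  fix p assume "p \<in> polys.quot Y (J_pow t) (var x ^ s)"
  then have p: "p \<in> polys Y" "var_coeff x 0 p \<in> pow_coeff t (0 + s)" unfolding quot_J_pow by blast+
  then have "Poly_Mapping.lookup (var_coeff x 0 p) 0 = 0" using pow_coeff_aug[OF assms] by (auto simp: aug_def)
  then show "p \<in> aug Y" using p(1) by (simp add: aug_def lookup_var_coeff)
qed

lemma quot_quot: "polys.quot Y (polys.quot Y K (var x ^ s)) (var x) = polys.quot Y K (var x ^ Suc s)"
  for K :: "'k mpoly set"
  using var_in_polys[of x Y] by (auto simp: polys.quot_def mult.assoc intro: polys.mult_in)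

lemma power_colon_depths:
  assumes t: "t \<ge> 1" and s: "s < t"
  defines "U \<equiv> \<lambda>s. colon K[Y] (ideal_power K[Y] J t) (var x ^ s)"
    and "L \<equiv> ideal_power K[X] I (t - s) \<cdot>\<^bsub>K[X]\<^esub> ideal_power K[X] J' s"
  shows "depth_quot Y (U s) \<le> depth_quot X L + 1"
    and "depth_quot Y (U (Suc s)) > depth_quot Y (U s) \<Longrightarrow> depth_quot X L = depth_quot Y (U s)"
    and "sdepth_quot Y (U (Suc s)) > sdepth_quot Y (U s) \<Longrightarrow> sdepth_quot X L \<le> sdepth_quot Y (U s)"
proof -
  have U: "U s = polys.quot Y (J_pow t) (var x ^ s)" for s
    by (simp add: U_def colon_poly_ring ideal_power_J)
  have US: "U (Suc s) = polys.quot Y (U s) (var x)" by (simp only: U quot_quot)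
  \<comment> \<open>\<open>s < t\<close> turns \<open>min s t\<close> into \<open>s\<close>, so the
    \<open>s\<close>-th coefficient ideal is the product in the statement.\<close>
  have L: "L = U s \<inter> polys X" using s by (simp add: U quot_J_pow_Int L_def pow_coeff_def min_absorb1)
  have id: "polys.is_ideal Y (U s)"
    unfolding U by (rule polys.ideal_quot) (use ideal_pow(3) ideal_power_J in metis)
  have g: "graded_in x (U s)" unfolding U by (rule graded_quot_J_pow)
  have a: "U s \<subseteq> aug Y" for s unfolding U by (rule quot_J_pow_aug[OF t])
  have ne: "V \<noteq> polys Z" if "V \<subseteq> aug Z" for V :: "'k mpoly set" and Z
  proof -
    have "(1 :: 'k mpoly) \<in> polys Z - aug Z" by (simp add: polys.one_in aug_def)
    then show ?thesis using that by blast
  qed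
  have La: "U s \<inter> polys X \<subseteq> aug X" using a by (auto simp: aug_def)
  show "depth_quot Y (U s) \<le> depth_quot X L + 1"
    unfolding L by (rule depth_right_bound[OF fin x id g a]) (use a US in metis)
  show "depth_quot X L = depth_quot Y (U s)" if "depth_quot Y (U (Suc s)) > depth_quot Y (U s)"
    using that unfolding L US by (intro depth_right_eq[OF fin x id g a]) (use a US in metis)
  show "sdepth_quot X L \<le> sdepth_quot Y (U s)" if "sdepth_quot Y (U (Suc s)) > sdepth_quot Y (U s)"
    using that unfolding L US
    by (intro sdepth_quot_le[OF fin x id g ne[OF a] _ ne[OF La]]) (use ne[OF a] US in metis)
qed

end

text \<open>For a generator \<open>x h\<close> the factor \<open>h\<close> lies in
  \<open>J'\<close>, so every generator is in \<open>I S + x J' S\<close>. Conversely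
  \<open>c\<close> in \<open>J'\<close> means that \<open>x c\<close> is in \<open>M\<close>, and
  then so is \<open>x^j c\<close> for all \<open>j > 0\<close>.\<close>

lemma split_ideal_gen:
  fixes G G' :: "'k::field mpoly set"
  assumes fin: "finite X" and x: "x \<notin> X" and G': "G' \<subseteq> aug X" "G' \<subseteq> G"
    and G: "\<And>g. g \<in> G \<Longrightarrow> g \<in> G' \<or> (\<exists>h\<in>aug X. g = var x * h)"
  defines "I \<equiv> polys.gen X G'"
    and "M \<equiv> polys.gen (insert x X) G"
    and "J' \<equiv> polys.quot (insert x X) (polys.gen (insert x X) G) (var x) \<inter> polys X"
  shows "split_ideal X x I J'" and "split_ideal.J X x I J' = M"
proof -
  let ?Y = "insert x X"
  have XY: "polys X \<subseteq> (polys ?Y :: 'k mpoly set)" by (rule polys_mono) auto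
  have augX: "aug X \<subseteq> (polys X :: 'k mpoly set)" by (auto simp: aug_def)
  have xY: "var x \<in> (polys ?Y :: 'k mpoly set)" by (rule var_in_polys) simp
  have free: "var_coeff x j p = (if j = 0 then p else 0)" if "p \<in> polys X" for p :: "'k mpoly" and j
    by (rule var_coeff_free[OF that x])
  have GY: "G \<subseteq> polys ?Y"
  proof
    fix g assume "g \<in> G"
    from G[OF this] show "g \<in> polys ?Y"
    proof
      assume "g \<in> G'"
      then show ?thesis using G'(1) augX XY by blast
    next
      assume "\<exists>h\<in>aug X. g = var x * h"
      then show ?thesis using augX XY polys.mult_in[OF xY] by blast
    qed
  qed
  have M: "polys.is_ideal ?Y M" unfolding M_def by (rule polys.ideal_gen[OF GY])
  have I: "polys.is_ideal X I" unfolding I_def using G'(1) augX by (intro polys.ideal_gen) blast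
  have J'_eq: "J' = polys.quot ?Y M (var x) \<inter> polys X" by (simp add: J'_def M_def)
  have J': "polys.is_ideal X J'"
    unfolding J'_eq by (rule ideal_Int_polys[OF polys.ideal_quot[OF M]]) auto
  have GJ: "g \<in> M" if "g \<in> G" for g using polys.gen_superset[of G ?Y] that by (auto simp: M_def)
  have J'I: "p \<in> J'" if "p \<in> polys X" "var x * p \<in> M" for p
    using that XY by (auto simp: J'_eq polys.quot_def mult.commute)
  have "G' \<subseteq> J'"
  proof
    fix g assume g: "g \<in> G'"
    then have "var x * g \<in> M" using G'(2) by (intro polys.ideal_mult[OF M xY] GJ) auto
    then show "g \<in> J'" using g G'(1) augX by (intro J'I) auto
  qed
  then have IJ': "I \<subseteq> J'" unfolding I_def by (rule polys.gen_least[OF J'])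
  have IJ: "I \<subseteq> M"
  proof -
    have "polys.is_ideal X (M \<inter> polys X)" by (rule ideal_Int_polys[OF M]) auto
    moreover have "G' \<subseteq> M \<inter> polys X" using GJ G' augX by blast
    ultimately show ?thesis using polys.gen_least[of X "M \<inter> polys X" G'] by (auto simp: I_def)
  qed
  have J'_aug: "J' \<subseteq> aug X"
  proof -
    \<comment> \<open>The polynomials in which neither 1 nor \<open>x\<close> occurs as a term: an
      ideal containing \<open>G\<close>. Hence \<open>x p\<close> in \<open>M\<close> forces
      \<open>p\<close> to have zero constant term.\<close>
    define N where "N = {p \<in> polys ?Y. var_coeff x 0 p \<in> aug X \<and> var_coeff x 1 p \<in> (aug X :: 'k mpoly set)}"
    have "polys.is_ideal ?Y N"
    proof (rule polys.is_idealI)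
      fix r a :: "'k mpoly" assume r: "r \<in> polys ?Y" and a: "a \<in> N"
      have "var_coeff x 1 (r * a) = var_coeff x 0 r * var_coeff x 1 a + var_coeff x 1 r * var_coeff x 0 a"
        by (simp add: var_coeff_mult atMost_Suc)
      moreover have "var_coeff x 0 r * var_coeff x 1 a + var_coeff x 1 r * var_coeff x 0 a \<in> aug X"
        by (rule polys.ideal_add[OF ideal_aug polys.ideal_mult[OF ideal_aug var_coeff_in[OF r]]
              polys.ideal_mult[OF ideal_aug var_coeff_in[OF r]]]) (use a in \<open>auto simp: N_def\<close>)
      moreover have "var_coeff x 0 r * var_coeff x 0 a \<in> aug X"
        using polys.ideal_mult[OF ideal_aug var_coeff_in[OF r]] a by (auto simp: N_def)
      ultimately show "r * a \<in> N" using r a by (simp add: N_def var_coeff_0_mult polys.mult_in)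
    next
      fix a b :: "'k mpoly" assume "a \<in> N" "b \<in> N"
      then show "a + b \<in> N"
        by (simp add: N_def var_coeff_add polys.add_in polys.ideal_add[OF ideal_aug])
    qed (auto simp: N_def polys.zero_in polys.ideal_zero[OF ideal_aug])
    moreover have "G \<subseteq> N"
    proof
      fix g assume g: "g \<in> G"
      from G[OF g] show "g \<in> N"
      proof
        assume "g \<in> G'"
        then have "g \<in> aug X" "g \<in> polys X" using G'(1) augX by auto
        then show ?thesis using g GY polys.ideal_zero[OF ideal_aug] by (auto simp: N_def free)
      next
        assume "\<exists>h\<in>aug X. g = var x * h"
        then obtain h where h: "h \<in> aug X" "h \<in> polys X" "g = var x * h" using augX by blast
        then show ?thesis using g GY polys.ideal_zero[OF ideal_aug] by (auto simp: N_def var_coeff_var_mult free)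
      qed
    qed
    ultimately have JN: "M \<subseteq> N" unfolding M_def by (rule polys.gen_least)
    show ?thesis
    proof
      fix p assume "p \<in> J'"
      then have p: "p \<in> polys X" "var x * p \<in> N" using JN by (auto simp: J'_eq polys.quot_def mult.commute)
      then show "p \<in> aug X" by (auto simp: N_def var_coeff_var_mult free)
    qed
  qed
  interpret split_ideal X x I J'
    by unfold_locales (rule fin x I J' IJ' J'_aug)+
  show "split_ideal X x I J'" ..
  show "split_ideal.J X x I J' = M"
  proof
    show "M \<subseteq> split_ideal.J X x I J'" unfolding M_def
    proof (rule polys.gen_least[OF ideal_J], rule subsetI)
      fix g assume g: "g \<in> G"
      from G[OF g] show "g \<in> split_ideal.J X x I J'"
      proof
        assume "g \<in> G'"
        then show ?thesis using I_sub_J polys.gen_superset[of G' X] by (auto simp: I_def)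
      next
        assume "\<exists>h\<in>aug X. g = var x * h"
        then obtain h where h: "h \<in> polys X" "g = var x * h" using augX by blast
        then have "h \<in> J'" using GJ[OF g] by (intro J'I) auto
        then show ?thesis using var_J'_in_J h by simp
      qed
    qed
    show "split_ideal.J X x I J' \<subseteq> M"
    proof
      fix p assume p: "p \<in> split_ideal.J X x I J'"
      have summand: "var x ^ j * var_coeff x j p \<in> M" for j
      proof (cases j)
        case 0
        then show ?thesis using p IJ by (auto simp: J_def)
      next
        case (Suc i)
        then have "var_coeff x j p \<in> J'" using p by (simp add: J_def)
        then have "var x * var_coeff x j p \<in> M" by (simp add: J'_eq polys.quot_def mult.commute)
        then have "var x ^ i * (var x * var_coeff x j p) \<in> M"
          by (rule polys.ideal_mult[OF M var_power_in_polys, rotated]) simp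
        then show ?thesis using Suc by (simp add: mult_ac)
      qed
      obtain d where d: "\<forall>j\<ge>d. var_coeff x j p = 0" using var_coeff_eventually_0 by blast
      have "(\<Sum>j<d. var x ^ j * var_coeff x j p) \<in> M" by (rule polys.ideal_sum[OF M summand])
      then show "p \<in> M" using var_coeff_expansion[of d x p] d by simp
    qed
  qed
qed

section \<open>Path ideals\<close>

lemma prod_var_in_aug:
  assumes "finite T" "T \<noteq> {}" "\<And>j. j \<in> T \<Longrightarrow> v j \<in> X"
  shows "(\<Prod>j\<in>T. var (v j)) \<in> (aug X :: 'k::field mpoly set)"
proof -
  obtain i where i: "i \<in> T" using assms(2) by blast
  have "(\<Prod>j\<in>T - {i}. var (v j)) \<in> (polys X :: 'k mpoly set)"
    using assms(3) by (intro polys.prod_in var_in_polys) auto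
  then have "var (v i) * (\<Prod>j\<in>T - {i}. var (v j)) \<in> (aug X :: 'k mpoly set)"
    using assms(3)[OF i] by (intro polys.ideal_mult'[OF ideal_aug] var_in_aug)
  then show ?thesis using assms(1) i by (simp add: prod.remove[of T i])
qed

lemma cyc_eq: "1 \<le> a \<Longrightarrow> a \<le> n \<Longrightarrow> cyc n a = a"
  by (simp add: cyc_def)

text \<open>A path of \<open>m\<close> vertices starting at \<open>i\<close> either stops before
  \<open>n\<close> or runs through \<open>n\<close>. As \<open>m < n\<close> it meets
  \<open>n\<close> only once, and as \<open>m >= 2\<close> another vertex is left, so
  \<open>h\<close> has no constant term.\<close>

lemma cycle_path_generator:
  assumes m: "2 \<le> m" "m < n" and i: "1 \<le> i" "i \<le> n"
  shows "(i + m \<le> n \<and> (\<Prod>j<m. var (cyc n (i + j))) = (\<Prod>j<m. var (i + j) :: 'k::field mpoly)) \<or>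
    (\<exists>h\<in>aug {1..n - 1}. (\<Prod>j<m. var (cyc n (i + j))) = (var n * h :: 'k mpoly))"
proof (cases "i + m \<le> n")
  case True
  then have "(\<Prod>j<m. var (cyc n (i + j))) = (\<Prod>j<m. var (i + j) :: 'k mpoly)"
    using i by (intro prod.cong) (auto simp: cyc_eq)
  then show ?thesis using True by blast
next
  case False
  \<comment> \<open>\<open>n - i\<close> is the position at which the path reaches
    \<open>n\<close>.\<close>
  define T where "T = {..<m} - {n - i}"
  have ni: "n - i < m" "cyc n (i + (n - i)) = n" using False i by (auto simp: cyc_eq)
  have "(\<Prod>j<m. var (cyc n (i + j))) = (var n * (\<Prod>j\<in>T. var (cyc n (i + j))) :: 'k mpoly)"
    using ni by (simp add: T_def prod.remove[of "{..<m}" "n - i"])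
  moreover have "(\<Prod>j\<in>T. var (cyc n (i + j))) \<in> (aug {1..n - 1} :: 'k mpoly set)"
  proof (rule prod_var_in_aug)
    have "0 \<in> T \<or> 1 \<in> T" using m by (auto simp: T_def)
    then show "T \<noteq> {}" by blast
    show "finite T" by (simp add: T_def)
    fix j assume j: "j \<in> T"
    show "cyc n (i + j) \<in> {1..n - 1}"
    proof (cases "i + j \<le> n")
      case True
      then have "cyc n (i + j) = i + j" using i by (intro cyc_eq) auto
      then show ?thesis using True j i by (auto simp: T_def)
    next
      case False
      \<comment> \<open>Past \<open>n\<close> the vertex is \<open>i + j - n\<close>, which stays
        below \<open>n\<close> because \<open>j < m < n\<close>.\<close>
      then have "(i + j - 1) mod n = i + j - 1 - n"
        using m i j by (subst le_mod_geq) (auto simp: T_def)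
      then show ?thesis using False m i j by (auto simp: cyc_def T_def)
    qed
  qed
  ultimately show ?thesis by blast
qed

lemma poly_ring_pow: "p [^]\<^bsub>K[X]\<^esub> (k::nat) = p ^ k"
  by (induction k) (simp_all add: mult.commute)

theorem proposition3p2:
  fixes n m t :: nat
    and S S' :: "'k::field mpoly ring"
    and J J' I :: "'k mpoly set"
    and d :: "nat \<Rightarrow> enat"
    and s :: "nat \<Rightarrow> nat"
  assumes "n > m" and "m \<ge> 2" and "t \<ge> 1"
    and "S = K[{1..n}]" and "S' = K[{1..n-1}]"
    and "J = cycle_path_ideal n m"
    and "J' = colon S J (var n) \<inter> carrier S'"
    and "I = line_path_ideal (n - 1) m"
    and "\<And>k. k \<in> {1..t} \<Longrightarrow>
           d k = depth_quot {1..n-1} (ideal_power S' I (t + 1 - k) \<cdot>\<^bsub>S'\<^esub> ideal_power S' J' (k - 1))"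
    and "\<And>k. k \<in> {1..t} \<Longrightarrow>
           s k = sdepth_quot {1..n-1} (ideal_power S' I (t + 1 - k) \<cdot>\<^bsub>S'\<^esub> ideal_power S' J' (k - 1))"
  shows "\<forall>k \<in> {1..t}.
    (depth_quot {1..n} (colon S (ideal_power S J t) (var n [^]\<^bsub>S\<^esub> (k - 1))) \<le> d k + 1) \<and>
    (depth_quot {1..n} (colon S (ideal_power S J t) (var n [^]\<^bsub>S\<^esub> k)) >
       depth_quot {1..n} (colon S (ideal_power S J t) (var n [^]\<^bsub>S\<^esub> (k - 1))) \<longrightarrow>
     d k = depth_quot {1..n} (colon S (ideal_power S J t) (var n [^]\<^bsub>S\<^esub> (k - 1)))) \<and>
    (sdepth_quot {1..n} (colon S (ideal_power S J t) (var n [^]\<^bsub>S\<^esub> k)) >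
       sdepth_quot {1..n} (colon S (ideal_power S J t) (var n [^]\<^bsub>S\<^esub> (k - 1))) \<longrightarrow>
     s k \<le> sdepth_quot {1..n} (colon S (ideal_power S J t) (var n [^]\<^bsub>S\<^esub> (k - 1))))"
proof
  fix k assume k: "k \<in> {1..t}"
  let ?X = "{1..n - 1}"
  define G :: "'k mpoly set" where "G = {\<Prod>j<m. var (cyc n (i + j)) | i. 1 \<le> i \<and> i \<le> n}"
  \<comment> \<open>\<open>i + m <= n\<close> is the bound \<open>i + m <= N + 1\<close> of the path
    ideal for \<open>N = n - 1\<close>.\<close>
  define G' :: "'k mpoly set" where "G' = {\<Prod>j<m. var (i + j) | i. 1 \<le> i \<and> i + m \<le> n}"
  have Y: "{1..n} = insert n ?X" using assms(1) by auto
  have G'aug: "G' \<subseteq> aug ?X"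
  proof
    fix g assume "g \<in> G'"
    then obtain i where i: "1 \<le> i" "i + m \<le> n" "g = (\<Prod>j<m. var (i + j))" by (auto simp: G'_def)
    show "g \<in> aug ?X" unfolding i(3) using i(1,2) assms(2) by (intro prod_var_in_aug) (auto simp: lessThan_empty_iff)
  qed
  have G'G: "G' \<subseteq> G"
  proof
    fix g assume "g \<in> G'"
    then obtain i where i: "1 \<le> i" "i + m \<le> n" "g = (\<Prod>j<m. var (i + j))" by (auto simp: G'_def)
    then have "g = (\<Prod>j<m. var (cyc n (i + j)))"
      unfolding i(3) by (intro prod.cong) (auto simp: cyc_eq)
    then show "g \<in> G" using i(1,2) unfolding G_def by auto
  qed
  have split: "g \<in> G' \<or> (\<exists>h\<in>aug ?X. g = var n * h)" if "g \<in> G" for g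
  proof -
    from that obtain i where i: "1 \<le> i" "i \<le> n" "g = (\<Prod>j<m. var (cyc n (i + j)))" by (auto simp: G_def)
    show ?thesis using cycle_path_generator[OF assms(2,1) i(1,2), where ?'k = 'k] i unfolding G'_def by auto
  qed
  have J_gen: "J = polys.gen (insert n ?X) G"
    unfolding assms(6) cycle_path_ideal_def genideal_poly_ring Y G_def ..
  have I_gen: "I = polys.gen ?X G'"
    using assms(1) unfolding assms(8) line_path_ideal_def genideal_poly_ring G'_def by simp
  have J'_gen: "J' = polys.quot (insert n ?X) (polys.gen (insert n ?X) G) (var n) \<inter> polys ?X"
    unfolding assms(4,5,7) colon_poly_ring J_gen Y by simp
  have n: "n \<notin> ?X" using assms(1) by auto
  interpret split_ideal ?X n I J'
    unfolding I_gen J'_gen by (rule split_ideal_gen[OF _ n G'aug G'G split]) auto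
  have JJ: "split_ideal.J ?X n I J' = J"
    unfolding I_gen J'_gen J_gen by (rule split_ideal_gen[OF _ n G'aug G'G split]) auto
  \<comment> \<open>With \<open>k = l + 1\<close> the exponents \<open>t + 1 - k\<close> and
    \<open>k - 1\<close> become \<open>t - l\<close> and \<open>l\<close>, and the colon powers are
    \<open>l\<close> and \<open>l + 1\<close>.\<close>
  obtain l where l: "k = Suc l" "l < t" using k by (cases k) auto
  have d: "d k = depth_quot ?X (ideal_power K[?X] I (t - l) \<cdot>\<^bsub>K[?X]\<^esub> ideal_power K[?X] J' l)"
    and s: "s k = sdepth_quot ?X (ideal_power K[?X] I (t - l) \<cdot>\<^bsub>K[?X]\<^esub> ideal_power K[?X] J' l)"
    using assms(9,10)[OF k] by (simp_all add: assms(5) l(1))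
  show "(depth_quot {1..n} (colon S (ideal_power S J t) (var n [^]\<^bsub>S\<^esub> (k - 1))) \<le> d k + 1) \<and>
    (depth_quot {1..n} (colon S (ideal_power S J t) (var n [^]\<^bsub>S\<^esub> k)) >
       depth_quot {1..n} (colon S (ideal_power S J t) (var n [^]\<^bsub>S\<^esub> (k - 1))) \<longrightarrow>
     d k = depth_quot {1..n} (colon S (ideal_power S J t) (var n [^]\<^bsub>S\<^esub> (k - 1)))) \<and>
    (sdepth_quot {1..n} (colon S (ideal_power S J t) (var n [^]\<^bsub>S\<^esub> k)) >
       sdepth_quot {1..n} (colon S (ideal_power S J t) (var n [^]\<^bsub>S\<^esub> (k - 1))) \<longrightarrow>
     s k \<le> sdepth_quot {1..n} (colon S (ideal_power S J t) (var n [^]\<^bsub>S\<^esub> (k - 1))))"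
    using power_colon_depths[OF assms(3) l(2), unfolded JJ]
    unfolding d s unfolding assms(4) Y poly_ring_pow l(1) diff_Suc_1 by (intro conjI impI)
qed

end
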